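(* Let $\mathfrak g$ be a finite dimensional Lie algebra over $\mathbb C$ and $Z\in\wedge^3(\mathfrak g)^{\mathfrak g}$. 1) Set $\rho_Z=\sum_{n\ge0}c_nZ^{(n+1)}$. Then $\rho_Z$ is an element of $(\widehat S^\cdot(\mathfrak g)\otimes\wedge^2(\mathfrak g))^{\mathfrak g}$, i.e. it can be viewed as a $\mathfrak g$-invariant formal map $\mathfrak g^*\to\wedge^2(\mathfrak g)$. Moreover, it satisfies the modified classical dynamical Yang-Baxter equation for $(\mathfrak g,Z)$: $$-\mathrm{Alt}(d\rho_Z)+\mathrm{CYB}(\rho_Z)=Z.$$ 2) When $\mathfrak g$ is equipped with an element $t\in S^2(\mathfrak g)^{\mathfrak g}$ and $Z=\frac14[t^{1,2},t^{2,3}]$, then $\rho_Z$ coincides with $\rho_{\mathrm{AM}}$.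
   Context: $\widehat S^\cdot(\mathfrak g)$ is the degree completion of the symmetric algebra $S^\cdot(\mathfrak g)$, i.e. the algebra of formal functions at $0$ on $\mathfrak g^*$. Superscripts indicate placement in tensor factors. $Z_n=\mathrm{Sym}_{2,3,\dots,2n}([Z^{1,2,3},[Z^{3,4,5},\dots,Z^{2n-1,2n,2n+1}]])\in\mathfrak g^{\otimes2n+1}$ for $n\ge1$, where the iterated commutator is taken in $U(\mathfrak g)^{\otimes2n+1}$ and $\mathrm{Sym}_{2,\dots,2n}$ is the average over all permutations of the tensor factors $2,\dots,2n$. $Z^{(n)}:\mathfrak g^*\to\wedge^2(\mathfrak g)$ is the degree $2n-1$ map $Z^{(n)}(\lambda)=\langle Z_n,\mathrm{id}\otimes\lambda\otimes\cdots\otimes\lambda\otimes\mathrm{id}\rangle$. The numbers $c_n$ ($n\ge0$) are defined by $-\frac1z+\coth(z)=\sum_{n\ge0}c_nz^{2n+1}$, i.e. $c_n=2^{2n+2}B_{2n+2}/(2n+2)!$ with $B_k$ the $k$th Bernoulli number. For dual bases $(h_i)$, $(\lambda_i)$ of $\mathfrak g$, $\mathfrak g^*$: $\mathrm{Alt}(d\rho)=\sum_ih_i^1\frac{\partial\rho^{2,3}}{\partial\lambda_i}-\sum_ih_i^2\frac{\partial\rho^{1,3}}{\partial\lambda_i}+\sum_ih_i^3\frac{\partial\rho^{1,2}}{\partial\lambda_i}$ and $\mathrm{CYB}(\rho)=[\rho^{1,2},\rho^{1,3}]+[\rho^{1,2},\rho^{2,3}]+[\rho^{1,3},\rho^{2,3}]$.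 $\rho_{\mathrm{AM}}(\lambda)=\varphi(1\otimes\mathrm{ad}\,t^\vee(\lambda))(t)$, where $t^\vee(\lambda)=(\lambda\otimes\mathrm{id})(t)$ and $\varphi(z)=-\frac1z+\frac12\coth\frac z2$ (expanded as a power series at $z=0$). *)

theory Defs
  imports
    "HOL-Analysis.Analysis"
    "HOL-Library.Poly_Mapping"
    "HOL-Library.Function_Algebras"
    "HOL-Combinatorics.Permutations"
    "HOL-Computational_Algebra.Formal_Laurent_Series"
begin

section \<open>Complex Lie algebras\<close>

class complex_lie_algebra = ab_group_add +
  fixes scaleC :: "complex \<Rightarrow> 'a \<Rightarrow> 'a" (infixr \<open>*\<^sub>C\<close> 75)
    and lie :: "'a \<Rightarrow> 'a \<Rightarrow> 'a"
  assumes scaleC_add_right: "a *\<^sub>C (x + y) = a *\<^sub>C x + a *\<^sub>C y"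
    and scaleC_add_left: "(a + b) *\<^sub>C x = a *\<^sub>C x + b *\<^sub>C x"
    and scaleC_scaleC: "a *\<^sub>C (b *\<^sub>C x) = (a * b) *\<^sub>C x"
    and scaleC_one: "1 *\<^sub>C x = x"
    and lie_add_left: "lie (x + y) z = lie x z + lie y z"
    and lie_add_right: "lie x (y + z) = lie x y + lie x z"
    and lie_scaleC_left: "lie (a *\<^sub>C x) y = a *\<^sub>C lie x y"
    and lie_scaleC_right: "lie x (a *\<^sub>C y) = a *\<^sub>C lie x y"
    and lie_self: "lie x x = 0"
    and jacobi: "lie x (lie y z) + lie y (lie z x) + lie z (lie x y) = 0"

global_interpretation cvec: vector_space "scaleC :: complex \<Rightarrow> 'g \<Rightarrow> 'g::complex_lie_algebra"
  by unfold_locales (simp_all add: scaleC_add_right scaleC_add_left scaleC_scaleC scaleC_one)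

text \<open>
  Finite dimensionality is expressed by the library locale predicate
  \<^term>\<open>finite_dimensional_vector_space scaleC B\<close>, which says that \<open>B\<close> is a finite
  basis.  Constants with an argument \<open>B\<close> use this basis as the \<open>(h\<^sub>i)\<close> and
  \<open>coord B b\<close>, \<open>b \<in> B\<close>, as the dual basis \<open>(\<lambda>\<^sub>i)\<close>.
\<close>

definition dual :: "('g::complex_lie_algebra \<Rightarrow> complex) set" where
  "dual = {\<alpha>. Vector_Spaces.linear scaleC (*) \<alpha>}"

definition coord :: "'g::complex_lie_algebra set \<Rightarrow> 'g \<Rightarrow> 'g \<Rightarrow> complex" where
  "coord B b = (\<lambda>v. cvec.representation B v b)"


section \<open>Tensors\<close>

text \<open>
  Since \<open>\<gg>\<close> is finite dimensional, \<open>\<gg>\<^sup>\<otimes>\<^sup>N\<close> is the space of \<open>N\<close>-linear forms on \<open>\<gg>\<^sup>*\<close>: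
  the tensor \<open>x\<^sub>1 \<otimes> \<dots> \<otimes> x\<^sub>N\<close> is the form \<open>[\<alpha>\<^sub>1, \<dots>, \<alpha>\<^sub>N] \<mapsto> \<alpha>\<^sub>1(x\<^sub>1) \<dots> \<alpha>\<^sub>N(x\<^sub>N)\<close>.  Forms are
  extended by zero to all other lists, so that equality of functions is equality of
  tensors.  List positions count from 0, tensor factors from 1.
\<close>

type_synonym 'g tensor = "('g \<Rightarrow> complex) list \<Rightarrow> complex"

definition tensors :: "nat \<Rightarrow> 'g::complex_lie_algebra tensor set" where
  "tensors N = {X.
     (\<forall>as. \<not> (length as = N \<and> set as \<subseteq> dual) \<longrightarrow> X as = 0) \<and>
     (\<forall>as i. length as = N \<and> set as \<subseteq> dual \<and> i < N \<longrightarrow>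
        (\<forall>\<beta>\<in>dual. \<forall>\<gamma>\<in>dual.
           X (as[i := (\<lambda>v. \<beta> v + \<gamma> v)]) = X (as[i := \<beta>]) + X (as[i := \<gamma>])) \<and>
        (\<forall>\<beta>\<in>dual. \<forall>c. X (as[i := (\<lambda>v. c * \<beta> v)]) = c * X (as[i := \<beta>])))}"

definition wedge :: "nat \<Rightarrow> 'g::complex_lie_algebra tensor set" where
  "wedge N = {X \<in> tensors N. \<forall>\<sigma> as. \<sigma> permutes {..<N} \<and> length as = N \<longrightarrow>
     X (permute_list \<sigma> as) = of_int (sign \<sigma>) * X as}"

definition sym_tensors :: "nat \<Rightarrow> 'g::complex_lie_algebra tensor set" where
  "sym_tensors N = {X \<in> tensors N. \<forall>\<sigma> as. \<sigma> permutes {..<N} \<and> length as = N \<longrightarrow>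
     X (permute_list \<sigma> as) = X as}"

text \<open>The diagonal adjoint action of \<open>x\<close> on \<open>\<gg>\<^sup>\<otimes>\<^sup>N\<close>.\<close>

definition tensor_act :: "'g::complex_lie_algebra \<Rightarrow> 'g tensor \<Rightarrow> 'g tensor" where
  "tensor_act x X = (\<lambda>as. \<Sum>i<length as. X (as[i := (\<lambda>v. (as ! i) (lie x v))]))"

definition invariant_tensor :: "nat \<Rightarrow> 'g::complex_lie_algebra tensor \<Rightarrow> bool" where
  "invariant_tensor N X \<longleftrightarrow>
     (\<forall>x as. length as = N \<and> set as \<subseteq> dual \<longrightarrow> tensor_act x X as = 0)"


section \<open>The algebras $U(\mathfrak g)^{\otimes N}$\<close>

datatype 'a fword = FWord (letters: "'a list")

instantiation fword :: (type) monoid_add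
begin
definition "0 = FWord []"
definition "u + v = FWord (letters u @ letters v)"
instance
  by standard (auto simp: zero_fword_def plus_fword_def)
end

text \<open>
  \<open>'a free_alg\<close> is the free unital algebra on the set \<open>'a\<close>: the monoid algebra of words,
  with the convolution product of \<^typ>\<open>'k \<Rightarrow>\<^sub>0 'v\<close>.  The universal enveloping algebra
  \<open>U(\<gg>)\<close> is its quotient by the two-sided ideal \<open>uea_ideal\<close>.
\<close>

type_synonym 'a free_alg = "'a fword \<Rightarrow>\<^sub>0 complex"

definition letter :: "'a \<Rightarrow> 'a free_alg" where
  "letter x = Poly_Mapping.single (FWord [x]) 1"

inductive_set uea_ideal :: "'g::complex_lie_algebra free_alg set" where
  "letter (x + y) - letter x - letter y \<in> uea_ideal"
| "letter (c *\<^sub>C x) - Poly_Mapping.single 0 c * letter x \<in> uea_ideal"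
| "letter x * letter y - letter y * letter x - letter (lie x y) \<in> uea_ideal"
| "p \<in> uea_ideal \<Longrightarrow> q \<in> uea_ideal \<Longrightarrow> p + q \<in> uea_ideal"
| "p \<in> uea_ideal \<Longrightarrow> a * p \<in> uea_ideal"
| "p \<in> uea_ideal \<Longrightarrow> p * a \<in> uea_ideal"

text \<open>
  Tensor powers of the free algebra \<open>F\<close>: the basis elements of \<open>F\<^sup>\<otimes>\<^sup>N\<close> are the families of
  words \<open>m\<close> with one word \<open>m i\<close> for each factor \<open>i \<in> {1..N}\<close>, and these are multiplied
  factor by factor.  Families indexed by all of \<^typ>\<open>nat\<close> contain all \<open>F\<^sup>\<otimes>\<^sup>N\<close> at once.
\<close>

type_synonym 'a free_tpow = "(nat \<Rightarrow> 'a fword) \<Rightarrow>\<^sub>0 complex"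

definition tpow :: "nat \<Rightarrow> 'a free_tpow set" where
  "tpow N = {p. \<forall>m\<in>Poly_Mapping.keys p. \<forall>i. i \<notin> {1..N} \<longrightarrow> m i = 0}"

definition in_factor :: "nat \<Rightarrow> 'a free_alg \<Rightarrow> 'a free_tpow" where
  "in_factor i p = (\<Sum>w\<in>Poly_Mapping.keys p.
     Poly_Mapping.single (\<lambda>j. if j = i then w else 0) (Poly_Mapping.lookup p w))"

definition scalar :: "complex \<Rightarrow> 'a free_tpow" where
  "scalar c = Poly_Mapping.single 0 c"

text \<open>
  With \<open>I = uea_ideal\<close>, the kernel of \<open>F\<^sup>\<otimes>\<^sup>N \<rightarrow> (F/I)\<^sup>\<otimes>\<^sup>N = U(\<gg>)\<^sup>\<otimes>\<^sup>N\<close> is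
  \<open>\<Sum>\<^sub>i F \<otimes> \<dots> \<otimes> I \<otimes> \<dots> \<otimes> F\<close>, the ideal generated by the copies of \<open>I\<close> in the
  factors \<open>1, \<dots>, N\<close>.  Elements of \<open>U(\<gg>)\<^sup>\<otimes>\<^sup>N\<close> are represented in \<open>F\<^sup>\<otimes>\<^sup>N\<close> and compared
  by \<open>upow_eq N\<close>.
\<close>

inductive_set upow_ideal :: "nat \<Rightarrow> 'g::complex_lie_algebra free_tpow set" for N where
  "0 \<in> upow_ideal N"
| "p \<in> uea_ideal \<Longrightarrow> i \<in> {1..N} \<Longrightarrow> in_factor i p \<in> upow_ideal N"
| "p \<in> upow_ideal N \<Longrightarrow> q \<in> upow_ideal N \<Longrightarrow> p + q \<in> upow_ideal N"
| "p \<in> upow_ideal N \<Longrightarrow> a \<in> tpow N \<Longrightarrow> a * p \<in> upow_ideal N"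
| "p \<in> upow_ideal N \<Longrightarrow> a \<in> tpow N \<Longrightarrow> p * a \<in> upow_ideal N"

definition upow_eq ::
    "nat \<Rightarrow> 'g::complex_lie_algebra free_tpow \<Rightarrow> 'g free_tpow \<Rightarrow> bool" where
  "upow_eq N p q \<longleftrightarrow> p - q \<in> upow_ideal N"

definition comm :: "'a free_tpow \<Rightarrow> 'a free_tpow \<Rightarrow> 'a free_tpow" where
  "comm p q = p * q - q * p"

definition gen :: "nat \<Rightarrow> 'a \<Rightarrow> 'a free_tpow" where
  "gen i x = in_factor i (letter x)"

text \<open>
  \<open>place B [i\<^sub>1, \<dots>, i\<^sub>k] X\<close> represents \<open>X\<^bsup>i\<^sub>1,\<dots>,i\<^sub>k\<^esup>\<close> for \<open>X \<in> \<gg>\<^sup>\<otimes>\<^sup>k\<close>, using the expansion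
  \<open>X = \<Sum> X(b\<^sub>1\<^sup>*, \<dots>, b\<^sub>k\<^sup>*) b\<^sub>1 \<otimes> \<dots> \<otimes> b\<^sub>k\<close> over the basis \<open>B\<close>.
\<close>

definition place ::
    "'g::complex_lie_algebra set \<Rightarrow> nat list \<Rightarrow> 'g tensor \<Rightarrow> 'g free_tpow" where
  "place B is X = (\<Sum>bs\<in>{bs. set bs \<subseteq> B \<and> length bs = length is}.
     scalar (X (map (coord B) bs)) * prod_list (map2 gen is bs))"


section \<open>The maps $Z^{(n)}$\<close>

text \<open>\<open>iter_comm B Z i m = [Z\<^bsup>i,i+1,i+2\<^esup>, [Z\<^bsup>i+2,i+3,i+4\<^esup>, \<dots>]]\<close> with \<open>m + 1\<close> occurrences of \<open>Z\<close>.\<close>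

primrec iter_comm ::
    "'g::complex_lie_algebra set \<Rightarrow> 'g tensor \<Rightarrow> nat \<Rightarrow> nat \<Rightarrow> 'g free_tpow" where
  "iter_comm B Z i 0 = place B [i, i + 1, i + 2] Z"
| "iter_comm B Z i (Suc m) = comm (place B [i, i + 1, i + 2] Z) (iter_comm B Z (i + 2) m)"

text \<open>
  The element of \<open>\<gg>\<^sup>\<otimes>\<^sup>N \<subseteq> U(\<gg>)\<^sup>\<otimes>\<^sup>N\<close> represented by \<open>p\<close>; it is unique because
  \<open>\<gg> \<rightarrow> U(\<gg>)\<close> is injective (Poincare-Birkhoff-Witt).
\<close>

definition tensor_of ::
    "'g::complex_lie_algebra set \<Rightarrow> nat \<Rightarrow> 'g free_tpow \<Rightarrow> 'g tensor" where
  "tensor_of B N p = (THE X. X \<in> tensors N \<and> upow_eq N (place B [1..<N + 1] X) p)"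

text \<open>The average over all permutations of the tensor factors \<open>2, \<dots>, 2n\<close>.\<close>

definition Sym_mid :: "nat \<Rightarrow> 'g tensor \<Rightarrow> 'g tensor" where
  "Sym_mid n X = (\<lambda>as.
     (\<Sum>\<sigma> | \<sigma> permutes {1..<2 * n}. X (permute_list \<sigma> as)) / fact (2 * n - 1))"

definition Z_sub ::
    "'g::complex_lie_algebra set \<Rightarrow> 'g tensor \<Rightarrow> nat \<Rightarrow> 'g tensor" where
  "Z_sub B Z n = Sym_mid n (tensor_of B (2 * n + 1) (iter_comm B Z 1 (n - 1)))"

definition Z_sup ::
    "'g::complex_lie_algebra set \<Rightarrow> 'g tensor \<Rightarrow> nat \<Rightarrow> ('g \<Rightarrow> complex) \<Rightarrow> 'g tensor" where
  "Z_sup B Z n l = (\<lambda>as. case as of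
       [\<alpha>, \<beta>] \<Rightarrow> Z_sub B Z n (\<alpha> # replicate (2 * n - 1) l @ [\<beta>])
     | _ \<Rightarrow> 0)"


section \<open>Formal maps from $\mathfrak g^*$ to $\wedge^2(\mathfrak g)$\<close>

text \<open>
  An element of the degree completion \<open>\<Prod>\<^sub>k S\<^sup>k(\<gg>) \<otimes> \<wedge>\<^sup>2(\<gg>)\<close> is given by its homogeneous
  components \<open>\<rho> k\<close>; these are polynomial maps \<open>\<gg>\<^sup>* \<rightarrow> \<wedge>\<^sup>2(\<gg>)\<close> of degree \<open>k\<close>, that is,
  restrictions to the diagonal of \<open>k\<close>-linear maps.
\<close>

type_synonym 'g formal_map = "nat \<Rightarrow> ('g \<Rightarrow> complex) \<Rightarrow> 'g tensor"

definition formal_maps :: "'g::complex_lie_algebra formal_map set" where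
  "formal_maps = {\<rho>. \<forall>k.
     (\<forall>l\<in>dual. \<rho> k l \<in> wedge 2) \<and>
     (\<exists>T\<in>tensors (k + 2). \<forall>l\<in>dual. \<forall>as. length as = 2 \<longrightarrow>
        \<rho> k l as = T (replicate k l @ as))}"

definition dir_deriv ::
    "(('g \<Rightarrow> complex) \<Rightarrow> 'g tensor) \<Rightarrow> ('g \<Rightarrow> complex) \<Rightarrow> ('g \<Rightarrow> complex) \<Rightarrow> 'g tensor" where
  "dir_deriv P \<mu> l = (\<lambda>as. deriv (\<lambda>s. P (\<lambda>v. l v + s * \<mu> v) as) 0)"

text \<open>
  \<open>x \<in> \<gg>\<close> acts on \<open>S(\<gg>)\<close> by derivations extending \<open>ad x\<close>; on the function \<open>l \<mapsto> l h\<close>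
  given by \<open>h \<in> \<gg>\<close> this is \<open>l \<mapsto> l [x,h]\<close>, so on functions on \<open>\<gg>\<^sup>*\<close> it is the derivative
  in the direction \<open>l \<circ> ad x\<close>.
\<close>

definition invariant_formal_map :: "'g::complex_lie_algebra formal_map \<Rightarrow> bool" where
  "invariant_formal_map \<rho> \<longleftrightarrow> (\<forall>k x. \<forall>l\<in>dual. \<forall>as. length as = 2 \<and> set as \<subseteq> dual \<longrightarrow>
     dir_deriv (\<rho> k) (\<lambda>v. l (lie x v)) l as + tensor_act x (\<rho> k l) as = 0)"

text \<open>
  Degree \<open>k\<close> components, evaluated at \<open>l \<in> \<gg>\<^sup>*\<close>, of \<open>Alt(d\<rho>)\<close> and \<open>CYB(\<rho>)\<close>, as elements of
  \<open>U(\<gg>)\<^sup>\<otimes>\<^sup>3\<close>.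
\<close>

definition Alt_d :: "'g::complex_lie_algebra set \<Rightarrow> 'g formal_map \<Rightarrow>
    nat \<Rightarrow> ('g \<Rightarrow> complex) \<Rightarrow> 'g free_tpow" where
  "Alt_d B \<rho> k l =
     (\<Sum>h\<in>B. gen 1 h * place B [2, 3] (dir_deriv (\<rho> (k + 1)) (coord B h) l))
   - (\<Sum>h\<in>B. gen 2 h * place B [1, 3] (dir_deriv (\<rho> (k + 1)) (coord B h) l))
   + (\<Sum>h\<in>B. gen 3 h * place B [1, 2] (dir_deriv (\<rho> (k + 1)) (coord B h) l))"

definition CYB :: "'g::complex_lie_algebra set \<Rightarrow> 'g formal_map \<Rightarrow>
    nat \<Rightarrow> ('g \<Rightarrow> complex) \<Rightarrow> 'g free_tpow" where
  "CYB B \<rho> k l = (\<Sum>i\<le>k.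
       comm (place B [1, 2] (\<rho> i l)) (place B [1, 3] (\<rho> (k - i) l))
     + comm (place B [1, 2] (\<rho> i l)) (place B [2, 3] (\<rho> (k - i) l))
     + comm (place B [1, 3] (\<rho> i l)) (place B [2, 3] (\<rho> (k - i) l)))"

definition satisfies_mCDYBE ::
    "'g::complex_lie_algebra set \<Rightarrow> 'g tensor \<Rightarrow> 'g formal_map \<Rightarrow> bool" where
  "satisfies_mCDYBE B Z \<rho> \<longleftrightarrow> (\<forall>k. \<forall>l\<in>dual.
     upow_eq 3 (- Alt_d B \<rho> k l + CYB B \<rho> k l) (if k = 0 then place B [1, 2, 3] Z else 0))"


section \<open>The formal maps $\rho_Z$ and $\rho_{\mathrm{AM}}$\<close>

text \<open>The Laurent expansion of \<open>coth(a z)\<close> at \<open>z = 0\<close>, for \<open>a \<noteq> 0\<close>.\<close>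

definition fls_coth :: "complex \<Rightarrow> complex fls" where
  "fls_coth a = fps_to_fls (fps_exp a + fps_exp (- a)) / fps_to_fls (fps_exp a - fps_exp (- a))"

definition c_coeff :: "nat \<Rightarrow> complex" where
  "c_coeff n = fls_nth (- fls_X_inv + fls_coth 1) (int (2 * n + 1))"

definition rho_Z :: "'g::complex_lie_algebra set \<Rightarrow> 'g tensor \<Rightarrow> 'g formal_map" where
  "rho_Z B Z k l = (\<lambda>as. \<Sum>n | 2 * n + 1 = k. c_coeff n * Z_sup B Z (n + 1) l as)"

definition phi :: "complex fls" where
  "phi = - fls_X_inv + fls_const (1 / 2) * fls_coth (1 / 2)"

definition t_check ::
    "'g::complex_lie_algebra set \<Rightarrow> 'g tensor \<Rightarrow> ('g \<Rightarrow> complex) \<Rightarrow> 'g" where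
  "t_check B t l = (\<Sum>b\<in>B. t [l, coord B b] *\<^sub>C b)"

definition id_tensor_ad :: "'g::complex_lie_algebra \<Rightarrow> 'g tensor \<Rightarrow> 'g tensor" where
  "id_tensor_ad y X = (\<lambda>as. case as of [\<alpha>, \<beta>] \<Rightarrow> X [\<alpha>, \<lambda>v. \<beta> (lie y v)] | _ \<Rightarrow> 0)"

text \<open>As \<open>t_check B t l\<close> is linear in \<open>l\<close>, the \<open>z\<^sup>k\<close> term of \<open>\<phi>\<close> gives the degree \<open>k\<close> component.\<close>

definition rho_AM :: "'g::complex_lie_algebra set \<Rightarrow> 'g tensor \<Rightarrow> 'g formal_map" where
  "rho_AM B t k l = (\<lambda>as. fls_nth phi (int k) * (id_tensor_ad (t_check B t l) ^^ k) t as)"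

end

theory Submission
  imports Defs
begin

text \<open>
  For \<open>\<lambda> \<in> \<gg>\<^sup>*\<close> let \<open>r\<^sub>\<lambda> : \<gg>\<^sup>* \<rightarrow> \<gg>\<close> be the contraction of \<open>Z\<close> with \<open>\<lambda>\<close> in its middle slot, and
  \<open>\<omega>\<^sub>\<lambda> : \<gg> \<rightarrow> \<gg>\<^sup>*\<close> the map \<open>x \<mapsto> \<lambda>([x, \<cdot>])\<close>.  Each bracket in
  \<open>[Z\<^bsup>1,2,3\<^esup>, [Z\<^bsup>3,4,5\<^esup>, \<dots>]]\<close> happens in a single tensor factor; evaluated at \<open>\<lambda>\<close> it contributes
  \<open>\<omega>\<^sub>\<lambda>\<close>, and each \<open>Z\<close> contributes \<open>r\<^sub>\<lambda>\<close>.  Hence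
  \<open>Z\<^sup>(\<^sup>n\<^sup>+\<^sup>1\<^sup>)(\<lambda>)(\<alpha>, \<beta>) = \<beta>(r\<^sub>\<lambda> (\<omega>\<^sub>\<lambda> r\<^sub>\<lambda>)\<^sup>n \<alpha>)\<close> (lemmas \<open>Z_sup_eq\<close>, \<open>chain_eq_double_ad_pow\<close>).

  The maps \<open>r\<^sub>\<lambda>\<close> and \<open>\<omega>\<^sub>\<lambda>\<close> are the two blocks of one operator \<open>A\<^sub>\<lambda>\<close> on \<open>\<gg> \<oplus> \<gg>\<^sup>*\<close>.  This operator is
  \<open>ad \<lambda>\<close> for the bracket on \<open>\<gg> \<oplus> \<gg>\<^sup>*\<close> that extends the bracket of \<open>\<gg>\<close> by the coadjoint action and
  by \<open>[\<alpha>, \<beta>] = -Z(\<alpha>, \<beta>, \<cdot>)\<close>.  So \<open>\<rho>\<^sub>Z(\<lambda>)\<close> is \<open>f(A\<^sub>\<lambda>)\<close> with \<open>f(z) = coth z - 1/z\<close>.  The canonical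
  pairing of \<open>\<gg> \<oplus> \<gg>\<^sup>*\<close> and the 3-form \<open>T(u, v, w) = \<langle>[u, v], w\<rangle>\<close> are invariant under \<open>A\<^sub>\<lambda>\<close>
  (lemmas \<open>pairing_double_ad\<close>, \<open>cubic_invariant\<close>); skew-symmetry and invariance of \<open>\<rho>\<^sub>Z\<close> are
  consequences of the first of these and of the equivariance of \<open>\<lambda> \<mapsto> A\<^sub>\<lambda>\<close>.

  For the dynamical Yang-Baxter equation, the derivative of \<open>A\<^sub>\<lambda>\<^sup>n\<close> in direction \<open>\<mu>\<close> is
  \<open>\<Sum> A\<^sub>\<lambda>\<^sup>i A\<^sub>\<mu> A\<^sub>\<lambda>\<^sup>j\<close>, and pairing with \<open>A\<^sub>\<mu>\<close> is evaluating \<open>T\<close> at \<open>\<mu>\<close>.  Every term of the equation,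
  evaluated at \<open>\<alpha>, \<beta>, \<gamma>\<close>, is therefore a combination of values
  \<open>T(A\<^sub>\<lambda>\<^sup>i \<alpha>, A\<^sub>\<lambda>\<^sup>j \<beta>, A\<^sub>\<lambda>\<^sup>k \<gamma>)\<close>, that is, a polynomial in commuting variables \<open>a, b, c\<close> applied to \<open>T\<close>,
  and by the invariance of \<open>T\<close> only the class of this polynomial modulo \<open>a + b + c\<close> matters.  In these terms the equation reads
  \<open>f(a)f(b) + f(b)f(c) + f(a)f(c) + (f(b) + f(c))/a + (f(a) + f(c))/b + (f(a) + f(b))/c = -1\<close>.
  Substituting \<open>f(z) = coth z - 1/z\<close>, the terms with \<open>1/a\<close>, \<open>1/b\<close>, \<open>1/c\<close> cancel, and there remains the
  addition theorem of \<open>coth\<close> (lemma \<open>trilinear_coth_identity\<close>).  The constant \<open>-1\<close> produces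
  \<open>-T(\<alpha>, \<beta>, \<gamma>) = Z(\<alpha>, \<beta>, \<gamma>)\<close>.

  In the second part, \<open>t\<close> viewed as a map \<open>\<gg>\<^sup>* \<rightarrow> \<gg>\<close> carries \<open>A\<^sub>\<lambda>\<^sup>2\<close> on \<open>\<gg>\<^sup>*\<close> to
  \<open>\<onequarter> (ad t\<^sup>\<or>(\<lambda>))\<^sup>2\<close>, and \<open>\<phi>(z) = \<onehalf> f(z/2)\<close>.

  All of this takes place in \<open>\<gg>\<^sup>\<otimes>\<^sup>N\<close>, whereas the objects are given by representatives in
  \<open>U(\<gg>)\<^sup>\<otimes>\<^sup>N\<close>.  The passage rests on the injectivity of \<open>\<gg>\<^sup>\<otimes>\<^sup>N \<rightarrow> U(\<gg>)\<^sup>\<otimes>\<^sup>N\<close> (lemma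
  \<open>tensor_zero_if_ideal\<close>), which is deduced from the degree one part of the Poincare-Birkhoff-Witt
  theorem: every linear form on \<open>\<gg>\<close> extends to \<open>U(\<gg>)\<close>.
\<close>

section \<open>Linear forms and coordinates\<close>

lemma dual_iff: "\<alpha> \<in> dual \<longleftrightarrow>
    (\<forall>x y. \<alpha> (x + y) = \<alpha> x + \<alpha> y) \<and> (\<forall>c x. \<alpha> (c *\<^sub>C x) = c * \<alpha> x)"
proof -
  have "vector_space ((*) :: complex \<Rightarrow> complex \<Rightarrow> complex)"
    by unfold_locales (simp_all add: algebra_simps)
  then show ?thesis
    by (simp add: dual_def Vector_Spaces.linear_iff cvec.vector_space_axioms)
qed

lemma dual_plus: "\<alpha> \<in> dual \<Longrightarrow> \<alpha> (x + y) = \<alpha> x + \<alpha> y"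
  and dual_scaleC: "\<alpha> \<in> dual \<Longrightarrow> \<alpha> (c *\<^sub>C x) = c * \<alpha> x"
  by (auto simp: dual_iff)

lemma dual_zero: "\<alpha> \<in> dual \<Longrightarrow> \<alpha> 0 = 0"
  using dual_scaleC[of \<alpha> 0 0] by simp

lemma dual_minus: "\<alpha> \<in> dual \<Longrightarrow> \<alpha> (- x) = - \<alpha> x"
  using dual_scaleC[of \<alpha> "-1" x] by simp

lemma dual_diff: "\<alpha> \<in> dual \<Longrightarrow> \<alpha> (x - y) = \<alpha> x - \<alpha> y"
  using dual_plus[of \<alpha> x "- y"] by (simp add: dual_minus)

lemma dual_sum: "\<alpha> \<in> dual \<Longrightarrow> \<alpha> (\<Sum>i\<in>I. f i) = (\<Sum>i\<in>I. \<alpha> (f i))"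
  by (induction I rule: infinite_finite_induct) (simp_all add: dual_zero dual_plus)

lemma dual_combination: "\<alpha> \<in> dual \<Longrightarrow> \<beta> \<in> dual \<Longrightarrow> (\<lambda>v. \<alpha> v + c * \<beta> v) \<in> dual"
  by (auto simp: dual_iff algebra_simps)

lemma dual_add_closed: "\<alpha> \<in> dual \<Longrightarrow> \<beta> \<in> dual \<Longrightarrow> (\<lambda>v. \<alpha> v + \<beta> v) \<in> dual"
  by (auto simp: dual_iff algebra_simps)

lemma dual_scale_closed: "\<alpha> \<in> dual \<Longrightarrow> (\<lambda>v. c * \<alpha> v) \<in> dual"
  by (auto simp: dual_iff algebra_simps)

lemma zero_in_dual: "(\<lambda>v. 0) \<in> dual"
  by (auto simp: dual_iff)

lemma dual_lie: "\<alpha> \<in> dual \<Longrightarrow> (\<lambda>v. \<alpha> (lie x v)) \<in> dual"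
  by (auto simp: dual_iff lie_add_right lie_scaleC_right)

lemma dual_lie_left: "\<alpha> \<in> dual \<Longrightarrow> (\<lambda>v. \<alpha> (lie v x)) \<in> dual"
  by (auto simp: dual_iff lie_add_left lie_scaleC_left)

lemma dual_lie_funpow: "\<beta> \<in> dual \<Longrightarrow> (\<lambda>v. \<beta> ((lie y ^^ j) v)) \<in> dual"
proof (induction j arbitrary: \<beta>)
  case (Suc j)
  then show ?case using Suc.IH[OF dual_lie[OF Suc.prems]] by simp
qed simp

lemma lie_zero_left [simp]: "lie 0 x = 0" and lie_zero_right [simp]: "lie x 0 = 0"
  using lie_add_left[of 0 0 x] lie_add_right[of x 0 0] by simp_all

lemma lie_swap: "lie x y = - lie y x"
proof -
  have "lie (x + y) (x + y) = 0" by (rule lie_self)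
  then have "lie x y + lie y x = 0"
    by (simp only: lie_add_left lie_add_right lie_self[of x] lie_self[of y]) (simp add: add.commute)
  then show ?thesis by (rule eq_neg_iff_add_eq_0[THEN iffD2])
qed

lemma lie_minus_right: "lie x (- y) = - lie x y"
  using lie_add_right[of x "- y" y] by (simp add: eq_neg_iff_add_eq_0)

lemma lie_sum_left: "lie (\<Sum>i\<in>I. f i) y = (\<Sum>i\<in>I. lie (f i) y)"
  by (induction I rule: infinite_finite_induct) (simp_all add: lie_add_left)

lemma lie_sum_right: "lie y (\<Sum>i\<in>I. f i) = (\<Sum>i\<in>I. lie y (f i))"
  by (induction I rule: infinite_finite_induct) (simp_all add: lie_add_right)

lemma lie_lie: "lie (lie x y) z = lie x (lie y z) - lie y (lie x z)"
proof -
  have "lie x (lie y z) + lie y (lie z x) + lie z (lie x y) = 0" by (rule jacobi)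
  then show ?thesis
    unfolding lie_swap[of z "lie x y"] lie_swap[of z x] lie_minus_right
    by (simp add: algebra_simps eq_diff_eq)
qed

locale lie_basis =
  fixes B :: "'g::complex_lie_algebra set"
  assumes basis: "finite_dimensional_vector_space (scaleC :: complex \<Rightarrow> 'g \<Rightarrow> 'g) B"
begin

lemma finite_B [simp]: "finite B"
  using finite_dimensional_vector_space.finite_Basis[OF basis] .

lemma independent_B: "cvec.independent B"
  using finite_dimensional_vector_space.independent_Basis[OF basis] .

lemma span_B: "cvec.span B = UNIV"
  using finite_dimensional_vector_space.span_Basis[OF basis] .

lemma coord_in_dual [simp]: "coord B b \<in> dual"
  by (simp add: dual_iff coord_def span_B independent_B cvec.representation_add
      cvec.representation_scale)

lemma coord_basis: "c \<in> B \<Longrightarrow> coord B b c = (if b = c then 1 else 0)"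
  by (simp add: coord_def cvec.representation_basis independent_B)

lemma coord_expansion: "(\<Sum>b\<in>B. coord B b x *\<^sub>C b) = x"
  unfolding coord_def
  by (rule cvec.sum_representation_eq) (simp_all add: independent_B span_B)

lemma dual_expansion: "\<alpha> \<in> dual \<Longrightarrow> (\<Sum>b\<in>B. coord B b x * \<alpha> b) = \<alpha> x"
  using arg_cong[OF coord_expansion[of x], of \<alpha>] by (simp add: dual_sum dual_scaleC)

section \<open>Extending linear forms to the universal enveloping algebra\<close>

text \<open>
  The basis has no order of its own; the reduction of words needs one.
\<close>

definition idx :: "'g \<Rightarrow> nat" where
  "idx = (SOME f. inj_on f B)"

lemma inj_idx: "inj_on idx B"
proof -
  have "\<exists>f :: 'g \<Rightarrow> nat. inj_on f B"
    using finite_imp_inj_to_nat_seg[of B] by auto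
  then show ?thesis unfolding idx_def by (rule someI_ex)
qed

text \<open>
  Exchanging the two letters of a descent lowers this number, so it can serve as a termination measure
  in place of the number of inversions.
\<close>

fun weight :: "'g list \<Rightarrow> nat" where
  "weight [] = 0"
| "weight (x # w) = idx x * length w + weight w"

lemma weight_swap: "idx c < idx b \<Longrightarrow> weight (u @ c # b # v) < weight (u @ b # c # v)"
  by (induction u) (auto simp: algebra_simps)

definition descent :: "'g list \<Rightarrow> 'g list \<times> 'g \<times> 'g \<times> 'g list \<Rightarrow> bool" where
  "descent w = (\<lambda>(u, b, c, v). w = u @ b # c # v \<and> idx c < idx b)"

text \<open>
  The linear form on \<open>U(\<gg>)\<close> that extends \<open>\<alpha>\<close> and vanishes on sorted words of length other than one,
  evaluated on words in the basis: a descent \<open>b c\<close> is rewritten by \<open>b c = c b + [b, c]\<close>.  An arbitrary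
  descent is chosen; confluence, shown below, is what makes the choice immaterial.
\<close>

function normal_value :: "('g \<Rightarrow> complex) \<Rightarrow> 'g list \<Rightarrow> complex" where
  "normal_value \<alpha> w = (if \<exists>d. descent w d
     then let d = (SOME d. descent w d); u = fst d; b = fst (snd d); c = fst (snd (snd d));
              v = snd (snd (snd d))
          in normal_value \<alpha> (u @ c # b # v) + (\<Sum>h\<in>B. coord B h (lie b c) * normal_value \<alpha> (u @ h # v))
     else (case w of [x] \<Rightarrow> \<alpha> x | _ \<Rightarrow> 0))"
  by pat_completeness auto
termination
proof (relation "measures [length \<circ> snd, weight \<circ> snd]", goal_cases)
  case 1
  show ?case by simp
next
  case (2 \<alpha> w d u b c v)
  then have "descent w d" by (metis someI_ex)
  moreover have "d = (u, b, c, v)" using 2 by simp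
  ultimately have "w = u @ b # c # v" "idx c < idx b" by (simp_all add: descent_def)
  then show ?case by (simp add: weight_swap)
next
  case (3 \<alpha> w d u b c v h)
  then have "descent w d" by (metis someI_ex)
  moreover have "d = (u, b, c, v)" using 3 by simp
  ultimately have "w = u @ b # c # v" by (simp add: descent_def)
  then show ?case by simp
qed

declare normal_value.simps [simp del]

definition bracket_term :: "('g \<Rightarrow> complex) \<Rightarrow> 'g list \<Rightarrow> 'g \<Rightarrow> 'g list \<Rightarrow> complex" where
  "bracket_term \<alpha> u x v = (\<Sum>h\<in>B. coord B h x * normal_value \<alpha> (u @ h # v))"

lemma bracket_term_add: "bracket_term \<alpha> u (x + y) v = bracket_term \<alpha> u x v + bracket_term \<alpha> u y v"
  by (simp add: bracket_term_def dual_plus[OF coord_in_dual] algebra_simps sum.distrib)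

lemma bracket_term_minus: "bracket_term \<alpha> u (- x) v = - bracket_term \<alpha> u x v"
  by (simp add: bracket_term_def dual_minus[OF coord_in_dual] sum_negf)

lemma bracket_term_diff: "bracket_term \<alpha> u (x - y) v = bracket_term \<alpha> u x v - bracket_term \<alpha> u y v"
  using bracket_term_add[of \<alpha> u x "- y" v] by (simp add: bracket_term_minus)

lemma bracket_term_zero: "bracket_term \<alpha> u 0 v = 0"
  by (simp add: bracket_term_def dual_zero[OF coord_in_dual])

text \<open>
  The defining relation of \<open>U(\<gg>)\<close> in the middle of a word in the basis.
\<close>

definition exchange :: "('g \<Rightarrow> complex) \<Rightarrow> 'g list \<Rightarrow> 'g \<Rightarrow> 'g \<Rightarrow> 'g list \<Rightarrow> bool" where
  "exchange \<alpha> u b c v \<longleftrightarrow> normal_value \<alpha> (u @ b # c # v) = normal_value \<alpha> (u @ c # b # v) + bracket_term \<alpha> u (lie b c) v"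

lemma normal_value_chosen_descent:
  assumes "descent w d"
  obtains u b c v where "descent w (u, b, c, v)" "normal_value \<alpha> w = normal_value \<alpha> (u @ c # b # v) + bracket_term \<alpha> u (lie b c) v"
proof -
  obtain u b c v where s: "(SOME d. descent w d) = (u, b, c, v)" by (metis surj_pair)
  have "descent w (u, b, c, v)" unfolding s[symmetric] by (rule someI[where P = "descent w", OF assms])
  moreover have "normal_value \<alpha> w = normal_value \<alpha> (u @ c # b # v) + bracket_term \<alpha> u (lie b c) v"
    using exI[where P = "descent w", OF assms] by (subst normal_value.simps) (simp only: s bracket_term_def Let_def if_True fst_conv snd_conv)
  ultimately show ?thesis by (rule that)
qed

text \<open>
  The exchange relation extends from a basis letter to a linear combination \<open>x\<close> of them, as both sides
  are linear in \<open>x\<close>.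
\<close>

lemma bracket_term_exchange:
  assumes "\<And>h. h \<in> B \<Longrightarrow> exchange \<alpha> u h c v"
  shows "bracket_term \<alpha> u x (c # v) = bracket_term \<alpha> (u @ [c]) x v + bracket_term \<alpha> u (lie x c) v"
proof -
  have "lie x c = (\<Sum>h\<in>B. coord B h x *\<^sub>C lie h c)"
    by (subst coord_expansion[of x, symmetric]) (simp add: lie_sum_left lie_scaleC_left)
  then have *: "coord B k (lie x c) = (\<Sum>h\<in>B. coord B h x * coord B k (lie h c))" for k
    by (simp add: dual_sum dual_scaleC)
  have "bracket_term \<alpha> u x (c # v) = (\<Sum>h\<in>B. coord B h x * (normal_value \<alpha> (u @ c # h # v) + bracket_term \<alpha> u (lie h c) v))"
    using assms by (simp add: bracket_term_def[of \<alpha> u x] exchange_def)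
  also have "\<dots> = bracket_term \<alpha> (u @ [c]) x v + (\<Sum>h\<in>B. coord B h x * bracket_term \<alpha> u (lie h c) v)"
    by (simp add: bracket_term_def[of \<alpha> "u @ [c]"] algebra_simps sum.distrib)
  also have "(\<Sum>h\<in>B. coord B h x * bracket_term \<alpha> u (lie h c) v) = bracket_term \<alpha> u (lie x c) v"
    unfolding bracket_term_def * sum_distrib_left sum_distrib_right
    by (subst sum.swap) (simp add: mult.assoc)
  finally show ?thesis .
qed

text \<open>
  The diamond lemma.  Two descents that do not overlap can be resolved in either order; for overlapping
  descents \<open>b c x\<close> the two ways of sorting the three letters differ by the Jacobi identity in shorter
  words, where the exchange relation is already known.
\<close>

lemma confluence_aux:
  assumes short: "\<And>u b c v. set (u @ b # c # v) \<subseteq> B \<Longrightarrow> length (u @ b # c # v) < length w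
                    \<Longrightarrow> exchange \<alpha> u b c v"
    and light: "\<And>u b c v. set (u @ b # c # v) \<subseteq> B \<Longrightarrow> length (u @ b # c # v) = length w
                    \<Longrightarrow> weight (u @ b # c # v) < weight w \<Longrightarrow> idx c < idx b \<Longrightarrow> exchange \<alpha> u b c v"
    and B: "set w \<subseteq> B"
    and d: "descent w (u, b, c, v)" and d': "descent w (u', b', c', v')"
    and le: "length u \<le> length u'"
  shows "normal_value \<alpha> (u @ c # b # v) + bracket_term \<alpha> u (lie b c) v = normal_value \<alpha> (u' @ c' # b' # v') + bracket_term \<alpha> u' (lie b' c') v'"
proof -
  have w: "w = u @ b # c # v" "w = u' @ b' # c' # v'" and lt: "idx c < idx b" "idx c' < idx b'"
    using d d' by (auto simp: descent_def)
  then obtain m where m: "u' = u @ m" "b # c # v = m @ b' # c' # v'"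
    using le by (metis append_eq_append_conv_if append_eq_conv_conj)
  consider "m = []" | "m = [b]" "c = b'" "v = c' # v'" | m' where "m = b # c # m'" "v = m' @ b' # c' # v'"
    using m(2) by (cases m; cases "tl m") auto
  then show ?thesis
  proof cases
    case 1
    with m show ?thesis by simp
  next
    \<comment> \<open>Overlapping descents: both sides are reduced to the same sorted triple \<open>x c b\<close>.\<close>
    case 2
    define x where "x = c'"
    have e: "u' = u @ [b]" "b' = c" "c' = x" "v = x # v'" using m 2 by (auto simp: x_def)
    note w = w(1)[unfolded e] and lt = lt[unfolded e]
    have S: "set u \<subseteq> B" "b \<in> B" "c \<in> B" "x \<in> B" "set v' \<subseteq> B" using B w by auto
    note l1 = weight_swap[OF lt(1), of u "x # v'"] and l2 = weight_swap[OF lt(2), of "u @ [b]" v']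
    have lt3: "idx x < idx b" using lt by simp
    note l3 = weight_swap[OF lt3, of "u @ [c]" v'] and l4 = weight_swap[OF lt3, of u "c # v'"]
    have x1: "exchange \<alpha> (u @ [c]) b x v'" using S l1 w lt3 by (intro light) auto
    have x2: "exchange \<alpha> u c x (b # v')" using S l1 l3 w lt by (intro light) auto
    have x3: "exchange \<alpha> u b x (c # v')" using S l2 w lt3 by (intro light) auto
    have x4: "exchange \<alpha> (u @ [x]) b c v'" using S l2 l4 w lt by (intro light) auto
    have b1: "bracket_term \<alpha> u (lie b c) (x # v') = bracket_term \<alpha> (u @ [x]) (lie b c) v' + bracket_term \<alpha> u (lie (lie b c) x) v'"
      using S w by (intro bracket_term_exchange short) auto
    have b2: "bracket_term \<alpha> u (lie b x) (c # v') = bracket_term \<alpha> (u @ [c]) (lie b x) v' + bracket_term \<alpha> u (lie (lie b x) c) v'"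
      using S w by (intro bracket_term_exchange short) auto
    have b3: "bracket_term \<alpha> u (lie c x) (b # v') = bracket_term \<alpha> (u @ [b]) (lie c x) v' + bracket_term \<alpha> u (lie (lie c x) b) v'"
      using S w by (intro bracket_term_exchange short) auto
    have "lie (lie b c) x + lie (lie c x) b - lie (lie b x) c = 0"
      unfolding lie_lie[of b c x] lie_swap[of "lie c x" b] lie_swap[of "lie b x" c] by simp
    then have "bracket_term \<alpha> u (lie (lie b c) x + lie (lie c x) b - lie (lie b x) c) v' = 0"
      by (simp add: bracket_term_zero)
    then have j: "bracket_term \<alpha> u (lie (lie b c) x) v' + bracket_term \<alpha> u (lie (lie c x) b) v' = bracket_term \<alpha> u (lie (lie b x) c) v'"
      by (simp add: bracket_term_add bracket_term_diff)
    show ?thesis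
      using x1 x2 x3 x4 b1 b2 b3 j unfolding e exchange_def by (simp add: algebra_simps)
  next
    \<comment> \<open>Disjoint descents: \<open>x1\<close> and \<open>x2\<close> perform the other exchange, and \<open>b1\<close>, \<open>b2\<close>, \<open>b3\<close> show that
      the two bracket corrections commute.\<close>
    case 3
    note e = m(1)[unfolded 3] 3(2)
    note w = w(1)[unfolded e]
    have S: "set u \<subseteq> B" "b \<in> B" "c \<in> B" "set m' \<subseteq> B" "b' \<in> B" "c' \<in> B" "set v' \<subseteq> B"
      using B w by auto
    note l1 = weight_swap[OF lt(1), of u "m' @ b' # c' # v'"]
      and l2 = weight_swap[OF lt(2), of "u @ b # c # m'" v']
    have x1: "exchange \<alpha> (u @ c # b # m') b' c' v'" using S l1 w lt by (intro light) auto
    have x2: "exchange \<alpha> u b c (m' @ c' # b' # v')" using S l2 w lt by (intro light) auto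
    have b1: "bracket_term \<alpha> u y (m' @ b' # c' # v') = bracket_term \<alpha> u y (m' @ c' # b' # v')
        + (\<Sum>h\<in>B. coord B h y * bracket_term \<alpha> (u @ h # m') (lie b' c') v')" for y
    proof -
      have "exchange \<alpha> (u @ h # m') b' c' v'" if "h \<in> B" for h
        using S w that by (intro short) auto
      then show ?thesis
        by (simp add: bracket_term_def[of \<alpha> u] exchange_def algebra_simps sum.distrib)
    qed
    have b2: "bracket_term \<alpha> (u @ b # c # m') y v' = bracket_term \<alpha> (u @ c # b # m') y v'
        + (\<Sum>k\<in>B. coord B k y * bracket_term \<alpha> u (lie b c) (m' @ k # v'))" for y
    proof -
      have "exchange \<alpha> u b c (m' @ k # v')" if "k \<in> B" for k
        using S w that by (intro short) auto
      then show ?thesis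
        by (simp add: bracket_term_def[of \<alpha> "_ @ _"] exchange_def algebra_simps sum.distrib)
    qed
    have b3: "(\<Sum>h\<in>B. coord B h y * bracket_term \<alpha> (u @ h # m') z v')
        = (\<Sum>k\<in>B. coord B k z * bracket_term \<alpha> u y (m' @ k # v'))" for y z
      unfolding bracket_term_def sum_distrib_left by (subst sum.swap) (simp add: mult.left_commute)
    show ?thesis
      using x1 x2 b1[of "lie b c"] b2[of "lie b' c'"] b3[of "lie b c" "lie b' c'"]
      unfolding e exchange_def by simp
  qed
qed

text \<open>
  The outer induction on the length supplies the shorter words, the inner induction on the weight the
  words of equal length; ascents follow from descents by antisymmetry.
\<close>

lemma normal_value_exchange: "set (u @ b # c # v) \<subseteq> B \<Longrightarrow> exchange \<alpha> u b c v"
proof (induction "length (u @ b # c # v)" arbitrary: u b c v rule: less_induct)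
  case less
  define n where "n = length (u @ b # c # v)"
  have short: "exchange \<alpha> u b c v" if "set (u @ b # c # v) \<subseteq> B" "length (u @ b # c # v) < n" for u b c v
    using less.hyps that unfolding n_def by blast
  have desc: "exchange \<alpha> u b c v"
    if "set (u @ b # c # v) \<subseteq> B" "length (u @ b # c # v) = n" "idx c < idx b" for u b c v
    using that
  proof (induction "weight (u @ b # c # v)" arbitrary: u b c v rule: less_induct)
    case less
    define w where "w = u @ b # c # v"
    have d: "descent w (u, b, c, v)" using less.prems by (simp add: descent_def w_def)
    obtain u' b' c' v' where d': "descent w (u', b', c', v')"
      and normal_value: "normal_value \<alpha> w = normal_value \<alpha> (u' @ c' # b' # v') + bracket_term \<alpha> u' (lie b' c') v'"
      using normal_value_chosen_descent[OF d] .
    have L: "exchange \<alpha> u b c v"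
      if "set (u @ b # c # v) \<subseteq> B" "length (u @ b # c # v) = length w"
        "weight (u @ b # c # v) < weight w" "idx c < idx b" for u b c v
      using less.hyps that less.prems unfolding w_def by metis
    have H: "exchange \<alpha> u b c v"
      if "set (u @ b # c # v) \<subseteq> B" "length (u @ b # c # v) < length w" for u b c v
      using short that less.prems unfolding w_def by metis
    have wB: "set w \<subseteq> B" using less.prems by (simp add: w_def)
    have "normal_value \<alpha> (u @ c # b # v) + bracket_term \<alpha> u (lie b c) v
        = normal_value \<alpha> (u' @ c' # b' # v') + bracket_term \<alpha> u' (lie b' c') v'"
    proof (cases "length u \<le> length u'")
      case True
      show ?thesis using confluence_aux[OF H L wB d d' True] .
    next
      case False
      then have "length u' \<le> length u" by simp
      from confluence_aux[OF H L wB d' d this] show ?thesis by (rule sym)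
    qed
    then show ?case using normal_value by (simp add: exchange_def w_def)
  qed
  consider "idx c < idx b" | "idx b < idx c" | "idx b = idx c" by linarith
  then show ?case
  proof cases
    case 1
    then show ?thesis using desc less.prems by (simp add: n_def)
  next
    case 2
    then have "exchange \<alpha> u c b v" using desc less.prems by (simp add: n_def)
    then show ?thesis by (simp add: exchange_def lie_swap[of c b] bracket_term_minus)
  next
    case 3
    then have "b = c" using inj_idx less.prems by (auto dest: inj_onD)
    then show ?thesis by (simp add: exchange_def lie_self bracket_term_zero)
  qed
qed

text \<open>
  The extension of a function on words in the basis to words in arbitrary elements of \<open>\<gg>\<close>, linear in each letter.
\<close>

primrec multilinear_ext :: "('g list \<Rightarrow> complex) \<Rightarrow> 'g list \<Rightarrow> complex" where
  "multilinear_ext L [] = L []"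
| "multilinear_ext L (x # w) = (\<Sum>b\<in>B. coord B b x * multilinear_ext (\<lambda>v. L (b # v)) w)"

lemma multilinear_ext_append: "multilinear_ext L (u @ v) = multilinear_ext (\<lambda>w. multilinear_ext (\<lambda>w'. L (w @ w')) v) u"
  by (induction u arbitrary: L) simp_all

lemma multilinear_ext_cong: "(\<And>v. set v \<subseteq> B \<Longrightarrow> L v = M v) \<Longrightarrow> multilinear_ext L w = multilinear_ext M w"
proof (induction w arbitrary: L M)
  case (Cons x w)
  have "multilinear_ext (\<lambda>v. L (b # v)) w = multilinear_ext (\<lambda>v. M (b # v)) w" if "b \<in> B" for b
    using that by (intro Cons.IH Cons.prems) simp
  then show ?case by simp
qed simp

lemma multilinear_ext_add: "multilinear_ext (\<lambda>v. L v + M v) w = multilinear_ext L w + multilinear_ext M w"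
  by (induction w arbitrary: L M) (simp_all add: sum.distrib algebra_simps)

lemma multilinear_ext_scale: "multilinear_ext (\<lambda>v. c * L v) w = c * multilinear_ext L w"
  by (induction w arbitrary: L) (simp_all add: sum_distrib_left algebra_simps)

lemma multilinear_ext_sum: "finite I \<Longrightarrow> multilinear_ext (\<lambda>v. \<Sum>i\<in>I. L i v) w = (\<Sum>i\<in>I. multilinear_ext (L i) w)"
proof (induction w arbitrary: L)
  case (Cons x w)
  then show ?case by (simp add: sum_distrib_left) (rule sum.swap)
qed simp

lemma multilinear_ext_plus_letter: "multilinear_ext L (u @ (x + y) # v) = multilinear_ext L (u @ x # v) + multilinear_ext L (u @ y # v)"
  unfolding multilinear_ext_append[of L u] multilinear_ext_add[symmetric]
  by (rule multilinear_ext_cong) (simp add: dual_plus algebra_simps sum.distrib)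

lemma multilinear_ext_scale_letter: "multilinear_ext L (u @ (c *\<^sub>C x) # v) = c * multilinear_ext L (u @ x # v)"
proof -
  have "multilinear_ext (\<lambda>w'. L (w @ w')) ((c *\<^sub>C x) # v) = c * multilinear_ext (\<lambda>w'. L (w @ w')) (x # v)" for w
    by (simp add: dual_scaleC algebra_simps sum_distrib_left)
  then show ?thesis
    unfolding multilinear_ext_append[of L u] by (simp only: multilinear_ext_scale)
qed

lemma coord_lie: "coord B h (lie x y) = (\<Sum>a\<in>B. \<Sum>b\<in>B. coord B a x * coord B b y * coord B h (lie a b))"
proof -
  have "lie x y = (\<Sum>a\<in>B. \<Sum>b\<in>B. (coord B a x * coord B b y) *\<^sub>C lie a b)"
    apply (subst coord_expansion[of x, symmetric])
    apply (subst coord_expansion[of y, symmetric])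
    apply (simp add: lie_sum_left lie_sum_right lie_scaleC_left lie_scaleC_right scaleC_scaleC
        cvec.scale_sum_right)
    apply (subst sum.swap)
    apply (simp add: mult.commute)
    done
  then show ?thesis by (simp add: dual_sum dual_scaleC)
qed

lemma multilinear_ext_exchange:
  "multilinear_ext (normal_value \<alpha>) (u @ x # y # v) = multilinear_ext (normal_value \<alpha>) (u @ y # x # v) + multilinear_ext (normal_value \<alpha>) (u @ lie x y # v)"
  unfolding multilinear_ext_append[of "normal_value \<alpha>" u] multilinear_ext_add[symmetric]
proof (rule multilinear_ext_cong)
  fix w assume w: "set w \<subseteq> B"
  have "multilinear_ext (\<lambda>w'. normal_value \<alpha> (w @ w')) (x # y # v)
     = (\<Sum>a\<in>B. \<Sum>b\<in>B. coord B a x * coord B b y * multilinear_ext (\<lambda>w'. normal_value \<alpha> (w @ a # b # w')) v)"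
    by (simp add: sum_distrib_left mult.assoc)
  also have "\<dots> = (\<Sum>a\<in>B. \<Sum>b\<in>B. coord B a x * coord B b y *
     multilinear_ext (\<lambda>w'. normal_value \<alpha> (w @ b # a # w') + (\<Sum>h\<in>B. coord B h (lie a b) * normal_value \<alpha> (w @ h # w'))) v)"
  proof (intro sum.cong refl arg_cong2[where f = "(*)"] multilinear_ext_cong)
    fix a b w' assume "a \<in> B" "b \<in> B" "set w' \<subseteq> B"
    with w have "exchange \<alpha> w a b w'" by (intro normal_value_exchange) auto
    then show "normal_value \<alpha> (w @ a # b # w') = normal_value \<alpha> (w @ b # a # w')
        + (\<Sum>h\<in>B. coord B h (lie a b) * normal_value \<alpha> (w @ h # w'))"
      by (simp add: exchange_def bracket_term_def)
  qed
  also have "\<dots> = (\<Sum>a\<in>B. \<Sum>b\<in>B. coord B a x * coord B b y * multilinear_ext (\<lambda>w'. normal_value \<alpha> (w @ b # a # w')) v)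
      + (\<Sum>a\<in>B. \<Sum>b\<in>B. \<Sum>h\<in>B. coord B a x * coord B b y * coord B h (lie a b) * multilinear_ext (\<lambda>w'. normal_value \<alpha> (w @ h # w')) v)"
    by (simp add: multilinear_ext_add multilinear_ext_sum multilinear_ext_scale algebra_simps sum.distrib sum_distrib_left)
  also have "(\<Sum>a\<in>B. \<Sum>b\<in>B. coord B a x * coord B b y * multilinear_ext (\<lambda>w'. normal_value \<alpha> (w @ b # a # w')) v)
      = multilinear_ext (\<lambda>w'. normal_value \<alpha> (w @ w')) (y # x # v)"
    by (subst sum.swap) (simp add: sum_distrib_left algebra_simps)
  also have "(\<Sum>a\<in>B. \<Sum>b\<in>B. \<Sum>h\<in>B. coord B a x * coord B b y * coord B h (lie a b) * multilinear_ext (\<lambda>w'. normal_value \<alpha> (w @ h # w')) v)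
      = multilinear_ext (\<lambda>w'. normal_value \<alpha> (w @ w')) (lie x y # v)"
    unfolding multilinear_ext.simps coord_lie[of _ x y] sum_distrib_right
    by (subst (2) sum.swap, subst (1) sum.swap) simp
  finally show "multilinear_ext (\<lambda>w'. normal_value \<alpha> (w @ w')) (x # y # v)
     = multilinear_ext (\<lambda>w'. normal_value \<alpha> (w @ w')) (y # x # v) + multilinear_ext (\<lambda>w'. normal_value \<alpha> (w @ w')) (lie x y # v)" .
qed

lemma multilinear_ext_singleton: "\<alpha> \<in> dual \<Longrightarrow> multilinear_ext (normal_value \<alpha>) [x] = \<alpha> x"
proof -
  assume a: "\<alpha> \<in> dual"
  have "normal_value \<alpha> [b] = \<alpha> b" for b
    by (subst normal_value.simps) (auto simp: descent_def)
  with a show ?thesis by (simp add: dual_expansion)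
qed

end

section \<open>Monomials and ideals in tensor powers of the free algebra\<close>

text \<open>
  This gives the additivity of \<open>linear_ext\<close> and \<open>in_factor\<close>, which are defined by sums over supports: the
  support of \<open>p + q\<close> may be smaller than the union of the supports, but the missing summands are zero.
\<close>

lemma sum_keys_add:
  fixes p q :: "'m \<Rightarrow>\<^sub>0 complex" and G :: "'m \<Rightarrow> complex \<Rightarrow> 'b::comm_monoid_add"
  assumes "\<And>m. G m 0 = 0" and "\<And>m a b. G m (a + b) = G m a + G m b"
  shows "(\<Sum>m\<in>Poly_Mapping.keys (p + q). G m (Poly_Mapping.lookup (p + q) m))
    = (\<Sum>m\<in>Poly_Mapping.keys p. G m (Poly_Mapping.lookup p m))
    + (\<Sum>m\<in>Poly_Mapping.keys q. G m (Poly_Mapping.lookup q m))"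
proof -
  let ?S = "Poly_Mapping.keys p \<union> Poly_Mapping.keys q"
  have *: "(\<Sum>m\<in>Poly_Mapping.keys r. G m (Poly_Mapping.lookup r m)) = (\<Sum>m\<in>?S. G m (Poly_Mapping.lookup r m))"
    if "Poly_Mapping.keys r \<subseteq> ?S" for r
    using that by (intro sum.mono_neutral_left) (auto simp: assms(1) in_keys_iff)
  show ?thesis
    unfolding *[OF Poly_Mapping.keys_add] *[OF Un_upper1] *[OF Un_upper2]
    by (simp add: lookup_add assms(2) sum.distrib)
qed

definition linear_ext :: "('m \<Rightarrow> complex) \<Rightarrow> ('m \<Rightarrow>\<^sub>0 complex) \<Rightarrow> complex" where
  "linear_ext \<phi> p = (\<Sum>m\<in>Poly_Mapping.keys p. Poly_Mapping.lookup p m * \<phi> m)"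

lemma linear_ext_zero [simp]: "linear_ext \<phi> 0 = 0"
  by (simp add: linear_ext_def)

lemma linear_ext_add: "linear_ext \<phi> (p + q) = linear_ext \<phi> p + linear_ext \<phi> q"
  unfolding linear_ext_def by (rule sum_keys_add) (simp_all add: algebra_simps)

lemma linear_ext_diff: "linear_ext \<phi> (p - q) = linear_ext \<phi> p - linear_ext \<phi> q"
  using linear_ext_add[of \<phi> "p - q" q] by simp

lemma linear_ext_sum: "linear_ext \<phi> (\<Sum>i\<in>I. f i) = (\<Sum>i\<in>I. linear_ext \<phi> (f i))"
  by (induction I rule: infinite_finite_induct) (simp_all add: linear_ext_add)

lemma linear_ext_single [simp]: "linear_ext \<phi> (Poly_Mapping.single m c) = c * \<phi> m"
  by (simp add: linear_ext_def)

lemma sum_monomials: "(\<Sum>m\<in>Poly_Mapping.keys p. Poly_Mapping.single m (Poly_Mapping.lookup p m)) = p"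
  by (rule poly_mapping_eqI) (simp add: lookup_sum lookup_single when_def in_keys_iff)

lemma single_sum: "Poly_Mapping.single m (\<Sum>i\<in>I. c i) = (\<Sum>i\<in>I. Poly_Mapping.single m (c i))"
  by (induction I rule: infinite_finite_induct) (simp_all add: single_add)

lemma linear_ext_scale:
  "linear_ext \<phi> (Poly_Mapping.single 0 c * p) = c * linear_ext \<phi> (p :: 'm::monoid_add \<Rightarrow>\<^sub>0 complex)"
proof -
  have "linear_ext \<phi> (Poly_Mapping.single 0 c * (\<Sum>m\<in>Poly_Mapping.keys p. Poly_Mapping.single m (Poly_Mapping.lookup p m)))
      = c * linear_ext \<phi> (\<Sum>m\<in>Poly_Mapping.keys p. Poly_Mapping.single m (Poly_Mapping.lookup p m))"
    unfolding sum_distrib_left linear_ext_sum mult_single by (simp add: sum_distrib_left mult.assoc)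
  then show ?thesis unfolding sum_monomials .
qed

text \<open>
  The two-sided ideal generated by an element lies in the kernel of the linear form.  This is what is inherited
  along the generation of the ideals below; vanishing on the element alone would not be.
\<close>

definition kills :: "('m::monoid_add \<Rightarrow> complex) \<Rightarrow> ('m \<Rightarrow>\<^sub>0 complex) \<Rightarrow> bool" where
  "kills \<phi> p \<longleftrightarrow> (\<forall>a b. linear_ext \<phi> (Poly_Mapping.single a 1 * p * Poly_Mapping.single b 1) = 0)"

lemma kills_imp: "kills \<phi> p \<Longrightarrow> linear_ext \<phi> p = 0"
  unfolding kills_def by (drule spec[of _ 0], drule spec[of _ 0]) simp

lemma kills_zero: "kills \<phi> 0"
  by (simp add: kills_def)

lemma kills_add: "kills \<phi> p \<Longrightarrow> kills \<phi> q \<Longrightarrow> kills \<phi> (p + q)"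
  by (simp add: kills_def algebra_simps linear_ext_add)

lemma kills_mult_left:
  assumes "kills \<phi> p" shows "kills \<phi> (q * p)"
  unfolding kills_def
proof (intro allI)
  fix a b
  have "linear_ext \<phi> (Poly_Mapping.single a 1 * ((\<Sum>m\<in>Poly_Mapping.keys q. Poly_Mapping.single m (Poly_Mapping.lookup q m)) * p) * Poly_Mapping.single b 1)
    = (\<Sum>m\<in>Poly_Mapping.keys q. linear_ext \<phi> (Poly_Mapping.single 0 (Poly_Mapping.lookup q m) * (Poly_Mapping.single (a + m) 1 * p * Poly_Mapping.single b 1)))"
    unfolding sum_distrib_left sum_distrib_right linear_ext_sum
    by (simp add: mult.assoc[symmetric] mult_single)
  then show "linear_ext \<phi> (Poly_Mapping.single a 1 * (q * p) * Poly_Mapping.single b 1) = 0"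
    using assms unfolding sum_monomials linear_ext_scale by (simp add: kills_def)
qed

lemma kills_mult_right:
  assumes "kills \<phi> p" shows "kills \<phi> (p * q)"
  unfolding kills_def
proof (intro allI)
  fix a b
  have *: "Poly_Mapping.single a 1 * (p * Poly_Mapping.single m c) * Poly_Mapping.single b 1
     = Poly_Mapping.single 0 c * (Poly_Mapping.single a 1 * p * Poly_Mapping.single (m + b) 1)" for m c
  proof -
    have c: "r * Poly_Mapping.single 0 c = Poly_Mapping.single 0 c * r" for r :: "'a \<Rightarrow>\<^sub>0 complex"
    proof -
      have "(\<Sum>m\<in>Poly_Mapping.keys r. Poly_Mapping.single m (Poly_Mapping.lookup r m)) * Poly_Mapping.single 0 c
        = Poly_Mapping.single 0 c * (\<Sum>m\<in>Poly_Mapping.keys r. Poly_Mapping.single m (Poly_Mapping.lookup r m))"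
        unfolding sum_distrib_left sum_distrib_right by (simp add: mult_single mult.commute)
      then show ?thesis unfolding sum_monomials .
    qed
    have "Poly_Mapping.single m c * Poly_Mapping.single b 1
        = Poly_Mapping.single (m + b) 1 * Poly_Mapping.single 0 c"
      by (simp add: mult_single)
    then have "Poly_Mapping.single a 1 * (p * Poly_Mapping.single m c) * Poly_Mapping.single b 1
        = (Poly_Mapping.single a 1 * p * Poly_Mapping.single (m + b) 1) * Poly_Mapping.single 0 c"
      by (simp only: mult.assoc)
    then show ?thesis unfolding c .
  qed
  have "linear_ext \<phi> (Poly_Mapping.single a 1 * (p * (\<Sum>m\<in>Poly_Mapping.keys q. Poly_Mapping.single m (Poly_Mapping.lookup q m))) * Poly_Mapping.single b 1)
    = (\<Sum>m\<in>Poly_Mapping.keys q. linear_ext \<phi> (Poly_Mapping.single 0 (Poly_Mapping.lookup q m) * (Poly_Mapping.single a 1 * p * Poly_Mapping.single (m + b) 1)))"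
    unfolding sum_distrib_left sum_distrib_right linear_ext_sum * ..
  then show "linear_ext \<phi> (Poly_Mapping.single a 1 * (p * q) * Poly_Mapping.single b 1) = 0"
    using assms unfolding sum_monomials linear_ext_scale by (simp add: kills_def)
qed

lemma in_factor_add: "in_factor i (p + q) = in_factor i p + in_factor i q"
  unfolding in_factor_def by (rule sum_keys_add) (simp_all add: single_add)

lemma in_factor_diff: "in_factor i (p - q) = in_factor i p - in_factor i q"
  using in_factor_add[of i "p - q" q] by simp

lemma in_factor_zero [simp]: "in_factor i 0 = 0"
  by (simp add: in_factor_def)

lemma in_factor_sum: "in_factor i (\<Sum>k\<in>I. f k) = (\<Sum>k\<in>I. in_factor i (f k))"
  by (induction I rule: infinite_finite_induct) (simp_all add: in_factor_add)

lemma in_factor_single: "in_factor i (Poly_Mapping.single w c) = Poly_Mapping.single (\<lambda>j. if j = i then w else 0) c"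
  by (simp add: in_factor_def)

text \<open>
  One letter in each factor of \<open>S\<close>: the normal form of a product of generators in distinct factors.  Since
  such generators commute, the order of the factors does not enter, and equalities between products become
  equalities of functions.
\<close>

definition word_at :: "nat set \<Rightarrow> (nat \<Rightarrow> 'a) \<Rightarrow> nat \<Rightarrow> 'a fword" where
  "word_at S F = (\<lambda>i. if i \<in> S then FWord [F i] else 0)"

lemma gen_eq: "gen i x = Poly_Mapping.single (word_at {i} (\<lambda>_. x)) 1"
  by (simp add: gen_def letter_def in_factor_single word_at_def)

lemma prod_gen:
  "distinct is \<Longrightarrow> prod_list (map (\<lambda>i. gen i (F i)) is) = Poly_Mapping.single (word_at (set is) F) 1"
proof (induction "is")
  case Nil
  have "word_at {} F = 0" by (simp add: word_at_def zero_fun_def)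
  then show ?case by (simp only: list.map prod_list.Nil set_simps single_one)
next
  case (Cons i "is")
  then have "word_at {i} (\<lambda>_. F i) + word_at (set is) F = word_at (insert i (set is)) F"
    by (auto simp: word_at_def fun_eq_iff)
  with Cons show ?case by (simp add: gen_eq mult_single)
qed

lemma bij_betw_PiE_lists:
  assumes "distinct is"
  shows "bij_betw (\<lambda>F. map F is) (PiE (set is) (\<lambda>_. B)) {bs. set bs \<subseteq> B \<and> length bs = length is}"
proof (rule bij_betwI')
  fix F G assume "F \<in> PiE (set is) (\<lambda>_. B)" "G \<in> PiE (set is) (\<lambda>_. B)"
  then show "map F is = map G is \<longleftrightarrow> F = G"
    by (auto simp: map_eq_conv intro: PiE_ext)
next
  fix F assume "F \<in> PiE (set is) (\<lambda>_. B)"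
  then show "map F is \<in> {bs. set bs \<subseteq> B \<and> length bs = length is}" by auto
next
  fix bs assume bs: "bs \<in> {bs. set bs \<subseteq> B \<and> length bs = length is}"
  define F where "F = restrict (\<lambda>i. the (map_of (zip is bs) i)) (set is)"
  have nth: "F (is ! k) = bs ! k" if "k < length is" for k
    using bs assms that by (simp add: F_def map_of_zip_nth)
  have "map F is = bs" by (rule nth_equalityI) (use bs nth in auto)
  moreover have "F \<in> PiE (set is) (\<lambda>_. B)"
  proof (rule PiE_I)
    fix i assume "i \<in> set is"
    then obtain k where "k < length is" "i = is ! k" by (auto simp: in_set_conv_nth)
    with nth[of k] bs show "F i \<in> B" by auto
  qed (simp add: F_def)
  ultimately show "\<exists>F\<in>PiE (set is) (\<lambda>_. B). bs = map F is" by auto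
qed

lemma place_eq:
  assumes "distinct is"
  shows "place B is X = (\<Sum>F\<in>PiE (set is) (\<lambda>_. B).
    Poly_Mapping.single (word_at (set is) F) (X (map (\<lambda>i. coord B (F i)) is)))"
proof -
  have "place B is X = (\<Sum>F\<in>PiE (set is) (\<lambda>_. B).
      scalar (X (map (coord B) (map F is))) * prod_list (map2 gen is (map F is)))"
    unfolding place_def by (rule sum.reindex_bij_betw[OF bij_betw_PiE_lists[OF assms], symmetric])
  moreover have "map2 gen is (map F is) = map (\<lambda>i. gen i (F i)) is" for F :: "nat \<Rightarrow> 'a"
    by (induction "is") simp_all
  ultimately show ?thesis
    by (simp add: prod_gen assms scalar_def mult_single comp_def)
qed

lemma place_cong:
  assumes "distinct is"
    and "\<And>F. F \<in> PiE (set is) (\<lambda>_. B) \<Longrightarrow> X (map (\<lambda>i. coord B (F i)) is) = Y (map (\<lambda>i. coord B (F i)) is)"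
  shows "place B is X = place B is Y"
  using assms by (simp add: place_eq)

lemma place_add: "place B is (\<lambda>as. X as + Y as) = place B is X + place B is Y"
  by (simp add: place_def scalar_def single_add algebra_simps sum.distrib)

lemma place_scale: "place B is (\<lambda>as. c * X as) = scalar c * place B is X"
proof -
  have "scalar (c * d) = scalar c * (scalar d :: 'a free_tpow)" for d
    by (simp add: scalar_def mult_single)
  then show ?thesis by (simp add: place_def sum_distrib_left mult.assoc)
qed

lemma place_minus: "place B is (\<lambda>as. - X as) = - place B is X"
  by (simp add: place_def scalar_def single_uminus sum_negf)

lemma place_diff: "place B is (\<lambda>as. X as - Y as) = place B is X - place B is Y"
  by (simp add: place_def scalar_def single_diff algebra_simps sum_subtractf)

lemma place_zero: "place B is (\<lambda>as. 0) = 0"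
  by (simp add: place_def scalar_def)

lemma place_sum: "place B is (\<lambda>as. \<Sum>i\<in>I. X i as) = (\<Sum>i\<in>I. place B is (X i))"
  by (induction I rule: infinite_finite_induct) (simp_all add: place_add place_zero)

lemma tpow_single: "(\<And>i. i \<notin> {1..N} \<Longrightarrow> m i = 0) \<Longrightarrow> Poly_Mapping.single m c \<in> tpow N"
  by (auto simp: tpow_def)

lemma scalar_in_tpow: "scalar c \<in> tpow N"
  by (simp add: scalar_def tpow_single)

lemma upow_ideal_minus: "p \<in> upow_ideal N \<Longrightarrow> - p \<in> upow_ideal N"
proof -
  assume "p \<in> upow_ideal N"
  then have "scalar (-1) * p \<in> upow_ideal N"
    by (rule upow_ideal.intros(4)[OF _ scalar_in_tpow])
  then show ?thesis by (simp add: scalar_def single_uminus)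
qed

lemma upow_ideal_diff: "p \<in> upow_ideal N \<Longrightarrow> q \<in> upow_ideal N \<Longrightarrow> p - q \<in> upow_ideal N"
  using upow_ideal.intros(3)[OF _ upow_ideal_minus, of p N q] by simp

lemma upow_ideal_sum: "(\<And>i. i \<in> I \<Longrightarrow> f i \<in> upow_ideal N) \<Longrightarrow> (\<Sum>i\<in>I. f i) \<in> upow_ideal N"
  by (induction I rule: infinite_finite_induct) (auto intro: upow_ideal.intros)

lemma upow_eq_refl: "upow_eq N p p"
  by (simp add: upow_eq_def upow_ideal.intros)

lemma upow_eq_sym: "upow_eq N p q \<Longrightarrow> upow_eq N q p"
  unfolding upow_eq_def by (drule upow_ideal_minus) simp

lemma upow_eq_trans: "upow_eq N p q \<Longrightarrow> upow_eq N q r \<Longrightarrow> upow_eq N p r"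
  unfolding upow_eq_def by (drule (1) upow_ideal.intros(3)) simp

lemma upow_eq_add: "upow_eq N p q \<Longrightarrow> upow_eq N p' q' \<Longrightarrow> upow_eq N (p + p') (q + q')"
  unfolding upow_eq_def by (drule (1) upow_ideal.intros(3)) (simp add: algebra_simps)

lemma upow_eq_sum: "(\<And>i. i \<in> I \<Longrightarrow> upow_eq N (f i) (g i)) \<Longrightarrow> upow_eq N (\<Sum>i\<in>I. f i) (\<Sum>i\<in>I. g i)"
  unfolding upow_eq_def sum_subtractf[symmetric] by (rule upow_ideal_sum)

lemma upow_eq_scalar: "upow_eq N p q \<Longrightarrow> upow_eq N (scalar c * p) (scalar c * q)"
  unfolding upow_eq_def right_diff_distrib[symmetric]
  by (rule upow_ideal.intros(4)[OF _ scalar_in_tpow])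

lemma upow_eq_comm: "upow_eq N p q \<Longrightarrow> a \<in> tpow N \<Longrightarrow> upow_eq N (comm a p) (comm a q)"
proof -
  assume "upow_eq N p q" "a \<in> tpow N"
  then have "a * (p - q) - (p - q) * a \<in> upow_ideal N"
    unfolding upow_eq_def by (auto intro: upow_ideal_diff[OF upow_ideal.intros(4) upow_ideal.intros(5)])
  then show ?thesis by (simp add: upow_eq_def comm_def algebra_simps)
qed

lemma letter_sum_ideal:
  "letter (\<Sum>h\<in>I. c h *\<^sub>C f h) - (\<Sum>h\<in>I. Poly_Mapping.single 0 (c h) * letter (f h)) \<in> uea_ideal"
proof (induction I rule: infinite_finite_induct)
  case (insert x F)
  let ?y = "\<Sum>h\<in>F. c h *\<^sub>C f h"
  have "(letter (c x *\<^sub>C f x + ?y) - letter (c x *\<^sub>C f x) - letter ?y)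
     + ((letter (c x *\<^sub>C f x) - Poly_Mapping.single 0 (c x) * letter (f x))
     + (letter ?y - (\<Sum>h\<in>F. Poly_Mapping.single 0 (c h) * letter (f h)))) \<in> uea_ideal"
    by (intro uea_ideal.intros insert)
  with insert show ?case by (simp add: algebra_simps)
next
  case empty
  show ?case using uea_ideal.intros(2)[of 0 0] by simp
next
  case (infinite A)
  then show ?case using uea_ideal.intros(2)[of 0 0] by simp
qed

section \<open>Commutators of tensors\<close>

lemma tensors_outside: "X \<in> tensors N \<Longrightarrow> \<not> (length as = N \<and> set as \<subseteq> dual) \<Longrightarrow> X as = 0"
  by (simp add: tensors_def)

lemma tensors_add: "X \<in> tensors N \<Longrightarrow> length as = N \<Longrightarrow> set as \<subseteq> dual \<Longrightarrow> i < N \<Longrightarrow>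
    \<beta> \<in> dual \<Longrightarrow> \<gamma> \<in> dual \<Longrightarrow> X (as[i := (\<lambda>v. \<beta> v + \<gamma> v)]) = X (as[i := \<beta>]) + X (as[i := \<gamma>])"
  by (auto simp: tensors_def)

lemma tensors_scale: "X \<in> tensors N \<Longrightarrow> length as = N \<Longrightarrow> set as \<subseteq> dual \<Longrightarrow> i < N \<Longrightarrow>
    \<beta> \<in> dual \<Longrightarrow> X (as[i := (\<lambda>v. c * \<beta> v)]) = c * X (as[i := \<beta>])"
  by (auto simp: tensors_def)

context lie_basis
begin

text \<open>
  The form in which the relations of \<open>U(\<gg>)\<close> enter the computations with tensors: a bracket in one factor is
  expanded in the basis at once, because placed tensors are sums over the basis.
\<close>

lemma commutator_ideal:
  assumes j: "j \<in> {1..N}" and n: "\<And>i. i \<notin> {1..N} \<Longrightarrow> n i = 0"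
  shows "upow_eq N
    (Poly_Mapping.single (n(j := FWord [x, y])) c - Poly_Mapping.single (n(j := FWord [y, x])) c)
    (\<Sum>h\<in>B. Poly_Mapping.single (n(j := FWord [h])) (c * coord B h (lie x y)))"
proof -
  let ?s = "\<Sum>h\<in>B. Poly_Mapping.single 0 (coord B h (lie x y)) * letter h"
  have "letter x * letter y - letter y * letter x - letter (lie x y)
      + (letter (\<Sum>h\<in>B. coord B h (lie x y) *\<^sub>C h) - ?s) \<in> uea_ideal"
    by (intro uea_ideal.intros letter_sum_ideal)
  then have "letter x * letter y - letter y * letter x - ?s \<in> uea_ideal"
    by (simp add: coord_expansion)
  then have "Poly_Mapping.single (n(j := 0)) c * in_factor j (letter x * letter y - letter y * letter x - ?s)
      \<in> upow_ideal N"
    using j n by (intro upow_ideal.intros tpow_single) auto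
  also have "letter x * letter y - letter y * letter x - ?s
     = Poly_Mapping.single (FWord [x, y]) 1 - Poly_Mapping.single (FWord [y, x]) 1
       - (\<Sum>h\<in>B. Poly_Mapping.single (FWord [h]) (coord B h (lie x y)))"
    by (simp add: letter_def mult_single plus_fword_def zero_fword_def)
  also have "Poly_Mapping.single (n(j := 0)) c * in_factor j \<dots>
     = (Poly_Mapping.single (n(j := FWord [x, y])) c - Poly_Mapping.single (n(j := FWord [y, x])) c)
      - (\<Sum>h\<in>B. Poly_Mapping.single (n(j := FWord [h])) (c * coord B h (lie x y)))"
  proof -
    have "n(j := 0) + (\<lambda>i. if i = j then w else 0) = n(j := w)" for w
      by (auto simp: fun_eq_iff)
    then show ?thesis
      by (simp add: in_factor_diff in_factor_sum in_factor_single right_diff_distrib sum_distrib_left mult_single)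
  qed
  finally show ?thesis unfolding upow_eq_def .
qed

text \<open>
  If two tensors share exactly one factor \<open>j\<close>, then their commutator is again a tensor, because the other
  factors commute: \<open>V\<close> is obtained by bracketing in factor \<open>j\<close>.  All commutators of placed tensors that occur
  in the theorem are of this kind.
\<close>

lemma comm_place:
  assumes d: "distinct is" "distinct js" "distinct ks"
    and j: "set is \<inter> set js = {j}" and ks: "set ks = set is \<union> set js" "set ks \<subseteq> {1..N}"
    and V: "\<And>K. K \<in> PiE (set ks) (\<lambda>_. B) \<Longrightarrow> V (map (\<lambda>i. coord B (K i)) ks) =
       (\<Sum>x\<in>B. \<Sum>y\<in>B. coord B (K j) (lie x y) * X (map (\<lambda>i. coord B ((K(j := x)) i)) is)
           * Y (map (\<lambda>i. coord B ((K(j := y)) i)) js))"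
  shows "upow_eq N (comm (place B is X) (place B js Y)) (place B ks V)"
proof -
  let ?S = "set is" and ?T = "set js"
  let ?P = "\<lambda>A. PiE A (\<lambda>_. B)"
  define X' where "X' F = X (map (\<lambda>i. coord B (F i)) is)" for F
  define Y' where "Y' F = Y (map (\<lambda>i. coord B (F i)) js)" for F
  define merge where "merge F G = word_at (?S \<union> ?T) (\<lambda>i. if i \<in> ?S then F i else G i)" for F G :: "nat \<Rightarrow> 'g"
  have jS: "j \<in> ?S" "j \<in> ?T" using j by auto
  have m1: "word_at ?S F + word_at ?T G = (merge F G)(j := FWord [F j, G j])" for F G
    using j jS by (auto simp: fun_eq_iff word_at_def merge_def plus_fword_def zero_fword_def)
  have m2: "word_at ?T G + word_at ?S F = (merge F G)(j := FWord [G j, F j])" for F G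
    using j jS by (auto simp: fun_eq_iff word_at_def merge_def plus_fword_def zero_fword_def)
  have "comm (place B is X) (place B js Y) = (\<Sum>F\<in>?P ?S. \<Sum>G\<in>?P ?T.
      Poly_Mapping.single ((merge F G)(j := FWord [F j, G j])) (X' F * Y' G)
    - Poly_Mapping.single ((merge F G)(j := FWord [G j, F j])) (X' F * Y' G))"
    unfolding comm_def place_eq[OF d(1)] place_eq[OF d(2)] sum_product sum_subtractf
    apply (subst (2) sum.swap)
    apply (simp add: mult_single X'_def[symmetric] Y'_def[symmetric] m1 m2 mult.commute)
    done
  moreover have "upow_eq N \<dots> (\<Sum>F\<in>?P ?S. \<Sum>G\<in>?P ?T. \<Sum>h\<in>B.
      Poly_Mapping.single ((merge F G)(j := FWord [h])) (X' F * Y' G * coord B h (lie (F j) (G j))))"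
    (is "upow_eq N _ ?R")
    using jS ks by (intro upow_eq_sum commutator_ideal) (auto simp: merge_def word_at_def)
  ultimately have 1: "upow_eq N (comm (place B is X) (place B js Y)) ?R" by (simp only:)
  have "?R = (\<Sum>(F, G, h)\<in>?P ?S \<times> ?P ?T \<times> B.
      Poly_Mapping.single ((merge F G)(j := FWord [h])) (X' F * Y' G * coord B h (lie (F j) (G j))))"
    by (simp add: sum.cartesian_product)
  also have "\<dots> = (\<Sum>(K, x, y)\<in>?P (?S \<union> ?T) \<times> B \<times> B.
      Poly_Mapping.single (word_at (?S \<union> ?T) K)
        (coord B (K j) (lie x y) * X' (K(j := x)) * Y' (K(j := y))))"
  \<comment> \<open>On the left \<open>F j\<close> and \<open>G j\<close> are bracketed and \<open>h\<close> is the new letter in factor \<open>j\<close>; on the right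
    these are \<open>x\<close>, \<open>y\<close> and \<open>K j\<close>.\<close>
  proof (rule sum.reindex_bij_witness[where
      i = "\<lambda>(K, x, y). (restrict (K(j := x)) ?S, restrict (K(j := y)) ?T, K j)" and
      j = "\<lambda>(F, G, h). (restrict ((\<lambda>i. if i \<in> ?S then F i else G i)(j := h)) (?S \<union> ?T), F j, G j)"],
      goal_cases)
    case (1 a)
    obtain F G h where a: "a = (F, G, h)" by (metis surj_pair)
    have F: "F \<in> ?P ?S" and G: "G \<in> ?P ?T" using 1 a by auto
    have "restrict ((restrict ((\<lambda>i. if i \<in> ?S then F i else G i)(j := h)) (?S \<union> ?T))(j := F j)) ?S = F"
      by (rule PiE_ext[OF _ F]) (use F jS in \<open>auto simp: PiE_iff\<close>)
    moreover have "restrict ((restrict ((\<lambda>i. if i \<in> ?S then F i else G i)(j := h)) (?S \<union> ?T))(j := G j)) ?T = G"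
      by (rule PiE_ext[OF _ G]) (use F G jS j in \<open>auto simp: PiE_iff\<close>)
    ultimately show ?case using jS by (simp add: a)
  next
    case (2 a)
    then show ?case using jS by (auto simp: PiE_iff split: prod.splits)
  next
    case (3 b)
    obtain K x y where b: "b = (K, x, y)" by (metis surj_pair)
    have K: "K \<in> ?P (?S \<union> ?T)" using 3 b by auto
    have "restrict ((\<lambda>i. if i \<in> ?S then restrict (K(j := x)) ?S i else restrict (K(j := y)) ?T i)(j := K j)) (?S \<union> ?T) = K"
      by (rule PiE_ext[OF _ K]) (use K jS in \<open>auto simp: PiE_iff\<close>)
    then show ?case using jS by (simp add: b)
  next
    case (4 b)
    then show ?case using jS by (auto simp: PiE_iff split: prod.splits)
  next
    case (5 a)
    obtain F G h where a: "a = (F, G, h)" by (metis surj_pair)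
    have F: "F \<in> ?P ?S" and G: "G \<in> ?P ?T" using 5 a by auto
    let ?K = "restrict ((\<lambda>i. if i \<in> ?S then F i else G i)(j := h)) (?S \<union> ?T)"
    have "X' (?K(j := F j)) = X' F" unfolding X'_def
      by (intro arg_cong[where f = X] map_cong) auto
    moreover have "Y' (?K(j := G j)) = Y' G" unfolding Y'_def
      using j by (intro arg_cong[where f = Y] map_cong) auto
    moreover have "word_at (?S \<union> ?T) ?K = (merge F G)(j := FWord [h])"
      using jS by (auto simp: word_at_def merge_def fun_eq_iff)
    ultimately show ?case using jS by (simp add: a ac_simps)
  qed
  also have "\<dots> = (\<Sum>K\<in>?P (?S \<union> ?T). \<Sum>x\<in>B. \<Sum>y\<in>B.
      Poly_Mapping.single (word_at (?S \<union> ?T) K)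
        (coord B (K j) (lie x y) * X' (K(j := x)) * Y' (K(j := y))))"
    by (simp add: sum.cartesian_product)
  also have "\<dots> = place B ks V"
    unfolding place_eq[OF d(3)] using V
    by (simp add: ks(1) single_sum[symmetric] X'_def Y'_def)
  finally show ?thesis using 1 by simp
qed

text \<open>
  The sums over dual bases in \<open>Alt(d\<rho>)\<close>: the new factor \<open>i\<close> records the direction of the derivative.
\<close>

lemma sum_gen_place:
  assumes d: "distinct is" "distinct ks" and i: "i \<notin> set is" "set ks = insert i (set is)"
    and V: "\<And>K. K \<in> PiE (set ks) (\<lambda>_. B) \<Longrightarrow>
      V (map (\<lambda>i. coord B (K i)) ks) = Y (K i) (map (\<lambda>i. coord B (K i)) is)"
  shows "(\<Sum>h\<in>B. gen i h * place B is (Y h)) = place B ks V"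
proof -
  have w: "word_at {i} (\<lambda>_. h) + word_at (set is) F = word_at (insert i (set is)) (F(i := h))" for h and F :: "nat \<Rightarrow> 'g"
    using i by (auto simp: word_at_def fun_eq_iff)
  have m: "map (\<lambda>k. coord B (if k = i then h else F k)) is = map (\<lambda>k. coord B (F k)) is" for h F
    using i by (intro map_cong) auto
  have "place B ks V = (\<Sum>K\<in>PiE (insert i (set is)) (\<lambda>_. B).
     Poly_Mapping.single (word_at (insert i (set is)) K) (Y (K i) (map (\<lambda>i. coord B (K i)) is)))"
    unfolding place_eq[OF d(2)] using V by (simp add: i(2))
  also have "\<dots> = (\<Sum>(h, F)\<in>B \<times> PiE (set is) (\<lambda>_. B).
     Poly_Mapping.single (word_at (insert i (set is)) (F(i := h))) (Y h (map (\<lambda>k. coord B ((F(i := h)) k)) is)))"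
    unfolding PiE_insert_eq
    by (subst sum.reindex[OF inj_combinator[OF i(1), of "\<lambda>_. B"]]) (simp add: split_def comp_def)
  also have "\<dots> = (\<Sum>h\<in>B. gen i h * place B is (Y h))"
    unfolding place_eq[OF d(1)]
    by (simp add: sum.cartesian_product[symmetric] gen_eq sum_distrib_left mult_single w m)
  finally show ?thesis ..
qed

section \<open>Injectivity of $\mathfrak g^{\otimes N} \to U(\mathfrak g)^{\otimes N}$\<close>

lemma tensors_expand:
  assumes X: "X \<in> tensors N" "length as = N" "set as \<subseteq> dual" "i < N" and \<alpha>: "\<alpha> \<in> dual"
  shows "X (as[i := \<alpha>]) = (\<Sum>b\<in>B. \<alpha> b * X (as[i := coord B b]))"
proof -
  have "(\<lambda>v. \<Sum>b\<in>S. c b * coord B b v) \<in> dual \<and>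
     X (as[i := (\<lambda>v. \<Sum>b\<in>S. c b * coord B b v)]) = (\<Sum>b\<in>S. c b * X (as[i := coord B b]))"
    if "finite S" for S c
    using that
  proof induction
    case empty
    have "X (as[i := (\<lambda>v. 0 * 0)]) = 0 * X (as[i := (\<lambda>v. 0)])"
      by (rule tensors_scale[OF X zero_in_dual])
    then show ?case by (simp add: zero_in_dual)
  next
    case (insert b S)
    have "(\<lambda>v. c b * coord B b v) \<in> dual" by (simp add: dual_scale_closed)
    with insert show ?case
      by (simp add: tensors_add[OF X] tensors_scale[OF X] dual_add_closed)
  qed
  from this[OF finite_B, of \<alpha>] show ?thesis
    using dual_expansion[OF \<alpha>] by (simp add: mult.commute)
qed

lemma tensors_zeroI:
  assumes X: "X \<in> tensors N"
    and z: "\<And>bs. set bs \<subseteq> B \<Longrightarrow> length bs = N \<Longrightarrow> X (map (coord B) bs) = 0"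
  shows "X as = 0"
proof -
  have "X as = 0" if "length as = N" "set as \<subseteq> dual" "\<forall>i<N. k \<le> i \<longrightarrow> as ! i \<in> coord B ` B" "k \<le> N" for k as
    using that
  proof (induction k arbitrary: as)
    case 0
    then have "set as \<subseteq> coord B ` B" by (auto simp: in_set_conv_nth)
    then have "as \<in> lists (coord B ` B)" by auto
    then obtain bs where "as = map (coord B) bs" "bs \<in> lists B" unfolding lists_image by auto
    then show ?case using z[of bs] 0 by auto
  next
    case (Suc k)
    then have k: "k < N" "as ! k \<in> dual" by auto
    have "X (as[k := coord B b]) = 0" if "b \<in> B" for b
    proof (rule Suc.IH)
      show "set (as[k := coord B b]) \<subseteq> dual"
        using Suc.prems by (metis coord_in_dual insert_subset order_trans set_update_subset_insert)
      show "\<forall>i<N. k \<le> i \<longrightarrow> as[k := coord B b] ! i \<in> coord B ` B"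
        using Suc.prems that by (auto simp: nth_list_update)
    qed (use Suc.prems in auto)
    then have "X (as[k := as ! k]) = 0"
      using tensors_expand[OF X Suc.prems(1,2) k] by simp
    then show ?case by simp
  qed
  from this[of as N] show ?thesis
    using tensors_outside[OF X, of as] by auto
qed

lemma uea_ideal_killed: "p \<in> uea_ideal \<Longrightarrow> kills (\<lambda>w. multilinear_ext (normal_value \<alpha>) (letters w)) p"
proof (induction rule: uea_ideal.induct)
  case (1 x y)
  show ?case
    by (simp add: kills_def letter_def left_diff_distrib right_diff_distrib mult_single linear_ext_diff plus_fword_def multilinear_ext_plus_letter)
next
  case (2 c x)
  show ?case
    by (simp add: kills_def letter_def left_diff_distrib right_diff_distrib mult_single linear_ext_diff plus_fword_def zero_fword_def multilinear_ext_scale_letter)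
next
  case (3 x y)
  show ?case
    using multilinear_ext_exchange[of \<alpha> _ x y]
    by (simp add: kills_def letter_def left_diff_distrib right_diff_distrib mult_single linear_ext_diff plus_fword_def)
qed (simp_all add: kills_add kills_mult_left kills_mult_right)

text \<open>
  Products of linear forms on the factors descend to \<open>U(\<gg>)\<^sup>\<otimes>\<^sup>N\<close>.
\<close>

lemma upow_ideal_killed:
  fixes \<phi> :: "nat \<Rightarrow> 'g fword \<Rightarrow> complex"
  assumes \<phi>: "\<And>i q. q \<in> uea_ideal \<Longrightarrow> kills (\<phi> i) q"
  shows "p \<in> upow_ideal N \<Longrightarrow> kills (\<lambda>m. \<Prod>i\<in>{1..N}. \<phi> i (m i)) p"
proof (induction rule: upow_ideal.induct)
  case (2 p i)
  let ?\<psi> = "\<lambda>m. \<Prod>i\<in>{1..N}. \<phi> i (m i)"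
  show ?case unfolding kills_def
  proof (intro allI)
    fix a b :: "nat \<Rightarrow> 'g fword"
    have \<psi>: "?\<psi> (a + (\<lambda>j. if j = i then w else 0) + b)
        = (\<Prod>j\<in>{1..N} - {i}. \<phi> j (a j + b j)) * \<phi> i (a i + w + b i)" for w
      using 2 by (subst prod.remove[of _ i]) (auto intro!: prod.cong)
    have "linear_ext ?\<psi> (Poly_Mapping.single a 1 * in_factor i p * Poly_Mapping.single b 1)
       = (\<Prod>j\<in>{1..N} - {i}. \<phi> j (a j + b j)) * linear_ext (\<phi> i)
          (Poly_Mapping.single (a i) 1 * (\<Sum>m\<in>Poly_Mapping.keys p. Poly_Mapping.single m (Poly_Mapping.lookup p m)) * Poly_Mapping.single (b i) 1)"
      unfolding in_factor_def sum_distrib_left sum_distrib_right linear_ext_sum mult_single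
        linear_ext_single \<psi> by (simp add: ac_simps)
    also have "\<dots> = 0"
      using \<phi>[OF 2(1), of i] unfolding sum_monomials kills_def by simp
    finally show "linear_ext ?\<psi> (Poly_Mapping.single a 1 * in_factor i p * Poly_Mapping.single b 1) = 0" .
  qed
qed (simp_all add: kills_zero kills_add kills_mult_left kills_mult_right)

text \<open>
  The product of the forms extending the coordinates \<open>coord B (G i)\<close> reads off one coordinate of \<open>X\<close>.
\<close>

lemma tensor_zero_if_ideal:
  assumes X: "X \<in> tensors N" and p: "place B [1..<N + 1] X \<in> upow_ideal N"
  shows "X as = 0"
proof (rule tensors_zeroI[OF X])
  fix bs assume bs: "set bs \<subseteq> B" "length bs = N"
  have I: "set [1..<N + 1] = {1..N}" by auto
  have "bs \<in> (\<lambda>F. map F [1..<N + 1]) ` (PiE {1..N} (\<lambda>_. B))"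
    using bij_betw_imp_surj_on[OF bij_betw_PiE_lists[of "[1..<N + 1]" B]] bs unfolding I by auto
  then obtain G where G: "G \<in> PiE {1..N} (\<lambda>_. B)" "bs = map G [1..<N + 1]" by auto
  let ?\<phi> = "\<lambda>i w. multilinear_ext (normal_value (coord B (G i))) (letters w)"
  have "linear_ext (\<lambda>m. \<Prod>i\<in>{1..N}. ?\<phi> i (m i)) (place B [1..<N + 1] X) = 0"
    by (intro kills_imp upow_ideal_killed[OF _ p] uea_ideal_killed)
  moreover have "linear_ext (\<lambda>m. \<Prod>i\<in>{1..N}. ?\<phi> i (m i)) (place B [1..<N + 1] X)
     = (\<Sum>F\<in>PiE {1..N} (\<lambda>_. B). X (map (\<lambda>i. coord B (F i)) [1..<N + 1]) * (if F = G then 1 else 0))"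
    unfolding place_eq[OF distinct_upt] I linear_ext_sum linear_ext_single
  proof (intro sum.cong refl arg_cong2[where f = "(*)"])
    fix F assume F: "F \<in> PiE {1..N} (\<lambda>_. B)"
    have "(\<Prod>i\<in>{1..N}. ?\<phi> i (word_at {1..N} F i)) = (\<Prod>i\<in>{1..N}. if F i = G i then 1 else 0)"
    proof (intro prod.cong refl)
      fix i assume i: "i \<in> {1..N}"
      then have "F i \<in> B" using F by auto
      then show "?\<phi> i (word_at {1..N} F i) = (if F i = G i then 1 else 0)"
        using i multilinear_ext_singleton[OF coord_in_dual, of "G i" "F i"]
        by (simp add: word_at_def coord_basis del: multilinear_ext.simps)
    qed
    also have "\<dots> = (if F = G then 1 else 0)"
    proof (cases "F = G")
      case False
      then obtain i where "i \<in> {1..N}" "F i \<noteq> G i" using F G(1) by (metis PiE_ext)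
      then show ?thesis using False by (intro trans[OF prod_zero]) auto
    qed simp
    finally show "(\<Prod>i\<in>{1..N}. ?\<phi> i (word_at {1..N} F i)) = (if F = G then 1 else 0)" .
  qed
  moreover have "(\<Sum>F\<in>PiE {1..N} (\<lambda>_. B). f F * (if F = G then 1 else 0)) = f G" for f :: "_ \<Rightarrow> complex"
    using G(1) by (simp add: finite_PiE if_distrib[of "\<lambda>c. _ * c"] sum.delta' cong: if_cong)
  ultimately have "X (map (\<lambda>i. coord B (G i)) [1..<N + 1]) = 0"
    by (simp only:)
  then show "X (map (coord B) bs) = 0" by (simp add: G(2) comp_def)
qed

lemma tensors_diff: "X \<in> tensors N \<Longrightarrow> Y \<in> tensors N \<Longrightarrow> (\<lambda>as. X as - Y as) \<in> tensors N"
  by (auto simp: tensors_def algebra_simps)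

lemma tensor_unique:
  assumes X: "X \<in> tensors N" "Y \<in> tensors N"
    and "upow_eq N (place B [1..<N + 1] X) (place B [1..<N + 1] Y)"
  shows "X = Y"
proof
  fix as
  show "X as = Y as"
    using tensor_zero_if_ideal[OF tensors_diff[OF X], of as] assms(3)
    by (simp add: upow_eq_def place_diff del: upt_Suc)
qed

text \<open>
  This evaluates the definite description: uniqueness comes from the embedding into \<open>U(\<gg>)\<^sup>\<otimes>\<^sup>N\<close>.
\<close>

lemma tensor_of_eq:
  assumes "X \<in> tensors N" "upow_eq N (place B [1..<N + 1] X) p"
  shows "tensor_of B N p = X"
  unfolding tensor_of_def
proof (rule the_equality)
  fix Y assume Y: "Y \<in> tensors N \<and> upow_eq N (place B [1..<N + 1] Y) p"
  show "Y = X"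
    using tensor_unique[OF _ assms(1) upow_eq_trans[OF _ upow_eq_sym[OF assms(2)]]] Y by blast
qed (use assms in simp)

end

section \<open>The addition theorem of the hyperbolic cotangent\<close>

text \<open>
  The coefficients of \<open>coth z - 1/z\<close>; the principal part does not reach the indices \<open>n \<ge> 0\<close>.
\<close>

definition coth_coeff :: "nat \<Rightarrow> complex" where
  "coth_coeff n = fls_nth (fls_coth 1) (int n)"

lemma fps_sinh_nonzero: "a \<noteq> 0 \<Longrightarrow> fps_exp a - fps_exp (- a) \<noteq> (0 :: complex fps)"
proof
  assume "a \<noteq> 0" "fps_exp a - fps_exp (- a) = 0"
  then have "fps_nth (fps_exp a - fps_exp (- a)) 1 = 0" by simp
  with \<open>a \<noteq> 0\<close> show False by simp
qed

lemma fls_coth_nth: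
  assumes a: "a \<noteq> 0"
  shows "fls_nth (fls_coth a) k = a powi k * fls_nth (fls_coth 1) k"
proof -
  have e: "fps_compose (fps_exp b) (fps_const a * fps_X) = fps_exp (b * a)" for b :: complex
    by (rule fps_ext) (simp add: power_mult_distrib)
  have H: "fps_const a * fps_X \<noteq> 0" "fps_nth (fps_const a * fps_X) 0 = 0" using a by simp_all
  have "fls_coth a = fls_compose_fps (fls_coth 1) (fps_const a * fps_X)"
    unfolding fls_coth_def fls_compose_fps_divide[OF H] fls_compose_fps_to_fls[OF H]
    by (simp add: fps_compose_add_distrib fps_compose_sub_distrib e)
  then show ?thesis by (simp only: fls_nth_fls_compose_fps_linear[OF a]) (rule mult.commute)
qed

text \<open>
  Here \<open>sinh\<close> has a simple zero, so dividing by \<open>S = z S'\<close> means dividing by \<open>z\<close> and by the unit \<open>S'\<close>.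
\<close>

lemma fls_coth_principal:
  assumes "k < 0"
  shows "fls_nth (fls_coth 1) k = (if k = - 1 then 1 else 0)"
proof -
  define S where "S = fps_exp 1 - fps_exp (- 1 :: complex)"
  define C where "C = fps_exp 1 + fps_exp (- 1 :: complex)"
  have S: "S = fps_X * fps_shift 1 S"
    by (rule fps_ext) (simp add: S_def)
  have S0: "fps_nth (fps_shift 1 S) 0 = 2" by (simp add: S_def)
  have "fps_shift 1 S * inverse (fps_shift 1 S) = 1"
    using S0 by (simp add: inverse_mult_eq_1')
  then have i: "fps_to_fls (fps_shift 1 S) * fps_to_fls (inverse (fps_shift 1 S)) = 1"
    by (simp flip: fls_times_fps_to_fls)
  have n: "fps_to_fls (fps_shift 1 S) \<noteq> 0" using i by auto
  have "fls_coth 1 = fps_to_fls C / fps_to_fls (fps_X * fps_shift 1 S)"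
    unfolding fls_coth_def C_def[symmetric] S_def[symmetric] S[symmetric] ..
  also have "\<dots> = fps_to_fls C / (fls_X * fps_to_fls (fps_shift 1 S))"
    by (simp only: fls_times_fps_to_fls fps_X_to_fls)
  also have "\<dots> = fls_X_inv * (fps_to_fls C * fps_to_fls (inverse (fps_shift 1 S)))"
  proof -
    have "(fls_X * fls_X_inv) * (fps_to_fls (fps_shift 1 S) * fps_to_fls (inverse (fps_shift 1 S))) = (1 :: complex fls)"
      unfolding i by (simp add: fls_X_times_conv_shift)
    then have "fps_to_fls C = fps_to_fls C * ((fls_X * fls_X_inv)
        * (fps_to_fls (fps_shift 1 S) * fps_to_fls (inverse (fps_shift 1 S))))"
      by (simp only: mult_1_right)
    also have "\<dots> = fls_X_inv * (fps_to_fls C * fps_to_fls (inverse (fps_shift 1 S))) * (fls_X * fps_to_fls (fps_shift 1 S))"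
      by (simp only: ac_simps)
    finally have "fps_to_fls C = fls_X_inv * (fps_to_fls C * fps_to_fls (inverse (fps_shift 1 S))) * (fls_X * fps_to_fls (fps_shift 1 S))" .
    moreover have "fls_X * fps_to_fls (fps_shift 1 S) \<noteq> 0" using n by simp
    ultimately show ?thesis by (metis nonzero_divide_eq_eq)
  qed
  also have "\<dots> = fls_shift 1 (fps_to_fls (C * inverse (fps_shift 1 S)))"
    by (simp only: fls_times_fps_to_fls fls_X_inv_times_conv_shift)
  finally have *: "fls_coth 1 = fls_shift 1 (fps_to_fls (C * inverse (fps_shift 1 S)))" .
  have "fps_nth (C * inverse (fps_shift 1 S)) 0 = 1"
    using S0 by (simp add: C_def)
  then show ?thesis using assms unfolding * by auto
qed

lemma fls_coth_eq:
  assumes "a \<noteq> 0"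
  shows "fls_coth a = fls_const (1 / a) * fls_X_inv + fps_to_fls (Abs_fps (\<lambda>n. a ^ n * coth_coeff n))"
proof (rule fls_eqI)
  fix k
  show "fls_nth (fls_coth a) k
    = fls_nth (fls_const (1 / a) * fls_X_inv + fps_to_fls (Abs_fps (\<lambda>n. a ^ n * coth_coeff n))) k"
  proof (cases "k < 0")
    case True
    then show ?thesis
      using assms by (simp add: fls_coth_nth[OF assms] fls_coth_principal power_int_minus field_simps)
  next
    case False
    then obtain n where "k = int n" by (metis int_nat_eq not_less)
    then show ?thesis using assms by (simp add: fls_coth_nth[OF assms] coth_coeff_def)
  qed
qed

lemma coth_coeff_even: "even n \<Longrightarrow> coth_coeff n = 0"
proof -
  assume "even n"
  have "fls_coth (- 1) = - fls_coth 1"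
  proof -
    have "fps_exp (- 1) - fps_exp 1 = - (fps_exp 1 - fps_exp (- 1 :: complex))" by simp
    then have "fps_to_fls (fps_exp (- 1) - fps_exp 1) = - fps_to_fls (fps_exp 1 - fps_exp (- 1 :: complex))"
      by simp
    then show ?thesis
      unfolding fls_coth_def minus_minus by (simp only: minus_divide_right add.commute)
  qed
  then have "fls_nth (fls_coth (- 1)) (int n) = - coth_coeff n" by (simp add: coth_coeff_def)
  then show ?thesis
    using fls_coth_nth[of "- 1" "int n"] \<open>even n\<close> by (simp add: coth_coeff_def)
qed

lemma sum_of_quotients:
  fixes x y z d e f :: "'a::field"
  assumes "d \<noteq> 0" "e \<noteq> 0" "f \<noteq> 0" and "x * y * f + y * z * d + x * z * e + d * e * f = 0"
  shows "x / d * (y / e) + y / e * (z / f) + x / d * (z / f) = - 1"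
proof -
  have "x / d * (y / e) + y / e * (z / f) + x / d * (z / f) = (x * y * f + y * z * d + x * z * e) / (d * e * f)"
    using assms(1-3) by (simp add: add_divide_distrib)
  also have "x * y * f + y * z * d + x * z * e = - (d * e * f)"
    using assms(4) by (simp only: eq_neg_iff_add_eq_0)
  finally show ?thesis using assms(1-3) by simp
qed

lemma sinh_sum_expansion:
  fixes u u' v v' w w' :: "'a::comm_ring_1"
  shows "(u + u') * (v + v') * (w - w') + (v + v') * (w + w') * (u - u')
      + (u + u') * (w + w') * (v - v') + (u - u') * (v - v') * (w - w')
      = 4 * (u * v * w) - 4 * (u' * v' * w')"
  by (simp add: algebra_simps)

text \<open>
  With \<open>u = e\<^sup>a\<close>, \<open>v = e\<^sup>b\<close> and \<open>e\<^sup>c = u\<inverse> v\<inverse>\<close>, clearing denominators leaves the expansion of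
  \<open>sinh(a + b + c) = 0\<close> into products of \<open>sinh\<close> and \<open>cosh\<close>.
\<close>

lemma fls_coth_addition:
  assumes "a \<noteq> 0" "b \<noteq> 0" "c \<noteq> 0" "a + b + c = 0"
  shows "fls_coth a * fls_coth b + fls_coth b * fls_coth c + fls_coth a * fls_coth c = - 1"
proof -
  define E where "E x = fps_to_fls (fps_exp x)" for x :: complex
  have E: "E x * E y = E (x + y)" for x y
    by (simp add: E_def fps_exp_add_mult fls_times_fps_to_fls)
  have E0: "E 0 = 1" by (simp add: E_def)
  have K: "fls_coth x = (E x + E (- x)) / (E x - E (- x))" for x
    by (simp add: fls_coth_def E_def)
  have nz: "E x - E (- x) \<noteq> 0" if "x \<noteq> 0" for x
    using fps_to_fls_nonzeroI[OF fps_sinh_nonzero[OF that]] by (simp only: E_def fps_to_fls_minus not_False_eq_True)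
  have c: "c = - a - b" using assms(4) unfolding add_eq_0_iff by simp
  define u u' v v' where "u = E a" "u' = E (- a)" "v = E b" "v' = E (- b)"
  have uv: "u * u' = 1" "v * v' = 1" "E c = u' * v'" "E (- c) = u * v"
    by (simp_all add: u_u'_v_v'_def E E0 c add.commute)
  have nz': "u - u' \<noteq> 0" "v - v' \<noteq> 0" "u' * v' - u * v \<noteq> 0"
    using nz[OF assms(1)] nz[OF assms(2)] nz[OF assms(3)] unfolding uv(3,4) u_u'_v_v'_def by auto
  have K': "fls_coth a = (u + u') / (u - u')" "fls_coth b = (v + v') / (v - v')"
    "fls_coth c = (u' * v' + u * v) / (u' * v' - u * v)"
    using K[of a] K[of b] K[of c] uv(3,4) by (simp_all add: u_u'_v_v'_def)
  have "(u + u') * (v + v') * (w - w') + (v + v') * (w + w') * (u - u')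
      + (u + u') * (w + w') * (v - v') + (u - u') * (v - v') * (w - w')
      = 4 * (u * v * w) - 4 * (u' * v' * w')" for w w'
    by (rule sinh_sum_expansion)
  moreover have "u * v * (u' * v') = 1" "u' * v' * (u * v) = 1"
  proof -
    have "(u * u') * (v * v') = 1" using uv by simp
    then show "u * v * (u' * v') = 1" "u' * v' * (u * v) = 1" by (simp_all only: ac_simps)
  qed
  ultimately have *: "(u + u') * (v + v') * (u' * v' - u * v) + (v + v') * (u' * v' + u * v) * (u - u')
      + (u + u') * (u' * v' + u * v) * (v - v') + (u - u') * (v - v') * (u' * v' - u * v) = 0"
    by simp
  show ?thesis unfolding K' by (rule sum_of_quotients[OF nz' *])
qed

text \<open>
  Coefficient \<open>N\<close> of the addition theorem after splitting off the poles.  The product of two poles contributes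
  \<open>1/(ab) + 1/(bc) + 1/(ac) = (a + b + c)/(abc) = 0\<close>; a pole times a regular part contributes the terms with
  index \<open>N + 1\<close>.
\<close>

lemma coth_coeff_identity:
  assumes abc: "a \<noteq> 0" "b \<noteq> 0" "c \<noteq> 0" "a + b + c = 0"
  shows "(\<Sum>i\<le>N. coth_coeff i * coth_coeff (N - i) *
            (a ^ i * b ^ (N - i) + b ^ i * c ^ (N - i) + a ^ i * c ^ (N - i)))
    + coth_coeff (Suc N) * ((b ^ Suc N + c ^ Suc N) / a + (a ^ Suc N + c ^ Suc N) / b
            + (a ^ Suc N + b ^ Suc N) / c) = (if N = 0 then - 1 else 0)"
proof -
  define F where "F x = Abs_fps (\<lambda>n. x ^ n * coth_coeff n)" for x :: complex
  let ?G = "fps_const (1 / a) * (F b + F c) + fps_const (1 / b) * (F a + F c) + fps_const (1 / c) * (F a + F b)"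
  have K: "fls_coth x = fls_const (1 / x) * fls_X_inv + fps_to_fls (F x)" if "x \<noteq> 0" for x
    using fls_coth_eq[OF that] by (simp add: F_def)
  have "1 / a * (1 / b) + 1 / b * (1 / c) + 1 / a * (1 / c) = 0"
    using abc by (simp add: field_simps)
  then have z: "fls_const (1 / a) * fls_const (1 / b) + fls_const (1 / b) * fls_const (1 / c)
      + fls_const (1 / a) * fls_const (1 / c) = 0"
    by (simp del: fls_const_divide_const add: fls_plus_const fls_const_mult_const)
  have nth: "fls_nth (fps_to_fls p + fls_shift 1 (fps_to_fls q)) (int N) = fps_nth p N + fps_nth q (Suc N)" for p q :: "complex fps"
  proof -
    have "nat (int N + 1) = Suc N" by simp
    then show ?thesis by simp
  qed
  have "- 1 = fps_to_fls (F a * F b + F b * F c + F a * F c) + fls_X_inv * fps_to_fls ?G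
      + fls_X_inv * fls_X_inv * (fls_const (1 / a) * fls_const (1 / b) + fls_const (1 / b) * fls_const (1 / c)
      + fls_const (1 / a) * fls_const (1 / c))"
    unfolding fls_coth_addition[OF abc, symmetric] K[OF abc(1)] K[OF abc(2)] K[OF abc(3)]
      fps_to_fls_plus fls_times_fps_to_fls fps_const_to_fls
    by (simp only: algebra_simps)
  then have "- 1 = fps_to_fls (F a * F b + F b * F c + F a * F c) + fls_shift 1 (fps_to_fls ?G)"
    unfolding z by (simp only: mult_zero_right add_0_right fls_X_inv_times_conv_shift)
  then have "fls_nth (- 1) (int N) = fls_nth (fps_to_fls (F a * F b + F b * F c + F a * F c) + fls_shift 1 (fps_to_fls ?G)) (int N)"
    by simp
  also have "\<dots> = fps_nth (F a * F b + F b * F c + F a * F c) N + fps_nth ?G (Suc N)"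
    unfolding nth ..
  also have "fps_nth (F a * F b + F b * F c + F a * F c) N = (\<Sum>i\<le>N. coth_coeff i * coth_coeff (N - i) *
            (a ^ i * b ^ (N - i) + b ^ i * c ^ (N - i) + a ^ i * c ^ (N - i)))"
    by (simp add: fps_mult_nth F_def sum.distrib[symmetric] atMost_atLeast0 algebra_simps)
  also have "fps_nth ?G (Suc N) = coth_coeff (Suc N) * ((b ^ Suc N + c ^ Suc N) / a + (a ^ Suc N + c ^ Suc N) / b
            + (a ^ Suc N + b ^ Suc N) / c)"
    by (simp add: F_def algebra_simps add_divide_distrib)
  finally show ?thesis by (simp split: if_splits)
qed

lemma c_coeff_eq: "c_coeff n = coth_coeff (2 * n + 1)"
  by (simp add: c_coeff_def coth_coeff_def)

text \<open>
  \<open>\<phi>(z) = \<onehalf> f(z/2)\<close> for \<open>f(z) = coth z - 1/z\<close>.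
\<close>

lemma phi_nth: "fls_nth phi (int k) = (1 / 2) ^ Suc k * coth_coeff k"
  by (simp add: phi_def fls_coth_nth[of "1 / 2"] coth_coeff_def)

lemma geometric_quotient:
  fixes x y :: complex
  assumes "x \<noteq> y"
  shows "(\<Sum>i\<le>N. x ^ i * y ^ (N - i)) = (x ^ Suc N - y ^ Suc N) / (x - y)"
  using power_diff_sumr2[of x "Suc N" y] assms
  by (simp add: lessThan_Suc_atMost mult.commute field_simps del: power_Suc)

text \<open>
  The previous identity with \<open>a\<^sup>i b\<^sup>j c\<^sup>k\<close> replaced by \<open>g i j k\<close>.  The hypothesis says that \<open>g\<close> respects
  \<open>a + b + c = 0\<close>.  By homogeneity one may set \<open>b = 1\<close>; then \<open>c = -1 - a\<close>, and \<open>g\<close> on degree \<open>N\<close> is a linear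
  functional \<open>\<Phi>\<close> on polynomials in \<open>a\<close>.  The polynomial \<open>P\<close> below vanishes at all \<open>a\<close> other than \<open>0\<close> and
  \<open>-1\<close>, hence is zero.  The alternating sums are the polynomials \<open>((-c)\<^sup>n - b\<^sup>n)/a\<close>, \<open>n = N + 1\<close>, and their
  analogues; as \<open>coth\<close> is odd only even \<open>N\<close> matter, and they equal \<open>-(b\<^sup>n + c\<^sup>n)/a\<close>.
\<close>

lemma trilinear_coth_identity:
  fixes g :: "nat \<Rightarrow> nat \<Rightarrow> nat \<Rightarrow> complex"
  assumes g: "\<And>i j k. g (Suc i) j k + g i (Suc j) k + g i j (Suc k) = 0"
  shows "(\<Sum>i\<le>N. coth_coeff i * coth_coeff (N - i) * (g i (N - i) 0 + g 0 i (N - i) + g i 0 (N - i)))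
    - coth_coeff (Suc N) * (\<Sum>i\<le>N. (- 1) ^ i * (g 0 (N - i) i + g (N - i) 0 i + g (N - i) i 0))
    = (if N = 0 then - g 0 0 0 else 0)"
proof -
  define \<Phi> :: "complex poly \<Rightarrow> complex" where "\<Phi> p = (\<Sum>n\<le>N. coeff p n * g n (N - n) 0)" for p
  have add: "\<Phi> (p + q) = \<Phi> p + \<Phi> q" and sm: "\<Phi> (smult c p) = c * \<Phi> p"
    and minus: "\<Phi> (- p) = - \<Phi> p" and diff: "\<Phi> (p - q) = \<Phi> p - \<Phi> q" for p q c
    by (simp_all add: \<Phi>_def algebra_simps sum.distrib sum_distrib_left sum_negf sum_subtractf)
  have zero: "\<Phi> 0 = 0" by (simp add: \<Phi>_def)
  have sum: "\<Phi> (\<Sum>i\<in>I. p i) = (\<Sum>i\<in>I. \<Phi> (p i))" for p and I :: "nat set"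
    by (induction I rule: infinite_finite_induct) (simp_all add: zero add)
  define mo :: "nat \<Rightarrow> nat \<Rightarrow> complex poly" where "mo i k = monom 1 i * [:-1, -1:] ^ k" for i k
  have mo: "\<Phi> (mo i k) = g i j k" if "i + j + k = N" for i j k
    using that
  proof (induction k arbitrary: i j)
    case 0
    then show ?case by (auto simp: \<Phi>_def mo_def coeff_monom if_distrib[of "\<lambda>c. c * _"] cong: if_cong)
  next
    case (Suc k)
    have "mo i (Suc k) = - mo i k - mo (Suc i) k"
      unfolding poly_eq_poly_eq_iff[symmetric] mo_def
      by (auto simp: fun_eq_iff poly_monom poly_power algebra_simps)
    then have "\<Phi> (mo i (Suc k)) = - g i (Suc j) k - g (Suc i) j k"
      using Suc.IH[of i "Suc j"] Suc.IH[of "Suc i" j] Suc.prems by (simp only: diff minus)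
    also have "\<dots> = g i j (Suc k)" using g[of i j k] unfolding add_eq_0_iff by simp
    finally show ?case .
  qed
  have pm: "poly (mo i k) x = x ^ i * (- 1 - x) ^ k" for i k x
    by (simp add: mo_def poly_monom poly_power)
  define P where "P = (\<Sum>i\<le>N. smult (coth_coeff i * coth_coeff (N - i)) (mo i 0 + mo 0 (N - i) + mo i (N - i)))
    - smult (coth_coeff (Suc N)) (\<Sum>i\<le>N. smult ((- 1) ^ i) (mo 0 i + mo (N - i) i + mo (N - i) 0))
    + (if N = 0 then mo 0 0 else 0)"
  have "poly P x = 0" if x: "x \<noteq> 0" "x \<noteq> - 1" for x
  proof -
    define c where "c = - 1 - x"
    have c: "c \<noteq> 0" "x + 1 + c = 0" using x by (auto simp: c_def algebra_simps eq_neg_iff_add_eq_0)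
    have s: "(\<Sum>i\<le>N. (- 1) ^ i * (c ^ i + x ^ (N - i) * c ^ i + x ^ (N - i)))
       = (\<Sum>i\<le>N. (- c) ^ i * 1 ^ (N - i)) + (\<Sum>i\<le>N. (- c) ^ i * x ^ (N - i)) + (\<Sum>i\<le>N. (- 1) ^ i * x ^ (N - i))"
      by (simp add: sum.distrib[symmetric] algebra_simps power_minus[of c])
    have ne: "- c \<noteq> 1" "- c \<noteq> x" "- 1 \<noteq> x" "- c - 1 = x" "- c - x = 1" "- 1 - x = c" using x c by (auto simp: c_def)
    have s': "coth_coeff (Suc N) * (\<Sum>i\<le>N. (- 1) ^ i * (c ^ i + x ^ (N - i) * c ^ i + x ^ (N - i)))
       = - coth_coeff (Suc N) * ((1 ^ Suc N + c ^ Suc N) / x + (x ^ Suc N + c ^ Suc N) / 1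
            + (x ^ Suc N + 1 ^ Suc N) / c)"
    proof (cases "even N")
      case True
      show ?thesis unfolding s geometric_quotient[OF ne(1)] geometric_quotient[OF ne(2)] geometric_quotient[OF ne(3)] ne(4-6)
        using True x c by (simp add: field_simps)
    next
      case False
      then have "coth_coeff (Suc N) = 0" by (intro coth_coeff_even) simp
      then show ?thesis by simp
    qed
    have "poly P x = (\<Sum>i\<le>N. coth_coeff i * coth_coeff (N - i) * (x ^ i + c ^ (N - i) + x ^ i * c ^ (N - i)))
        - coth_coeff (Suc N) * (\<Sum>i\<le>N. (- 1) ^ i * (c ^ i + x ^ (N - i) * c ^ i + x ^ (N - i)))
        + (if N = 0 then 1 else 0)"
      by (simp add: P_def pm poly_sum c_def[symmetric])
    also have "\<dots> = 0"
      using coth_coeff_identity[OF x(1) one_neq_zero c, of N]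
      unfolding s' power_one mult_1_left mult_1_right by (simp split: if_splits)
    finally show ?thesis .
  qed
  then have "UNIV - {0, - 1} \<subseteq> {x. poly P x = 0}" by auto
  moreover have "infinite (UNIV - {0, - 1 :: complex})" by (simp add: infinite_UNIV_char_0)
  ultimately have "P = 0" using poly_roots_finite[of P] by (metis finite_subset)
  then have "\<Phi> P = 0" by (simp add: zero)
  moreover have "\<Phi> (mo i 0) = g i (N - i) 0" "\<Phi> (mo 0 i) = g 0 (N - i) i"
    "\<Phi> (mo i (N - i)) = g i 0 (N - i)" "\<Phi> (mo (N - i) i) = g (N - i) 0 i" if "i \<le> N" for i
    using that by (simp_all add: mo[of i "N - i" 0] mo[of 0 "N - i" i] mo[of i 0 "N - i"] mo[of "N - i" 0 i])
  ultimately show ?thesis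
    unfolding P_def
    by (simp add: add sm diff sum zero eq_neg_iff_add_eq_0 split: if_splits)
qed

section \<open>Operations on tensors\<close>

lemma tensorsI:
  assumes "\<And>as. \<not> (length as = N \<and> set as \<subseteq> dual) \<Longrightarrow> X as = 0"
    and "\<And>as i \<beta> \<gamma>. length as = N \<Longrightarrow> set as \<subseteq> dual \<Longrightarrow> i < N \<Longrightarrow> \<beta> \<in> dual \<Longrightarrow> \<gamma> \<in> dual \<Longrightarrow>
      X (as[i := (\<lambda>v. \<beta> v + \<gamma> v)]) = X (as[i := \<beta>]) + X (as[i := \<gamma>])"
    and "\<And>as i \<beta> c. length as = N \<Longrightarrow> set as \<subseteq> dual \<Longrightarrow> i < N \<Longrightarrow> \<beta> \<in> dual \<Longrightarrow>
      X (as[i := (\<lambda>v. c * \<beta> v)]) = c * X (as[i := \<beta>])"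
  shows "X \<in> tensors N"
  unfolding tensors_def using assms by blast

lemma tensors_scaled: "X \<in> tensors N \<Longrightarrow> (\<lambda>as. c * X as) \<in> tensors N"
  by (auto simp: tensors_def algebra_simps)

lemma tensors_0: "(\<lambda>as. 0) \<in> tensors N"
  by (auto simp: tensors_def)

lemma permute_list_update:
  assumes \<sigma>: "\<sigma> permutes {..<length xs}" and i: "i < length xs"
  shows "permute_list \<sigma> (xs[i := x]) = (permute_list \<sigma> xs)[inv \<sigma> i := x]"
proof (rule nth_equalityI)
  fix k assume "k < length (permute_list \<sigma> (xs[i := x]))"
  then have k: "k < length xs" by simp
  have "\<sigma> k < length xs" using permutes_in_image[OF \<sigma>, of k] k by auto
  moreover have "\<sigma> k = i \<longleftrightarrow> k = inv \<sigma> i"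
    using permutes_inv_eq[OF \<sigma>] by metis
  ultimately show "permute_list \<sigma> (xs[i := x]) ! k = (permute_list \<sigma> xs)[inv \<sigma> i := x] ! k"
    using permute_list_nth[of \<sigma> "xs[i := x]" k] permute_list_nth[of \<sigma> xs k] \<sigma> k i
    by (cases "k = inv \<sigma> i") (auto simp: nth_list_update)
qed simp

lemma tensors_permute:
  fixes X :: "'g::complex_lie_algebra tensor"
  assumes X: "X \<in> tensors N" and \<sigma>: "\<sigma> permutes {..<N}"
  shows "(\<lambda>as. X (permute_list \<sigma> as)) \<in> tensors N"
proof -
  have i: "inv \<sigma> i < N" if "i < N" for i
    using permutes_in_image[OF permutes_inv[OF \<sigma>], of i] that by simp
  show ?thesis
  proof (rule tensorsI)
    fix as :: "('g \<Rightarrow> complex) list" assume "\<not> (length as = N \<and> set as \<subseteq> dual)"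
    then show "X (permute_list \<sigma> as) = 0"
      using \<sigma> by (intro tensors_outside[OF X]) auto
  next
    fix as :: "('g \<Rightarrow> complex) list" and i and \<beta> \<gamma> :: "'g \<Rightarrow> complex" assume "length as = N" "set as \<subseteq> dual" "i < N" "\<beta> \<in> dual" "\<gamma> \<in> dual"
    then show "X (permute_list \<sigma> (as[i := \<lambda>v. \<beta> v + \<gamma> v])) =
        X (permute_list \<sigma> (as[i := \<beta>])) + X (permute_list \<sigma> (as[i := \<gamma>]))"
      using \<sigma> i by (simp add: permute_list_update tensors_add[OF X])
  next
    fix as :: "('g \<Rightarrow> complex) list" and i and \<beta> :: "'g \<Rightarrow> complex" and c assume "length as = N" "set as \<subseteq> dual" "i < N" "\<beta> \<in> dual"
    then show "X (permute_list \<sigma> (as[i := \<lambda>v. c * \<beta> v])) = c * X (permute_list \<sigma> (as[i := \<beta>]))"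
      using \<sigma> i by (simp add: permute_list_update tensors_scale[OF X])
  qed
qed

lemma tensors_fix_prefix:
  fixes T :: "'g::complex_lie_algebra tensor"
  assumes T: "T \<in> tensors (length ls + M)" and l: "set ls \<subseteq> dual"
  shows "(\<lambda>as. T (ls @ as)) \<in> tensors M"
proof (rule tensorsI)
  fix as :: "('g \<Rightarrow> complex) list" assume "\<not> (length as = M \<and> set as \<subseteq> dual)"
  then show "T (ls @ as) = 0" by (intro tensors_outside[OF T]) auto
next
  fix as :: "('g \<Rightarrow> complex) list" and i and \<beta> \<gamma> :: "'g \<Rightarrow> complex" assume "length as = M" "set as \<subseteq> dual" "i < M" "\<beta> \<in> dual" "\<gamma> \<in> dual"
  then show "T (ls @ as[i := \<lambda>v. \<beta> v + \<gamma> v]) = T (ls @ as[i := \<beta>]) + T (ls @ as[i := \<gamma>])"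
    using tensors_add[OF T, of "ls @ as" "length ls + i"] l by (simp add: list_update_append)
next
  fix as :: "('g \<Rightarrow> complex) list" and i and \<beta> :: "'g \<Rightarrow> complex" and c assume "length as = M" "set as \<subseteq> dual" "i < M" "\<beta> \<in> dual"
  then show "T (ls @ as[i := \<lambda>v. c * \<beta> v]) = c * T (ls @ as[i := \<beta>])"
    using tensors_scale[OF T, of "ls @ as" "length ls + i"] l by (simp add: list_update_append)
qed

lemma multilinear_cons:
  assumes X: "X \<in> tensors (Suc N)" and as: "length as = N" "set as \<subseteq> dual"
  shows "\<alpha> \<in> dual \<Longrightarrow> \<beta> \<in> dual \<Longrightarrow> X ((\<lambda>v. \<alpha> v + \<beta> v) # as) = X (\<alpha> # as) + X (\<beta> # as)"
    and "\<alpha> \<in> dual \<Longrightarrow> X ((\<lambda>v. c * \<alpha> v) # as) = c * X (\<alpha> # as)"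
    and "\<alpha> \<in> dual \<Longrightarrow> \<beta> \<in> dual \<Longrightarrow> \<gamma> \<in> dual \<Longrightarrow> i < N \<Longrightarrow>
       X (\<gamma> # as[i := \<lambda>v. \<alpha> v + \<beta> v]) = X (\<gamma> # as[i := \<alpha>]) + X (\<gamma> # as[i := \<beta>])"
    and "\<alpha> \<in> dual \<Longrightarrow> \<gamma> \<in> dual \<Longrightarrow> i < N \<Longrightarrow> X (\<gamma> # as[i := \<lambda>v. c * \<alpha> v]) = c * X (\<gamma> # as[i := \<alpha>])"
  using tensors_add[OF X, of "\<alpha> # as" 0 \<alpha> \<beta>] tensors_scale[OF X, of "\<alpha> # as" 0 \<alpha> c]
    tensors_add[OF X, of "\<gamma> # as" "Suc i" \<alpha> \<beta>] tensors_scale[OF X, of "\<gamma> # as" "Suc i" \<alpha> c] as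
  by simp_all

lemma set_update_dual: "set as \<subseteq> dual \<Longrightarrow> \<beta> \<in> dual \<Longrightarrow> set (as[i := \<beta>]) \<subseteq> dual"
  using set_update_subset_insert[of as i \<beta>] by blast

lemma tpow_0: "0 \<in> tpow N"
  by (simp add: tpow_def)

lemma tpow_add: "p \<in> tpow N \<Longrightarrow> q \<in> tpow N \<Longrightarrow> p + q \<in> tpow N"
  using Poly_Mapping.keys_add[of p q] by (auto simp: tpow_def)

lemma tpow_sum: "(\<And>i. i \<in> I \<Longrightarrow> f i \<in> tpow N) \<Longrightarrow> (\<Sum>i\<in>I. f i) \<in> tpow N"
  by (induction I rule: infinite_finite_induct) (auto simp: tpow_0 intro: tpow_add)

lemma place_in_tpow: "distinct is \<Longrightarrow> set is \<subseteq> {1..N} \<Longrightarrow> place B is X \<in> tpow N"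
  by (auto simp: place_eq word_at_def intro!: tpow_sum tpow_single)

context lie_basis
begin

lemma eq_if_dual_eq:
  fixes x y :: 'g
  assumes "\<And>\<gamma>. \<gamma> \<in> dual \<Longrightarrow> \<gamma> x = \<gamma> y"
  shows "x = y"
proof -
  have "(\<Sum>b\<in>B. coord B b x *\<^sub>C b) = (\<Sum>b\<in>B. coord B b y *\<^sub>C b)"
    using assms[OF coord_in_dual] by simp
  then show ?thesis unfolding coord_expansion .
qed

text \<open>
  A tensor with all slots but the last one filled is an element of \<open>\<gg>\<close>.
\<close>

definition raise :: "'g tensor \<Rightarrow> ('g \<Rightarrow> complex) list \<Rightarrow> 'g" where
  "raise X as = (\<Sum>b\<in>B. X (as @ [coord B b]) *\<^sub>C b)"

lemma dual_raise:
  assumes X: "X \<in> tensors (Suc (length as))" and as: "set as \<subseteq> dual" and \<gamma>: "\<gamma> \<in> dual"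
  shows "\<gamma> (raise X as) = X (as @ [\<gamma>])"
proof -
  have "X ((as @ [\<gamma>])[length as := \<gamma>]) = (\<Sum>b\<in>B. \<gamma> b * X ((as @ [\<gamma>])[length as := coord B b]))"
    using as \<gamma> by (intro tensors_expand[OF X]) auto
  then show ?thesis
    by (simp add: raise_def dual_sum[OF \<gamma>] dual_scaleC[OF \<gamma>] mult.commute)
qed

lemma lie_contraction:
  assumes "\<gamma> \<in> dual"
  shows "(\<Sum>x\<in>B. \<Sum>y\<in>B. \<gamma> (lie x y) * coord B x p * coord B y q) = \<gamma> (lie p q)"
proof -
  have "(\<Sum>y\<in>B. \<gamma> (lie x y) * coord B x p * coord B y q) = coord B x p * \<gamma> (lie x q)" for x
  proof -
    have "(\<Sum>y\<in>B. \<gamma> (lie x y) * coord B x p * coord B y q) = coord B x p * (\<Sum>y\<in>B. coord B y q * \<gamma> (lie x y))"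
      by (simp add: sum_distrib_left ac_simps)
    then show ?thesis using dual_expansion[OF dual_lie[OF assms], of q x] by simp
  qed
  then show ?thesis
    using dual_expansion[OF dual_lie_left[OF assms], of p q] by simp
qed

lemma lie_contraction_scaled:
  assumes "\<gamma> \<in> dual"
  shows "(\<Sum>x\<in>B. \<Sum>y\<in>B. \<gamma> (lie x y) * (c * coord B x p) * (d * coord B y q)) = c * d * \<gamma> (lie p q)"
proof -
  have "(\<Sum>x\<in>B. \<Sum>y\<in>B. \<gamma> (lie x y) * (c * coord B x p) * (d * coord B y q))
      = c * d * (\<Sum>x\<in>B. \<Sum>y\<in>B. \<gamma> (lie x y) * coord B x p * coord B y q)"
    by (simp add: sum_distrib_left ac_simps)
  then show ?thesis unfolding lie_contraction[OF assms] .
qed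

end

section \<open>The tensors $Z_n$ as iterated contractions\<close>

locale lie_3form = lie_basis B for B :: "'g::complex_lie_algebra set" +
  fixes Z :: "'g tensor"
  assumes Z_wedge: "Z \<in> wedge 3" and Z_invariant: "invariant_tensor 3 Z"
begin

lemma Z_tensor: "Z \<in> tensors 3"
  using Z_wedge by (simp add: wedge_def)

lemma Z_swap01: "Z [\<beta>, \<alpha>, \<gamma>] = - Z [\<alpha>, \<beta>, \<gamma>]"
proof -
  have "Transposition.transpose 0 1 permutes {..<3::nat}" by (rule permutes_swap_id) auto
  moreover have "permute_list (Transposition.transpose 0 1) [\<alpha>, \<beta>, \<gamma>] = [\<beta>, \<alpha>, \<gamma>]"
    by (simp add: permute_list_def upt_rec transpose_def)
  ultimately show ?thesis
    using Z_wedge by (auto simp: wedge_def sign_swap_id dest!: spec[of _ "Transposition.transpose 0 (1::nat)"] dest: spec[of _ "[\<alpha>, \<beta>, \<gamma>]"])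
qed

lemma Z_swap12: "Z [\<alpha>, \<gamma>, \<beta>] = - Z [\<alpha>, \<beta>, \<gamma>]"
proof -
  have "Transposition.transpose 1 2 permutes {..<3::nat}" by (rule permutes_swap_id) auto
  moreover have "permute_list (Transposition.transpose 1 2) [\<alpha>, \<beta>, \<gamma>] = [\<alpha>, \<gamma>, \<beta>]"
    by (simp add: permute_list_def upt_rec transpose_def numeral_2_eq_2)
  ultimately show ?thesis
    using Z_wedge by (auto simp: wedge_def sign_swap_id dest!: spec[of _ "Transposition.transpose 1 (2::nat)"] dest: spec[of _ "[\<alpha>, \<beta>, \<gamma>]"])
qed

lemma Z_swap02: "Z [\<gamma>, \<beta>, \<alpha>] = - Z [\<alpha>, \<beta>, \<gamma>]"
  using Z_swap01[of \<gamma> \<beta> \<alpha>] Z_swap12[of \<beta> \<gamma> \<alpha>] Z_swap01[of \<beta> \<alpha> \<gamma>] by simp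

lemma Z_inv:
  assumes "\<alpha> \<in> dual" "\<beta> \<in> dual" "\<gamma> \<in> dual"
  shows "Z [\<lambda>v. \<alpha> (lie x v), \<beta>, \<gamma>] + Z [\<alpha>, \<lambda>v. \<beta> (lie x v), \<gamma>] + Z [\<alpha>, \<beta>, \<lambda>v. \<gamma> (lie x v)] = 0"
  using Z_invariant[unfolded invariant_tensor_def, rule_format, of "[\<alpha>, \<beta>, \<gamma>]" x] assms
  by (simp add: tensor_act_def numeral_3_eq_3 lessThan_Suc ac_simps)

lemma Z_add0: "\<alpha> \<in> dual \<Longrightarrow> \<alpha>' \<in> dual \<Longrightarrow> \<beta> \<in> dual \<Longrightarrow> \<gamma> \<in> dual \<Longrightarrow>
    Z [\<lambda>v. \<alpha> v + \<alpha>' v, \<beta>, \<gamma>] = Z [\<alpha>, \<beta>, \<gamma>] + Z [\<alpha>', \<beta>, \<gamma>]"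
  using tensors_add[OF Z_tensor, of "[\<alpha>, \<beta>, \<gamma>]" 0 \<alpha> \<alpha>'] by simp

lemma Z_scale0: "\<alpha> \<in> dual \<Longrightarrow> \<beta> \<in> dual \<Longrightarrow> \<gamma> \<in> dual \<Longrightarrow>
    Z [\<lambda>v. c * \<alpha> v, \<beta>, \<gamma>] = c * Z [\<alpha>, \<beta>, \<gamma>]"
  using tensors_scale[OF Z_tensor, of "[\<alpha>, \<beta>, \<gamma>]" 0 \<alpha> c] by simp

lemma Z_add1: "\<alpha> \<in> dual \<Longrightarrow> \<beta> \<in> dual \<Longrightarrow> \<beta>' \<in> dual \<Longrightarrow> \<gamma> \<in> dual \<Longrightarrow>
    Z [\<alpha>, \<lambda>v. \<beta> v + \<beta>' v, \<gamma>] = Z [\<alpha>, \<beta>, \<gamma>] + Z [\<alpha>, \<beta>', \<gamma>]"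
  using tensors_add[OF Z_tensor, of "[\<alpha>, \<beta>, \<gamma>]" 1 \<beta> \<beta>'] by simp

lemma Z_scale1: "\<alpha> \<in> dual \<Longrightarrow> \<beta> \<in> dual \<Longrightarrow> \<gamma> \<in> dual \<Longrightarrow>
    Z [\<alpha>, \<lambda>v. c * \<beta> v, \<gamma>] = c * Z [\<alpha>, \<beta>, \<gamma>]"
  using tensors_scale[OF Z_tensor, of "[\<alpha>, \<beta>, \<gamma>]" 1 \<beta> c] by simp

lemma Z_zero0: "\<beta> \<in> dual \<Longrightarrow> \<gamma> \<in> dual \<Longrightarrow> Z [\<lambda>v. 0, \<beta>, \<gamma>] = 0"
  using Z_scale0[OF zero_in_dual, of \<beta> \<gamma> 0] by simp

lemma Z_zero1: "\<alpha> \<in> dual \<Longrightarrow> \<gamma> \<in> dual \<Longrightarrow> Z [\<alpha>, \<lambda>v. 0, \<gamma>] = 0"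
  using Z_scale1[OF _ zero_in_dual, of \<alpha> \<gamma> 0] by simp

abbreviation zsharp :: "('g \<Rightarrow> complex) \<Rightarrow> ('g \<Rightarrow> complex) \<Rightarrow> 'g" where
  "zsharp \<alpha> \<beta> \<equiv> raise Z [\<alpha>, \<beta>]"

lemma dual_zsharp: "\<alpha> \<in> dual \<Longrightarrow> \<beta> \<in> dual \<Longrightarrow> \<gamma> \<in> dual \<Longrightarrow> \<gamma> (zsharp \<alpha> \<beta>) = Z [\<alpha>, \<beta>, \<gamma>]"
  using dual_raise[of Z "[\<alpha>, \<beta>]" \<gamma>] Z_tensor by (simp add: numeral_3_eq_3)

lemma zsharp_add0: "\<alpha> \<in> dual \<Longrightarrow> \<alpha>' \<in> dual \<Longrightarrow> \<beta> \<in> dual \<Longrightarrow>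
    zsharp (\<lambda>v. \<alpha> v + \<alpha>' v) \<beta> = zsharp \<alpha> \<beta> + zsharp \<alpha>' \<beta>"
  by (simp add: raise_def Z_add0 scaleC_add_left sum.distrib)

lemma zsharp_scale0: "\<alpha> \<in> dual \<Longrightarrow> \<beta> \<in> dual \<Longrightarrow> zsharp (\<lambda>v. c * \<alpha> v) \<beta> = c *\<^sub>C zsharp \<alpha> \<beta>"
  by (simp add: raise_def Z_scale0 cvec.scale_sum_right scaleC_scaleC)

lemma zsharp_add1: "\<alpha> \<in> dual \<Longrightarrow> \<beta> \<in> dual \<Longrightarrow> \<beta>' \<in> dual \<Longrightarrow>
    zsharp \<alpha> (\<lambda>v. \<beta> v + \<beta>' v) = zsharp \<alpha> \<beta> + zsharp \<alpha> \<beta>'"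
  by (simp add: raise_def Z_add1 scaleC_add_left sum.distrib)

lemma zsharp_scale1: "\<alpha> \<in> dual \<Longrightarrow> \<beta> \<in> dual \<Longrightarrow> zsharp \<alpha> (\<lambda>v. c * \<beta> v) = c *\<^sub>C zsharp \<alpha> \<beta>"
  by (simp add: raise_def Z_scale1 cvec.scale_sum_right scaleC_scaleC)

lemma zsharp_zero0: "\<beta> \<in> dual \<Longrightarrow> zsharp (\<lambda>v. 0) \<beta> = 0"
  using zsharp_scale0[OF zero_in_dual, of \<beta> 0] by simp

text \<open>
  The element of \<open>\<gg>\<^sup>\<otimes>\<^sup>2\<^sup>n\<^sup>+\<^sup>3\<close> that the iterated commutator of \<open>n + 1\<close> copies of \<open>Z\<close> represents.  The
  bracket of the last factor \<open>x\<close> of the first \<open>Z\<close> with the first factor of the other copies stands in factor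
  three; evaluating it at \<open>\<gamma>\<close> means evaluating the other copies at \<open>\<gamma>([x, \<cdot>])\<close> in their first slot.
\<close>

fun chain :: "nat \<Rightarrow> 'g tensor" where
  "chain 0 = Z"
| "chain (Suc n) = (\<lambda>as. if length as = 2 * n + 5 \<and> set as \<subseteq> dual
     then chain n ((\<lambda>v. (as ! 2) (lie (zsharp (as ! 0) (as ! 1)) v)) # drop 3 as) else 0)"

declare chain.simps(2) [simp del]

lemma chain_Suc: "length as = 2 * n + 2 \<Longrightarrow> set as \<subseteq> dual \<Longrightarrow> \<alpha> \<in> dual \<Longrightarrow> \<beta> \<in> dual \<Longrightarrow> \<gamma> \<in> dual \<Longrightarrow>
    chain (Suc n) (\<alpha> # \<beta> # \<gamma> # as) = chain n ((\<lambda>v. \<gamma> (lie (zsharp \<alpha> \<beta>) v)) # as)"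
proof -
  assume as: "length as = 2 * n + 2" "set as \<subseteq> dual" "\<alpha> \<in> dual" "\<beta> \<in> dual" "\<gamma> \<in> dual"
  have "(\<alpha> # \<beta> # \<gamma> # as) ! 2 = \<gamma>" "drop 3 (\<alpha> # \<beta> # \<gamma> # as) = as"
    by (simp_all add: numeral_2_eq_2 numeral_3_eq_3)
  then show ?thesis using as by (simp add: chain.simps(2))
qed

lemma chain_in_tensors: "chain n \<in> tensors (2 * n + 3)"
proof (induction n)
  case 0
  then show ?case using Z_tensor by simp
next
  case (Suc n)
  then have X: "chain n \<in> tensors (Suc (2 * n + 2))" by (simp add: numeral_3_eq_3)
  note ml = multilinear_cons[OF X]
  have split: "\<exists>\<alpha> \<beta> \<gamma> bs. as = \<alpha> # \<beta> # \<gamma> # bs \<and> length bs = 2 * n + 2 \<and> \<alpha> \<in> dual \<and> \<beta> \<in> dual \<and> \<gamma> \<in> dual \<and> set bs \<subseteq> dual"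
    if "length as = 2 * Suc n + 3" "set as \<subseteq> dual" for as :: "('g \<Rightarrow> complex) list"
    using that by (auto simp: length_Suc_conv numeral_3_eq_3)
  show ?case
  proof (rule tensorsI)
    fix as :: "('g \<Rightarrow> complex) list" assume "\<not> (length as = 2 * Suc n + 3 \<and> set as \<subseteq> (dual :: ('g \<Rightarrow> complex) set))"
    then show "chain (Suc n) as = 0" by (auto simp: chain.simps(2))
  next
    fix as :: "('g \<Rightarrow> complex) list" and i and \<phi> \<psi> :: "'g \<Rightarrow> complex" assume as: "length as = 2 * Suc n + 3" "set as \<subseteq> dual" and i: "i < 2 * Suc n + 3"
      and d: "\<phi> \<in> (dual :: ('g \<Rightarrow> complex) set)" "\<psi> \<in> dual"
    obtain \<alpha> \<beta> \<gamma> bs where s: "as = \<alpha> # \<beta> # \<gamma> # bs" "length bs = 2 * n + 2" "\<alpha> \<in> dual" "\<beta> \<in> dual" "\<gamma> \<in> dual" "set bs \<subseteq> dual"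
      using split[OF as] by auto
    consider "i = 0" | "i = 1" | "i = 2" | j where "i = Suc (Suc (Suc j))" "j < 2 * n + 2"
      using i by (cases i; cases "i - 1"; cases "i - 2") auto
    then show "chain (Suc n) (as[i := \<lambda>v. \<phi> v + \<psi> v]) = chain (Suc n) (as[i := \<phi>]) + chain (Suc n) (as[i := \<psi>])"
    proof cases
      case 4
      then show ?thesis
        using s d by (simp add: chain_Suc ml set_update_dual dual_add_closed dual_lie)
    qed (use s d in \<open>simp_all add: chain_Suc ml dual_add_closed dual_lie zsharp_add0 zsharp_add1
          lie_add_left dual_plus numeral_2_eq_2\<close>)
  next
    fix as :: "('g \<Rightarrow> complex) list" and i and \<phi> :: "'g \<Rightarrow> complex" and c assume as: "length as = 2 * Suc n + 3" "set as \<subseteq> dual" and i: "i < 2 * Suc n + 3"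
      and d: "\<phi> \<in> (dual :: ('g \<Rightarrow> complex) set)"
    obtain \<alpha> \<beta> \<gamma> bs where s: "as = \<alpha> # \<beta> # \<gamma> # bs" "length bs = 2 * n + 2" "\<alpha> \<in> dual" "\<beta> \<in> dual" "\<gamma> \<in> dual" "set bs \<subseteq> dual"
      using split[OF as] by auto
    consider "i = 0" | "i = 1" | "i = 2" | j where "i = Suc (Suc (Suc j))" "j < 2 * n + 2"
      using i by (cases i; cases "i - 1"; cases "i - 2") auto
    then show "chain (Suc n) (as[i := \<lambda>v. c * \<phi> v]) = c * chain (Suc n) (as[i := \<phi>])"
    proof cases
      case 4
      then show ?thesis
        using s d by (simp add: chain_Suc ml set_update_dual dual_scale_closed dual_lie)
    qed (use s d in \<open>simp_all add: chain_Suc ml dual_scale_closed dual_lie zsharp_scale0 zsharp_scale1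
          lie_scaleC_left dual_scaleC numeral_2_eq_2\<close>)
  qed
qed

text \<open>
  Consecutive copies of \<open>Z\<close> overlap in one factor, so each commutator is a contraction.
\<close>

lemma iter_comm_chain:
  "1 \<le> i \<Longrightarrow> i + 2 * n + 2 \<le> N \<Longrightarrow> upow_eq N (iter_comm B Z i n) (place B [i..<i + 2 * n + 3] (chain n))"
proof (induction n arbitrary: i)
  case 0
  have "[i..<i + 3] = [i, i + 1, i + 2]" by (simp add: upt_conv_Cons)
  then show ?case by (simp add: upow_eq_refl)
next
  case (Suc n)
  let ?ks = "[i..<i + 2 * Suc n + 3]" and ?js = "[i + 2..<i + 2 + 2 * n + 3]"
  have e: "Suc i = i + 1" "Suc (i + 1) = i + 2" "Suc (i + 2) = i + 3" "i + 2 * Suc n + 3 = i + 2 * n + 5"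
    "i + 2 + 2 * n + 3 = i + 2 * n + 5" by simp_all
  have js: "?js = (i + 2) # [i + 3..<i + 2 * n + 5]"
    unfolding e(5) by (subst upt_conv_Cons) (simp, simp only: e)
  then have ks: "?ks = i # (i + 1) # (i + 2) # [i + 3..<i + 2 * n + 5]"
    unfolding e(4,5) by (simp only: upt_conv_Cons[of i] upt_conv_Cons[of "i + 1"] e)
  have "upow_eq N (iter_comm B Z (i + 2) n) (place B ?js (chain n))"
    using Suc.prems by (intro Suc.IH) auto
  then have "upow_eq N (iter_comm B Z i (Suc n)) (comm (place B [i, i + 1, i + 2] Z) (place B ?js (chain n)))"
    unfolding iter_comm.simps using Suc.prems by (intro upow_eq_comm place_in_tpow) auto
  moreover have "upow_eq N (comm (place B [i, i + 1, i + 2] Z) (place B ?js (chain n))) (place B ?ks (chain (Suc n)))"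
  proof (rule comm_place[where j = "i + 2"])
    fix K assume K: "K \<in> PiE (set ?ks) (\<lambda>_. B)"
    define bs where "bs = map (\<lambda>k. coord B (K k)) [i + 3..<i + 2 * n + 5]"
    have bs: "length bs = 2 * n + 2" "set bs \<subseteq> dual" by (auto simp: bs_def)
    have m: "map (\<lambda>k. coord B ((K(i + 2 := y)) k)) [i + 3..<i + 2 * n + 5] = bs" for y
      unfolding bs_def by (intro map_cong) auto
    let ?x = "zsharp (coord B (K i)) (coord B (K (i + 1)))"
    have X: "chain n \<in> tensors (2 * n + 3)" by (rule chain_in_tensors)
    have "chain (Suc n) (map (\<lambda>k. coord B (K k)) ?ks)
       = chain n ((\<lambda>v. coord B (K (i + 2)) (lie ?x v)) # bs)"
      unfolding ks list.map bs_def[symmetric] using bs by (intro chain_Suc) auto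
    also have "\<dots> = (\<Sum>y\<in>B. coord B (K (i + 2)) (lie ?x y) * chain n (coord B y # bs))"
      using tensors_expand[OF X, of "coord B (K i) # bs" 0 "\<lambda>v. coord B (K (i + 2)) (lie ?x v)"] bs
      by (simp add: dual_lie)
    also have "\<dots> = (\<Sum>y\<in>B. (\<Sum>x\<in>B. coord B x ?x * coord B (K (i + 2)) (lie x y)) * chain n (coord B y # bs))"
      using dual_expansion[OF dual_lie_left[OF coord_in_dual]] by (intro sum.cong refl) simp
    also have "\<dots> = (\<Sum>x\<in>B. \<Sum>y\<in>B. coord B (K (i + 2)) (lie x y)
         * Z [coord B (K i), coord B (K (i + 1)), coord B x] * chain n (coord B y # bs))"
      by (subst sum.swap) (simp add: sum_distrib_right sum_distrib_left dual_zsharp ac_simps)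
    also have "\<dots> = (\<Sum>x\<in>B. \<Sum>y\<in>B. coord B (K (i + 2)) (lie x y)
         * Z (map (\<lambda>k. coord B ((K(i + 2 := x)) k)) [i, i + 1, i + 2])
         * chain n (map (\<lambda>k. coord B ((K(i + 2 := y)) k)) ?js))"
      unfolding js list.map m by simp
    finally show "chain (Suc n) (map (\<lambda>k. coord B (K k)) ?ks)
      = (\<Sum>x\<in>B. \<Sum>y\<in>B. coord B (K (i + 2)) (lie x y)
         * Z (map (\<lambda>k. coord B ((K(i + 2 := x)) k)) [i, i + 1, i + 2])
         * chain n (map (\<lambda>k. coord B ((K(i + 2 := y)) k)) ?js))" .
  qed (use Suc.prems in auto)
  ultimately show ?case by (rule upow_eq_trans)
qed

lemma tensor_of_iter_comm: "tensor_of B (2 * n + 3) (iter_comm B Z 1 n) = chain n"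
proof (rule tensor_of_eq[OF chain_in_tensors])
  have e: "1 + 2 * n + 3 = 2 * n + 3 + 1" by simp
  have "upow_eq (2 * n + 3) (iter_comm B Z 1 n) (place B [1..<1 + 2 * n + 3] (chain n))"
    by (rule iter_comm_chain) simp_all
  then show "upow_eq (2 * n + 3) (place B [1..<2 * n + 3 + 1] (chain n)) (iter_comm B Z 1 n)"
    unfolding e by (rule upow_eq_sym)
qed

text \<open>
  The average over permutations disappears, as all permuted arguments are equal to \<open>l\<close>.
\<close>

lemma Z_sup_eq: "Z_sup B Z (Suc n) l [\<alpha>, \<beta>] = chain n (\<alpha> # replicate (2 * n + 1) l @ [\<beta>])"
proof -
  let ?as = "\<alpha> # replicate (2 * n + 1) l @ [\<beta>]"
  have p: "permute_list \<sigma> ?as = ?as" if \<sigma>: "\<sigma> permutes {1..<2 * Suc n}" for \<sigma>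
  proof (rule nth_equalityI)
    fix i assume "i < length (permute_list \<sigma> ?as)"
    then have i: "i < 2 * n + 3" by simp
    have mid: "?as ! k = l" if "k \<in> {1..<2 * Suc n}" for k
      using that by (cases k) (auto simp: nth_append simp del: replicate.simps)
    have "\<sigma> permutes {..<2 * n + 3}" by (rule permutes_subset[OF \<sigma>]) auto
    then have "permute_list \<sigma> ?as ! i = ?as ! \<sigma> i" using i by (intro permute_list_nth) (simp_all add: numeral_3_eq_3)
    also have "\<dots> = ?as ! i"
    proof (cases "i \<in> {1..<2 * Suc n}")
      case True
      then show ?thesis using permutes_in_image[OF \<sigma>, of i] mid by metis
    next
      case False
      then show ?thesis using permutes_not_in[OF \<sigma>] by simp
    qed
    finally show "permute_list \<sigma> ?as ! i = ?as ! i" .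
  qed simp
  have c: "card {\<sigma>. \<sigma> permutes {1..<2 * Suc n}} = fact (2 * n + 1)"
    by (rule card_permutations) auto
  have "Z_sup B Z (Suc n) l [\<alpha>, \<beta>] = Sym_mid (Suc n) (chain n) ?as"
  proof -
    have e: "2 * Suc n + 1 = 2 * n + 3" "2 * Suc n - 1 = 2 * n + 1" "Suc n - 1 = n" by simp_all
    show ?thesis
      unfolding Z_sup_def Z_sub_def e tensor_of_iter_comm by simp
  qed
  also have "\<dots> = (\<Sum>\<sigma> | \<sigma> permutes {1..<2 * Suc n}. chain n ?as) / fact (2 * n + 1)"
    unfolding Sym_mid_def using p by (intro arg_cong2[where f = "(/)"] sum.cong) auto
  also have "\<dots> = chain n ?as"
    unfolding sum_constant c of_nat_fact by (rule nonzero_mult_div_cancel_left) (rule fact_nonzero)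
  finally show ?thesis .
qed

section \<open>The double\<close>

text \<open>
  The operator \<open>ad l\<close> on \<open>\<gg> \<oplus> \<gg>\<^sup>*\<close>, where \<open>\<gg>\<close> acts on \<open>\<gg>\<^sup>*\<close> by the coadjoint action and
  \<open>[\<alpha>, \<beta>] = -Z(\<alpha>, \<beta>, \<cdot>)\<close>.  The bracket of the double enters only through this operator and
  through the pairing and the 3-form defined next.
\<close>

definition double_ad :: "('g \<Rightarrow> complex) \<Rightarrow> 'g \<times> ('g \<Rightarrow> complex) \<Rightarrow> 'g \<times> ('g \<Rightarrow> complex)" where
  "double_ad l u = (zsharp (snd u) l, \<lambda>v. l (lie (fst u) v))"

abbreviation double_ad_pow :: "('g \<Rightarrow> complex) \<Rightarrow> nat \<Rightarrow> 'g \<times> ('g \<Rightarrow> complex) \<Rightarrow> 'g \<times> ('g \<Rightarrow> complex)" where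
  "double_ad_pow l n \<equiv> double_ad l ^^ n"

definition pairing :: "'g \<times> ('g \<Rightarrow> complex) \<Rightarrow> 'g \<times> ('g \<Rightarrow> complex) \<Rightarrow> complex" where
  "pairing u w = snd w (fst u) + snd u (fst w)"

text \<open>
  The 3-form \<open>\<langle>[u, v], w\<rangle>\<close>; its restrictions to \<open>\<gg> \<times> \<gg> \<times> \<gg>\<^sup>*\<close> and to \<open>\<gg>\<^sup>* \<times> \<gg>\<^sup>* \<times> \<gg>\<^sup>*\<close> are the
  bracket of \<open>\<gg>\<close> and \<open>-Z\<close>.
\<close>

definition cubic :: "'g \<times> ('g \<Rightarrow> complex) \<Rightarrow> 'g \<times> ('g \<Rightarrow> complex) \<Rightarrow> 'g \<times> ('g \<Rightarrow> complex) \<Rightarrow> complex" where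
  "cubic u v w = snd w (lie (fst u) (fst v)) + snd u (lie (fst v) (fst w)) + snd v (lie (fst w) (fst u))
     - Z [snd u, snd v, snd w]"

lemma double_ad_dual: "l \<in> dual \<Longrightarrow> snd (double_ad l u) \<in> dual"
  by (simp add: double_ad_def dual_lie)

lemma double_ad_pow_dual: "l \<in> dual \<Longrightarrow> snd u \<in> dual \<Longrightarrow> snd (double_ad_pow l n u) \<in> dual"
  by (cases n) (simp_all add: double_ad_dual)

lemma cubic_cyclic: "cubic v w u = cubic u v w"
  using Z_swap02[of "snd u" "snd w" "snd v"] Z_swap12[of "snd u" "snd w" "snd v"]
  by (simp add: cubic_def)

lemma cubic_swap:
  assumes "snd u \<in> dual" "snd v \<in> dual" "snd w \<in> dual"
  shows "cubic v u w = - cubic u v w"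
  using assms Z_swap01[of "snd v" "snd u" "snd w"] lie_swap[of "fst v" "fst u"]
    lie_swap[of "fst u" "fst w"] lie_swap[of "fst w" "fst v"]
  by (simp add: cubic_def dual_minus)

text \<open>
  Invariance of \<open>Z\<close>, in the form in which it enters the invariance of the 3-form.
\<close>

lemma zsharp_invariance:
  assumes "l \<in> dual" "\<beta> \<in> dual" "\<gamma> \<in> dual"
  shows "Z [\<lambda>v. l (lie x v), \<beta>, \<gamma>] = \<gamma> (lie x (zsharp \<beta> l)) - \<beta> (lie x (zsharp \<gamma> l))"
proof -
  have 1: "\<gamma> (lie x (zsharp \<beta> l)) = Z [\<beta>, l, \<lambda>v. \<gamma> (lie x v)]"
    using dual_zsharp[OF assms(2,1) dual_lie[OF assms(3)]] by simp
  have 2: "\<beta> (lie x (zsharp \<gamma> l)) = Z [\<gamma>, l, \<lambda>v. \<beta> (lie x v)]"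
    using dual_zsharp[OF assms(3,1) dual_lie[OF assms(2)]] by simp
  have "Z [\<lambda>v. l (lie x v), \<beta>, \<gamma>] = - Z [l, \<lambda>v. \<beta> (lie x v), \<gamma>] - Z [l, \<beta>, \<lambda>v. \<gamma> (lie x v)]"
    using Z_inv[OF assms, of x] by (simp add: algebra_simps eq_neg_iff_add_eq_0)
  then show ?thesis
    unfolding 1 2 Z_swap01[of \<beta> l] Z_swap01[of \<gamma> l] Z_swap12[of l \<gamma>] by simp
qed

text \<open>
  The components in \<open>\<gg>\<close> contribute the Jacobi identity paired with \<open>l\<close>.  The remaining terms contain one
  component in \<open>\<gg>\<close> and two in \<open>\<gg>\<^sup>*\<close>, and for each of the three positions of the former they cancel by
  \<open>zsharp_invariance\<close>.
\<close>

lemma cubic_invariant: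
  assumes l: "l \<in> dual" and d: "snd u \<in> dual" "snd v \<in> dual" "snd w \<in> dual"
  shows "cubic (double_ad l u) v w + cubic u (double_ad l v) w + cubic u v (double_ad l w) = 0"
proof -
  obtain x \<alpha> y \<beta> z \<gamma> where e: "u = (x, \<alpha>)" "v = (y, \<beta>)" "w = (z, \<gamma>)" by (metis surj_pair)
  have d: "\<alpha> \<in> dual" "\<beta> \<in> dual" "\<gamma> \<in> dual" using d by (simp_all add: e)
  have j: "l (lie x (lie y z)) + l (lie y (lie z x)) + l (lie z (lie x y)) = 0"
    using jacobi[of x y z] by (simp add: dual_plus[OF l, symmetric] dual_zero[OF l])
  have y: "Z [\<alpha>, \<lambda>v. l (lie y v), \<gamma>] = - Z [\<lambda>v. l (lie y v), \<alpha>, \<gamma>]" by (rule Z_swap01)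
  have z: "Z [\<alpha>, \<beta>, \<lambda>v. l (lie z v)] = Z [\<lambda>v. l (lie z v), \<alpha>, \<beta>]"
    using Z_swap02[of "\<lambda>v. l (lie z v)" \<beta> \<alpha>] Z_swap12[of "\<lambda>v. l (lie z v)" \<beta> \<alpha>] by simp
  have s: "\<gamma> (lie (zsharp \<alpha> l) y) = - \<gamma> (lie y (zsharp \<alpha> l))"
    "\<alpha> (lie (zsharp \<beta> l) z) = - \<alpha> (lie z (zsharp \<beta> l))"
    "\<beta> (lie (zsharp \<gamma> l) x) = - \<beta> (lie x (zsharp \<gamma> l))"
    using d by (simp_all add: dual_minus[symmetric] lie_swap[symmetric])
  show ?thesis
    using j unfolding e cubic_def double_ad_def fst_conv snd_conv y z s
      zsharp_invariance[OF l d(2,3)] zsharp_invariance[OF l d(1,3)] zsharp_invariance[OF l d(1,2)]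
    by (simp add: algebra_simps)
qed

lemma pairing_double_ad:
  assumes l: "l \<in> dual" and d: "snd u \<in> dual" "snd w \<in> dual"
  shows "pairing (double_ad l u) w = - pairing u (double_ad l w)"
  using dual_zsharp[OF d(1) l d(2)] dual_zsharp[OF d(2) l d(1)] Z_swap02[of "snd w" l "snd u"]
    lie_swap[of "fst w" "fst u"]
  by (simp add: pairing_def double_ad_def dual_minus[OF l])

lemma pairing_double_ad_pow:
  assumes l: "l \<in> dual" and d: "snd u \<in> dual" "snd w \<in> dual"
  shows "pairing (double_ad_pow l n u) w = (- 1) ^ n * pairing u (double_ad_pow l n w)"
  using d(2)
proof (induction n arbitrary: w)
  case (Suc n)
  have "pairing (double_ad_pow l (Suc n) u) w = - pairing (double_ad_pow l n u) (double_ad l w)"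
    using pairing_double_ad[OF l double_ad_pow_dual[OF l d(1)] Suc.prems] by simp
  also have "\<dots> = - ((- 1) ^ n * pairing u (double_ad_pow l n (double_ad l w)))"
    by (simp add: Suc.IH double_ad_dual l)
  finally show ?case by (simp add: funpow_swap1)
qed simp

lemma pairing_double_ad_cubic:
  assumes m: "m \<in> dual" and d: "snd v \<in> dual" "snd w \<in> dual"
  shows "pairing (double_ad m v) w = cubic (0, m) v w"
  using dual_zsharp[OF d(1) m d(2)] Z_swap01[of "snd v" m "snd w"] d
  by (simp add: pairing_def double_ad_def cubic_def dual_zero)

lemma zsharp_combination1:
  assumes "\<alpha> \<in> dual" "l \<in> dual" "m \<in> dual"
  shows "zsharp \<alpha> (\<lambda>v. l v + s * m v) = zsharp \<alpha> l + s *\<^sub>C zsharp \<alpha> m"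
  using assms by (simp add: zsharp_add1 zsharp_scale1 dual_scale_closed)

lemma pairing_double_ad_combination:
  assumes "l \<in> dual" "m \<in> dual" "snd u \<in> dual" "snd w \<in> dual"
  shows "pairing u (double_ad (\<lambda>v. l v + s * m v) w) = pairing u (double_ad l w) + s * pairing u (double_ad m w)"
  using assms
  by (simp add: pairing_def double_ad_def zsharp_combination1 dual_plus dual_scaleC algebra_simps)

text \<open>
  The Leibniz rule.  Moving the outermost operator to the other side of the pairing keeps the induction among
  scalar functions of \<open>s\<close>.
\<close>

lemma double_ad_pow_derivative:
  assumes l: "l \<in> dual" and m: "m \<in> dual" and u: "snd u \<in> dual" and w: "snd w \<in> dual"
  shows "((\<lambda>s. pairing (double_ad_pow (\<lambda>v. l v + s * m v) n u) w) has_field_derivative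
    (\<Sum>i<n. pairing (double_ad_pow l i (double_ad m (double_ad_pow l (n - Suc i) u))) w)) (at 0)"
  using w
proof (induction n arbitrary: w)
  case 0
  then show ?case by simp
next
  case (Suc n)
  let ?ls = "\<lambda>s v. l v + s * m v"
  have ls: "?ls s \<in> dual" for s using l m by (rule dual_combination)
  have eq: "pairing (double_ad_pow (?ls s) (Suc n) u) w
      = - pairing (double_ad_pow (?ls s) n u) (double_ad l w) - s * pairing (double_ad_pow (?ls s) n u) (double_ad m w)" for s
    using pairing_double_ad[OF ls[of s] double_ad_pow_dual[OF ls u] Suc.prems]
      pairing_double_ad_combination[OF l m double_ad_pow_dual[OF ls u] Suc.prems]
    by simp
  have "((\<lambda>s. - pairing (double_ad_pow (?ls s) n u) (double_ad l w) - s * pairing (double_ad_pow (?ls s) n u) (double_ad m w))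
     has_field_derivative (- (\<Sum>i<n. pairing (double_ad_pow l i (double_ad m (double_ad_pow l (n - Suc i) u))) (double_ad l w))
       - (1 * pairing (double_ad_pow (?ls 0) n u) (double_ad m w)
          + (\<Sum>i<n. pairing (double_ad_pow l i (double_ad m (double_ad_pow l (n - Suc i) u))) (double_ad m w)) * 0))) (at 0)"
    by (intro DERIV_diff DERIV_minus DERIV_mult DERIV_ident Suc.IH double_ad_dual l m)
  also have "- (\<Sum>i<n. pairing (double_ad_pow l i (double_ad m (double_ad_pow l (n - Suc i) u))) (double_ad l w))
       - (1 * pairing (double_ad_pow (?ls 0) n u) (double_ad m w)
          + (\<Sum>i<n. pairing (double_ad_pow l i (double_ad m (double_ad_pow l (n - Suc i) u))) (double_ad m w)) * 0)
     = (\<Sum>i<Suc n. pairing (double_ad_pow l i (double_ad m (double_ad_pow l (Suc n - Suc i) u))) w)"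
  proof -
    have "- pairing (double_ad_pow l i (double_ad m (double_ad_pow l (n - Suc i) u))) (double_ad l w)
        = pairing (double_ad_pow l (Suc i) (double_ad m (double_ad_pow l (n - Suc i) u))) w" for i
      using pairing_double_ad[OF l double_ad_pow_dual[OF l double_ad_dual[OF m]] Suc.prems] by simp
    moreover have "- pairing (double_ad_pow l n u) (double_ad m w) = pairing (double_ad m (double_ad_pow l n u)) w"
      using pairing_double_ad[OF m double_ad_pow_dual[OF l u] Suc.prems] by simp
    ultimately show ?thesis
      by (simp add: sum.lessThan_Suc_shift sum_negf[symmetric] del: sum.lessThan_Suc funpow.simps)
  qed
  finally show ?case unfolding eq .
qed

lemma double_ad_pow_even:
  assumes l: "l \<in> dual" and "\<alpha> \<in> dual"
  shows "\<exists>\<alpha>'\<in>dual. double_ad_pow l (2 * n) (0, \<alpha>) = (0, \<alpha>')"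
proof (induction n)
  case (Suc n)
  then obtain \<alpha>' where "\<alpha>' \<in> dual" "double_ad_pow l (2 * n) (0, \<alpha>) = (0, \<alpha>')" by auto
  moreover have "double_ad_pow l (2 * Suc n) (0, \<alpha>) = double_ad l (double_ad l (double_ad_pow l (2 * n) (0, \<alpha>)))"
    by simp
  ultimately show ?case
    using l by (simp add: double_ad_def[of l "(_, _)"] zsharp_zero0 dual_zero dual_lie del: funpow.simps)
qed (use assms in simp)

text \<open>
  The operator exchanges \<open>\<gg>\<close> and \<open>\<gg>\<^sup>*\<close>.
\<close>

lemma double_ad_pow_odd_snd:
  assumes l: "l \<in> dual" and "\<alpha> \<in> dual" and "odd k"
  shows "snd (double_ad_pow l k (0, \<alpha>)) = (\<lambda>v. 0)"
proof -
  obtain n where "k = Suc (2 * n)" using \<open>odd k\<close> by (auto elim: oddE)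
  with double_ad_pow_even[OF assms(1,2), of n] show ?thesis
    using l by (auto simp: double_ad_def dual_zero)
qed

lemma chain_eq_double_ad_pow:
  assumes l: "l \<in> dual" and "\<alpha> \<in> dual" and \<beta>: "\<beta> \<in> dual"
  shows "chain n (\<alpha> # replicate (2 * n + 1) l @ [\<beta>]) = \<beta> (fst (double_ad_pow l (2 * n + 1) (0, \<alpha>)))"
  using assms(2)
proof (induction n arbitrary: \<alpha>)
  case 0
  then show ?case using l \<beta> by (simp add: double_ad_def dual_zsharp)
next
  case (Suc n)
  let ?\<alpha> = "\<lambda>v. l (lie (zsharp \<alpha> l) v)"
  have "chain (Suc n) (\<alpha> # replicate (2 * Suc n + 1) l @ [\<beta>]) = chain (Suc n) (\<alpha> # l # l # replicate (2 * n + 1) l @ [\<beta>])"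
    by simp
  also have "\<dots> = chain n (?\<alpha> # replicate (2 * n + 1) l @ [\<beta>])"
    using Suc.prems l \<beta> by (intro chain_Suc) auto
  also have "\<dots> = \<beta> (fst (double_ad_pow l (2 * n + 1) (0, ?\<alpha>)))"
    using l by (intro Suc.IH) (simp add: dual_lie)
  also have "(0, ?\<alpha>) = double_ad_pow l 2 (0, \<alpha>)"
    using l by (simp add: numeral_2_eq_2 double_ad_def dual_zero zsharp_zero0)
  also have "double_ad_pow l (2 * n + 1) (double_ad_pow l 2 (0, \<alpha>)) = double_ad_pow l (2 * Suc n + 1) (0, \<alpha>)"
  proof -
    have e: "2 * Suc n + 1 = (2 * n + 1) + 2" by simp
    show ?thesis unfolding e by (simp only: funpow_add comp_apply)
  qed
  finally show ?case .
qed

section \<open>The formal map $\rho_Z$\<close>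

lemma pairing_dual: "snd u \<in> dual \<Longrightarrow> pairing u (0, \<beta>) = \<beta> (fst u)"
  by (simp add: pairing_def dual_zero)

lemma rho_Z_odd: "rho_Z B Z (2 * n + 1) l as = coth_coeff (2 * n + 1) * Z_sup B Z (Suc n) l as"
proof -
  have "{m. 2 * m + 1 = 2 * n + 1} = {n}" by auto
  then show ?thesis unfolding rho_Z_def by (simp add: c_coeff_eq)
qed

lemma rho_Z_even: "even k \<Longrightarrow> rho_Z B Z k l as = 0"
proof -
  assume "even k"
  then have "{n. 2 * n + 1 = k} = {}" by auto
  then show ?thesis by (simp add: rho_Z_def del: One_nat_def)
qed

text \<open>
  The formal map is \<open>f(A\<^sub>l)\<close> with \<open>f(z) = coth z - 1/z\<close>, degree by degree.
\<close>

lemma rho_Z_eq: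
  assumes "l \<in> dual" "\<alpha> \<in> dual" "\<beta> \<in> dual"
  shows "rho_Z B Z k l [\<alpha>, \<beta>] = coth_coeff k * pairing (double_ad_pow l k (0, \<alpha>)) (0, \<beta>)"
proof (cases "even k")
  case True
  then show ?thesis by (simp add: rho_Z_even coth_coeff_even)
next
  case False
  then obtain n where k: "k = 2 * n + 1" by (rule oddE)
  have "pairing (double_ad_pow l k (0, \<alpha>)) (0, \<beta>) = \<beta> (fst (double_ad_pow l k (0, \<alpha>)))"
    using assms by (intro pairing_dual double_ad_pow_dual) simp_all
  then show ?thesis
    unfolding k rho_Z_odd Z_sup_eq chain_eq_double_ad_pow[OF assms] by (simp only:)
qed

lemma rho_Z_swap:
  assumes "l \<in> dual" "\<alpha> \<in> dual" "\<beta> \<in> dual"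
  shows "rho_Z B Z k l [\<beta>, \<alpha>] = - rho_Z B Z k l [\<alpha>, \<beta>]"
proof (cases "even k")
  case True
  then show ?thesis by (simp add: rho_Z_even)
next
  case False
  have "pairing (double_ad_pow l k (0, \<beta>)) (0, \<alpha>) = - pairing (0, \<beta>) (double_ad_pow l k (0, \<alpha>))"
    using assms False by (simp add: pairing_double_ad_pow)
  also have "\<dots> = - pairing (double_ad_pow l k (0, \<alpha>)) (0, \<beta>)"
    by (simp add: pairing_def)
  finally show ?thesis using assms by (simp add: rho_Z_eq)
qed

lemma rho_Z_values:
  assumes "l \<in> dual" "\<alpha> \<in> dual" "\<beta> \<in> dual"
  shows "rho_Z B Z k l [\<alpha>, \<beta>] = coth_coeff k * \<beta> (fst (double_ad_pow l k (0, \<alpha>)))"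
    and "rho_Z B Z k l [\<alpha>, \<beta>] = - coth_coeff k * \<alpha> (fst (double_ad_pow l k (0, \<beta>)))"
  using rho_Z_swap[OF assms(1,3,2), of k] rho_Z_eq[OF assms, of k] rho_Z_eq[OF assms(1,3,2), of k]
    pairing_dual[OF double_ad_pow_dual[OF assms(1)], of "(0, \<alpha>)"] pairing_dual[OF double_ad_pow_dual[OF assms(1)], of "(0, \<beta>)"] assms
  by simp_all

lemma dir_deriv_rho_Z:
  assumes l: "l \<in> dual" and m: "m \<in> dual" and a: "\<alpha> \<in> dual" and b: "\<beta> \<in> dual"
  shows "dir_deriv (rho_Z B Z k) m l [\<alpha>, \<beta>]
    = coth_coeff k * (\<Sum>i<k. pairing (double_ad_pow l i (double_ad m (double_ad_pow l (k - Suc i) (0, \<alpha>)))) (0, \<beta>))"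
  unfolding dir_deriv_def
proof (rule DERIV_imp_deriv)
  have "rho_Z B Z k (\<lambda>v. l v + s * m v) [\<alpha>, \<beta>]
     = coth_coeff k * pairing (double_ad_pow (\<lambda>v. l v + s * m v) k (0, \<alpha>)) (0, \<beta>)" for s
    by (rule rho_Z_eq[OF dual_combination[OF l m] a b])
  then show "((\<lambda>s. rho_Z B Z k (\<lambda>v. l v + s * m v) [\<alpha>, \<beta>]) has_field_derivative
     coth_coeff k * (\<Sum>i<k. pairing (double_ad_pow l i (double_ad m (double_ad_pow l (k - Suc i) (0, \<alpha>)))) (0, \<beta>))) (at 0)"
    using a b by (simp only:) (intro DERIV_cmult double_ad_pow_derivative l m; simp)
qed

text \<open>
  Powers of \<open>A\<^sub>l\<close> on the left of \<open>A\<^sub>m\<close> are moved to the second argument of the pairing, which produces the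
  signs; the pairing with \<open>A\<^sub>m\<close> is the 3-form with first argument \<open>m\<close>.
\<close>

lemma dir_deriv_rho_Z_cubic:
  assumes l: "l \<in> dual" and m: "m \<in> dual" and a: "\<alpha> \<in> dual" and b: "\<beta> \<in> dual"
  shows "dir_deriv (rho_Z B Z (Suc N)) m l [\<alpha>, \<beta>]
    = coth_coeff (Suc N) * (\<Sum>i\<le>N. (- 1) ^ i * cubic (0, m) (double_ad_pow l (N - i) (0, \<alpha>)) (double_ad_pow l i (0, \<beta>)))"
proof -
  have "pairing (double_ad_pow l i (double_ad m (double_ad_pow l j (0, \<alpha>)))) (0, \<beta>)
      = (- 1) ^ i * cubic (0, m) (double_ad_pow l j (0, \<alpha>)) (double_ad_pow l i (0, \<beta>))" for i j
    using pairing_double_ad_pow[OF l double_ad_dual[OF m], of "(0, \<beta>)" i "double_ad_pow l j (0, \<alpha>)"]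
      pairing_double_ad_cubic[OF m double_ad_pow_dual[OF l] double_ad_pow_dual[OF l], of "(0, \<alpha>)" "(0, \<beta>)" j i] a b
    by simp
  then show ?thesis
    unfolding dir_deriv_rho_Z[OF assms] lessThan_Suc_atMost by simp
qed

text \<open>
  The multilinear form behind \<open>Z\<^sup>(\<^sup>n\<^sup>)\<close> is the chain, in which the copies of \<open>l\<close> stand between the other two
  arguments; a transposition moves the first of these behind them.
\<close>

lemma rho_Z_homogeneous: "\<exists>T\<in>tensors (k + 2). \<forall>l as. rho_Z B Z k l as = T (replicate k l @ as)"
proof (cases "even k")
  case True
  then show ?thesis using tensors_0[of "k + 2"] by (intro bexI[of _ "\<lambda>as. 0"]) (simp_all add: rho_Z_even)
next
  case False
  then obtain n where k: "k = 2 * n + 1" by (rule oddE)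
  define T where "T as = coth_coeff k * chain n (permute_list (Transposition.transpose 0 k) as)" for as
  have \<sigma>: "Transposition.transpose 0 k permutes {..<k + 2}" by (rule permutes_swap_id) auto
  have c: "chain n \<in> tensors (k + 2)" using chain_in_tensors[of n] by (simp add: k numeral_3_eq_3)
  have T: "T \<in> tensors (k + 2)"
    unfolding T_def by (intro tensors_scaled tensors_permute c \<sigma>)
  moreover have "rho_Z B Z k l as = T (replicate k l @ as)" for l as
  proof (cases "length as = 2")
    case True
    then obtain \<alpha> \<beta> where as: "as = [\<alpha>, \<beta>]" by (auto simp: length_Suc_conv numeral_2_eq_2)
    have "permute_list (Transposition.transpose 0 k) (replicate k l @ [\<alpha>, \<beta>]) = \<alpha> # replicate k l @ [\<beta>]"
    proof (rule nth_equalityI)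
      fix i assume "i < length (permute_list (Transposition.transpose 0 k) (replicate k l @ [\<alpha>, \<beta>]))"
      then have i: "i < k + 2" by simp
      then have p: "permute_list (Transposition.transpose 0 k) (replicate k l @ [\<alpha>, \<beta>]) ! i
          = (replicate k l @ [\<alpha>, \<beta>]) ! Transposition.transpose 0 k i"
        using \<sigma> by (intro permute_list_nth) (simp_all del: replicate.simps)
      consider "i = 0" | j where "i = Suc j" "i < k" | "i = k" | "i = Suc k" using i
        by (cases "i = 0"; cases "i < k"; cases "i = k") (auto simp: gr0_conv_Suc)
      then show "permute_list (Transposition.transpose 0 k) (replicate k l @ [\<alpha>, \<beta>]) ! i = (\<alpha> # replicate k l @ [\<beta>]) ! i"
        unfolding p by cases (auto simp: transpose_def nth_append nth_Cons' k simp del: replicate.simps)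
    qed simp
    then show ?thesis
      unfolding as T_def k rho_Z_odd Z_sup_eq by simp
  next
    case False
    then have "Z_sup B Z (Suc n) l as = 0"
      by (auto simp: Z_sup_def numeral_2_eq_2 split: list.splits)
    moreover have "T (replicate k l @ as) = 0" using False by (intro tensors_outside[OF T]) auto
    ultimately show ?thesis unfolding k rho_Z_odd by simp
  qed
  ultimately show ?thesis by auto
qed

lemma rho_Z_tensor: "l \<in> dual \<Longrightarrow> rho_Z B Z k l \<in> tensors 2"
proof -
  assume l: "l \<in> dual"
  obtain T where T: "T \<in> tensors (k + 2)" "\<And>l as. rho_Z B Z k l as = T (replicate k l @ as)"
    using rho_Z_homogeneous by blast
  have "rho_Z B Z k l = (\<lambda>as. T (replicate k l @ as))" using T(2) by auto
  then show ?thesis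
    using tensors_fix_prefix[of T "replicate k l" 2] T(1) l by (auto simp: set_replicate_conv_if)
qed

lemma rho_Z_wedge:
  assumes l: "l \<in> dual"
  shows "rho_Z B Z k l \<in> wedge 2"
  unfolding wedge_def
proof (intro CollectI conjI allI impI; (elim conjE)?)
  show "rho_Z B Z k l \<in> tensors 2" by (rule rho_Z_tensor[OF l])
  fix \<sigma> :: "nat \<Rightarrow> nat" and as :: "('g \<Rightarrow> complex) list" assume \<sigma>: "\<sigma> permutes {..<2}" and "length as = 2"
  then obtain \<alpha> \<beta> where as: "as = [\<alpha>, \<beta>]" by (auto simp: length_Suc_conv numeral_2_eq_2)
  have two: "{..<2::nat} = {0, 1}" by auto
  have out: "rho_Z B Z k l bs = 0" if "\<not> set bs \<subseteq> dual" for bs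
    using that by (intro tensors_outside[OF rho_Z_tensor[OF l]]) auto
  have sw: "rho_Z B Z k l [\<beta>, \<alpha>] = - rho_Z B Z k l [\<alpha>, \<beta>]"
    using rho_Z_swap[OF l, of \<alpha> \<beta>] out by (cases "\<alpha> \<in> dual \<and> \<beta> \<in> dual") auto
  have "\<sigma> = id \<or> \<sigma> = Transposition.transpose 0 1"
    using \<sigma> unfolding two permutes_doubleton_iff by blast
  then show "rho_Z B Z k l (permute_list \<sigma> as) = of_int (sign \<sigma>) * rho_Z B Z k l as"
  proof
    assume "\<sigma> = id"
    then show ?thesis by (simp add: sign_id)
  next
    assume s: "\<sigma> = Transposition.transpose 0 1"
    have "permute_list \<sigma> as = [\<beta>, \<alpha>]"
      by (simp add: as s permute_list_def upt_rec transpose_def)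
    then show ?thesis using sw by (simp add: as s sign_swap_id)
  qed
qed

lemma rho_Z_formal_map: "rho_Z B Z \<in> formal_maps"
  unfolding formal_maps_def using rho_Z_wedge rho_Z_homogeneous by blast

text \<open>
  The adjoint and coadjoint actions of \<open>-x\<close>; with this sign the component in \<open>\<gg>\<^sup>*\<close> is \<open>\<alpha> \<mapsto> \<alpha> \<circ> ad x\<close>, as in
  the direction of the derivative that expresses invariance.
\<close>

definition double_act :: "'g \<Rightarrow> 'g \<times> ('g \<Rightarrow> complex) \<Rightarrow> 'g \<times> ('g \<Rightarrow> complex)" where
  "double_act x u = (- lie x (fst u), \<lambda>v. snd u (lie x v))"

lemma double_act_dual: "snd u \<in> dual \<Longrightarrow> snd (double_act x u) \<in> dual"
  by (simp add: double_act_def dual_lie)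

lemma pairing_double_act:
  assumes "snd u \<in> dual" "snd w \<in> dual"
  shows "pairing (double_act x u) w = - pairing u (double_act x w)"
  using assms by (simp add: pairing_def double_act_def dual_minus)

text \<open>
  Equivariance of \<open>l \<mapsto> A\<^sub>l\<close>: for \<open>l \<circ> ad x\<close> the operator is the commutator of \<open>double_act x\<close> with \<open>A\<^sub>l\<close>.
\<close>

lemma pairing_double_ad_act:
  assumes l: "l \<in> dual" and d: "snd u \<in> dual" "snd w \<in> dual"
  shows "pairing (double_ad (\<lambda>v. l (lie x v)) u) w
    = pairing (double_act x (double_ad l u)) w + pairing (double_act x u) (double_ad l w)"
proof -
  obtain y \<alpha> z \<gamma> where e: "u = (y, \<alpha>)" "w = (z, \<gamma>)" by (metis surj_pair)
  have d: "\<alpha> \<in> dual" "\<gamma> \<in> dual" using d by (simp_all add: e)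
  have 1: "\<gamma> (zsharp \<alpha> (\<lambda>v. l (lie x v))) = Z [\<alpha>, \<lambda>v. l (lie x v), \<gamma>]"
    by (rule dual_zsharp) (simp_all add: d l dual_lie)
  have 2: "Z [\<alpha>, \<lambda>v. l (lie x v), \<gamma>] = \<alpha> (lie x (zsharp \<gamma> l)) - \<gamma> (lie x (zsharp \<alpha> l))"
    unfolding Z_swap01[of \<alpha> "\<lambda>v. l (lie x v)"] using zsharp_invariance[OF l d, of x] by simp
  have 3: "l (lie x (lie y z)) = l (lie y (lie x z)) - l (lie z (lie x y))"
  proof -
    have "lie x (lie y z) = lie (lie x y) z + lie y (lie x z)" by (simp add: lie_lie)
    also have "lie (lie x y) z = - lie z (lie x y)" by (rule lie_swap)
    finally show ?thesis by (simp add: dual_diff[OF l])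
  qed
  show ?thesis
    by (simp add: e pairing_def double_ad_def double_act_def 1 2 3 dual_minus d l lie_minus_right)
qed

text \<open>
  By equivariance the Leibniz sum for the derivative of \<open>A\<^sub>l\<^sup>k\<close> in the direction \<open>l \<circ> ad x\<close> telescopes to
  the commutator of \<open>double_act x\<close> with \<open>A\<^sub>l\<^sup>k\<close>.
\<close>

lemma rho_Z_invariant: "invariant_formal_map (rho_Z B Z)"
  unfolding invariant_formal_map_def
proof (intro allI ballI impI; elim conjE)
  fix k x and l :: "'g \<Rightarrow> complex" and as :: "('g \<Rightarrow> complex) list" assume l: "l \<in> dual" and "length as = 2" and "set as \<subseteq> dual"
  then obtain \<alpha> \<beta> where as: "as = [\<alpha>, \<beta>]" and d: "\<alpha> \<in> dual" "\<beta> \<in> dual"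
    by (auto simp: length_Suc_conv numeral_2_eq_2)
  have a: "snd (double_ad_pow l n (0, \<alpha>)) \<in> dual" and b: "snd (double_ad_pow l n (0, \<beta>)) \<in> dual" for n
    using l d by (simp_all add: double_ad_pow_dual)
  define f where "f i = (- 1) ^ i * pairing (double_act x (double_ad_pow l (k - i) (0, \<alpha>))) (double_ad_pow l i (0, \<beta>))" for i
  have "(\<Sum>i<k. pairing (double_ad_pow l i (double_ad (\<lambda>v. l (lie x v)) (double_ad_pow l (k - Suc i) (0, \<alpha>)))) (0, \<beta>))
      = (\<Sum>i<k. f i - f (Suc i))"
  proof (rule sum.cong[OF refl])
    fix i assume "i \<in> {..<k}"
    then have k: "k - i = Suc (k - Suc i)" by auto
    have "pairing (double_ad_pow l i (double_ad (\<lambda>v. l (lie x v)) (double_ad_pow l (k - Suc i) (0, \<alpha>)))) (0, \<beta>)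
      = (- 1) ^ i * pairing (double_ad (\<lambda>v. l (lie x v)) (double_ad_pow l (k - Suc i) (0, \<alpha>))) (double_ad_pow l i (0, \<beta>))"
      using l d by (intro pairing_double_ad_pow) (simp_all add: double_ad_dual dual_lie)
    also have "\<dots> = f i - f (Suc i)"
      unfolding pairing_double_ad_act[OF l a b] f_def k by (simp add: algebra_simps)
    finally show "pairing (double_ad_pow l i (double_ad (\<lambda>v. l (lie x v)) (double_ad_pow l (k - Suc i) (0, \<alpha>)))) (0, \<beta>)
      = f i - f (Suc i)" .
  qed
  also have "\<dots> = f 0 - f k"
    by (induction k) simp_all
  also have "f 0 = - pairing (double_ad_pow l k (0, \<alpha>)) (double_act x (0, \<beta>))"
    using a d by (simp add: f_def pairing_double_act)
  also have "f k = pairing (double_ad_pow l k (double_act x (0, \<alpha>))) (0, \<beta>)"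
    using l d by (simp add: f_def pairing_double_ad_pow double_act_dual)
  finally have D: "dir_deriv (rho_Z B Z k) (\<lambda>v. l (lie x v)) l [\<alpha>, \<beta>]
     = coth_coeff k * (- pairing (double_ad_pow l k (0, \<alpha>)) (double_act x (0, \<beta>)) - pairing (double_ad_pow l k (double_act x (0, \<alpha>))) (0, \<beta>))"
    using l d by (simp add: dir_deriv_rho_Z dual_lie)
  have act0: "double_act x (0, \<gamma>) = (0, \<lambda>v. \<gamma> (lie x v))" for \<gamma> by (simp add: double_act_def)
  have "tensor_act x (rho_Z B Z k l) [\<alpha>, \<beta>]
     = rho_Z B Z k l [\<lambda>v. \<alpha> (lie x v), \<beta>] + rho_Z B Z k l [\<alpha>, \<lambda>v. \<beta> (lie x v)]"
    by (simp add: tensor_act_def lessThan_Suc)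
  also have "\<dots> = coth_coeff k * (pairing (double_ad_pow l k (double_act x (0, \<alpha>))) (0, \<beta>) + pairing (double_ad_pow l k (0, \<alpha>)) (double_act x (0, \<beta>)))"
    using l d by (simp add: rho_Z_eq dual_lie act0 algebra_simps)
  finally show "dir_deriv (rho_Z B Z k) (\<lambda>v. l (lie x v)) l as + tensor_act x (rho_Z B Z k l) as = 0"
    unfolding as D by (simp add: algebra_simps)
qed

section \<open>The dynamical Yang-Baxter equation\<close>

lemma Alt_d_rho_Z:
  assumes l: "l \<in> dual"
  shows "Alt_d B (rho_Z B Z) N l = place B [1, 2, 3] (\<lambda>as.
      dir_deriv (rho_Z B Z (Suc N)) (as ! 0) l [as ! 1, as ! 2]
    - dir_deriv (rho_Z B Z (Suc N)) (as ! 1) l [as ! 0, as ! 2]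
    + dir_deriv (rho_Z B Z (Suc N)) (as ! 2) l [as ! 0, as ! 1])"
proof -
  let ?D = "\<lambda>h. dir_deriv (rho_Z B Z (Suc N)) (coord B h) l"
  have "(\<Sum>h\<in>B. gen 1 h * place B [2, 3] (?D h))
      = place B [1, 2, 3] (\<lambda>as. dir_deriv (rho_Z B Z (Suc N)) (as ! 0) l [as ! 1, as ! 2])"
    by (rule sum_gen_place) auto
  moreover have "(\<Sum>h\<in>B. gen 2 h * place B [1, 3] (?D h))
      = place B [1, 2, 3] (\<lambda>as. dir_deriv (rho_Z B Z (Suc N)) (as ! 1) l [as ! 0, as ! 2])"
    by (rule sum_gen_place) auto
  moreover have "(\<Sum>h\<in>B. gen 3 h * place B [1, 2] (?D h))
      = place B [1, 2, 3] (\<lambda>as. dir_deriv (rho_Z B Z (Suc N)) (as ! 2) l [as ! 0, as ! 1])"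
    by (rule sum_gen_place) auto
  ultimately show ?thesis
    by (simp only: Alt_d_def place_add place_diff Suc_eq_plus1)
qed

text \<open>
  Where the shared factor is the first slot of \<open>\<rho>\<close>, skew-symmetry moves it to the second, at the cost of a sign;
  this happens twice, once and not at all in the three commutators.
\<close>

lemma CYB_summand:
  fixes i j :: nat
  assumes l: "l \<in> dual"
  defines "P \<equiv> \<lambda>n \<alpha>. double_ad_pow l n (0, \<alpha>)"
  shows "upow_eq 3
    (comm (place B [1, 2] (rho_Z B Z i l)) (place B [1, 3] (rho_Z B Z j l))
   + comm (place B [1, 2] (rho_Z B Z i l)) (place B [2, 3] (rho_Z B Z j l))
   + comm (place B [1, 3] (rho_Z B Z i l)) (place B [2, 3] (rho_Z B Z j l)))
   (place B [1, 2, 3] (\<lambda>as. coth_coeff i * coth_coeff j *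
     ((as ! 0) (lie (fst (P i (as ! 1))) (fst (P j (as ! 2))))
    - (as ! 1) (lie (fst (P i (as ! 0))) (fst (P j (as ! 2))))
    + (as ! 2) (lie (fst (P i (as ! 0))) (fst (P j (as ! 1)))))))"
proof -
  let ?c = "coth_coeff i * coth_coeff j"
  have X: "rho_Z B Z n l [coord B b, coord B x] = coth_coeff n * coord B x (fst (P n (coord B b)))"
    and Y: "rho_Z B Z n l [coord B x, coord B b] = - coth_coeff n * coord B x (fst (P n (coord B b)))" for n b x
    using rho_Z_values[OF l coord_in_dual coord_in_dual] by (simp_all add: P_def)
  note contract = lie_contraction_scaled[OF coord_in_dual]
  have 1: "upow_eq 3 (comm (place B [1, 2] (rho_Z B Z i l)) (place B [1, 3] (rho_Z B Z j l)))
    (place B [1, 2, 3] (\<lambda>as. ?c * (as ! 0) (lie (fst (P i (as ! 1))) (fst (P j (as ! 2))))))"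
  proof (rule comm_place[where j = 1])
    fix K :: "nat \<Rightarrow> 'g"
    show "?c * (map (\<lambda>i. coord B (K i)) [1, 2, 3] ! 0)
        (lie (fst (P i (map (\<lambda>i. coord B (K i)) [1, 2, 3] ! 1))) (fst (P j (map (\<lambda>i. coord B (K i)) [1, 2, 3] ! 2))))
      = (\<Sum>x\<in>B. \<Sum>y\<in>B. coord B (K 1) (lie x y) * rho_Z B Z i l (map (\<lambda>i. coord B ((K(1 := x)) i)) [1, 2])
           * rho_Z B Z j l (map (\<lambda>i. coord B ((K(1 := y)) i)) [1, 3]))"
      using contract[of "K 1" "- coth_coeff i" "fst (P i (coord B (K 2)))" "- coth_coeff j" "fst (P j (coord B (K 3)))"]
      by (simp add: Y[of _ _ "K 2"] Y[of _ _ "K 3"])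
  qed auto
  have 2: "upow_eq 3 (comm (place B [1, 2] (rho_Z B Z i l)) (place B [2, 3] (rho_Z B Z j l)))
    (place B [1, 2, 3] (\<lambda>as. - ?c * (as ! 1) (lie (fst (P i (as ! 0))) (fst (P j (as ! 2))))))"
  proof (rule comm_place[where j = 2])
    fix K :: "nat \<Rightarrow> 'g"
    show "- ?c * (map (\<lambda>i. coord B (K i)) [1, 2, 3] ! 1)
        (lie (fst (P i (map (\<lambda>i. coord B (K i)) [1, 2, 3] ! 0))) (fst (P j (map (\<lambda>i. coord B (K i)) [1, 2, 3] ! 2))))
      = (\<Sum>x\<in>B. \<Sum>y\<in>B. coord B (K 2) (lie x y) * rho_Z B Z i l (map (\<lambda>i. coord B ((K(2 := x)) i)) [1, 2])
           * rho_Z B Z j l (map (\<lambda>i. coord B ((K(2 := y)) i)) [2, 3]))"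
      using contract[of "K 2" "coth_coeff i" "fst (P i (coord B (K 1)))" "- coth_coeff j" "fst (P j (coord B (K 3)))"]
      by (simp add: X[of _ "K (Suc 0)"] Y[of _ _ "K 3"])
  qed auto
  have 3: "upow_eq 3 (comm (place B [1, 3] (rho_Z B Z i l)) (place B [2, 3] (rho_Z B Z j l)))
    (place B [1, 2, 3] (\<lambda>as. ?c * (as ! 2) (lie (fst (P i (as ! 0))) (fst (P j (as ! 1))))))"
  proof (rule comm_place[where j = 3])
    fix K :: "nat \<Rightarrow> 'g"
    show "?c * (map (\<lambda>i. coord B (K i)) [1, 2, 3] ! 2)
        (lie (fst (P i (map (\<lambda>i. coord B (K i)) [1, 2, 3] ! 0))) (fst (P j (map (\<lambda>i. coord B (K i)) [1, 2, 3] ! 1))))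
      = (\<Sum>x\<in>B. \<Sum>y\<in>B. coord B (K 3) (lie x y) * rho_Z B Z i l (map (\<lambda>i. coord B ((K(3 := x)) i)) [1, 3])
           * rho_Z B Z j l (map (\<lambda>i. coord B ((K(3 := y)) i)) [2, 3]))"
      using contract[of "K 3" "coth_coeff i" "fst (P i (coord B (K 1)))" "coth_coeff j" "fst (P j (coord B (K 2)))"]
      by (simp add: X[of _ "K (Suc 0)"] X[of _ "K 2"])
  qed auto
  show ?thesis
    using upow_eq_add[OF upow_eq_add[OF 1 2] 3]
    unfolding place_add[symmetric] by (simp add: algebra_simps)
qed

text \<open>
  For odd \<open>i\<close>, \<open>j\<close> the powers applied to \<open>\<gg>\<^sup>*\<close> have values in \<open>\<gg>\<close>, so the 3-form reduces to a bracket in \<open>\<gg>\<close>;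
  otherwise the coefficients vanish.
\<close>

lemma cubic_sum_odd:
  assumes l: "l \<in> dual" and d: "\<alpha> \<in> dual" "\<beta> \<in> dual" "\<gamma> \<in> dual"
  defines "P \<equiv> \<lambda>n \<alpha>. double_ad_pow l n (0, \<alpha>)"
  shows "coth_coeff i * coth_coeff j * (\<alpha> (lie (fst (P i \<beta>)) (fst (P j \<gamma>)))
      - \<beta> (lie (fst (P i \<alpha>)) (fst (P j \<gamma>))) + \<gamma> (lie (fst (P i \<alpha>)) (fst (P j \<beta>))))
    = coth_coeff i * coth_coeff j *
      (cubic (P i \<alpha>) (P j \<beta>) (P 0 \<gamma>) + cubic (P 0 \<alpha>) (P i \<beta>) (P j \<gamma>) + cubic (P i \<alpha>) (P 0 \<beta>) (P j \<gamma>))"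
proof (cases "even i \<or> even j")
  case True
  then show ?thesis by (auto simp: coth_coeff_even)
next
  case False
  then have z: "snd (P n \<delta>) = (\<lambda>v. 0)" if "n = i \<or> n = j" "\<delta> \<in> dual" for n \<delta>
    using that l unfolding P_def by (auto intro!: double_ad_pow_odd_snd)
  have "\<beta> (lie (fst (P i \<alpha>)) (fst (P j \<gamma>))) = - \<beta> (lie (fst (P j \<gamma>)) (fst (P i \<alpha>)))"
    using d lie_swap[of "fst (P i \<alpha>)"] by (metis dual_minus)
  then show ?thesis
    using z d by (simp add: cubic_def Z_zero0 Z_zero1 zero_in_dual P_def)
qed

text \<open>
  On coordinates \<open>\<alpha>, \<beta>, \<gamma>\<close> both sides are the two sides of \<open>trilinear_coth_identity\<close> for
  \<open>g i j k = T(A\<^sub>l\<^sup>i \<alpha>, A\<^sub>l\<^sup>j \<beta>, A\<^sub>l\<^sup>k \<gamma>)\<close>.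
\<close>

lemma rho_Z_mCDYBE: "satisfies_mCDYBE B Z (rho_Z B Z)"
  unfolding satisfies_mCDYBE_def
proof (intro allI ballI)
  fix N and l :: "'g \<Rightarrow> complex" assume l: "l \<in> dual"
  define P where "P n \<alpha> = double_ad_pow l n (0, \<alpha>)" for n \<alpha>
  let ?D = "\<lambda>as. dir_deriv (rho_Z B Z (Suc N)) (as ! 0) l [as ! 1, as ! 2]
    - dir_deriv (rho_Z B Z (Suc N)) (as ! 1) l [as ! 0, as ! 2]
    + dir_deriv (rho_Z B Z (Suc N)) (as ! 2) l [as ! 0, as ! 1]"
  let ?C = "\<lambda>as. \<Sum>i\<le>N. coth_coeff i * coth_coeff (N - i) *
     ((as ! 0) (lie (fst (P i (as ! 1))) (fst (P (N - i) (as ! 2))))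
    - (as ! 1) (lie (fst (P i (as ! 0))) (fst (P (N - i) (as ! 2))))
    + (as ! 2) (lie (fst (P i (as ! 0))) (fst (P (N - i) (as ! 1)))))"
  have "upow_eq 3 (CYB B (rho_Z B Z) N l) (place B [1, 2, 3] ?C)"
    unfolding CYB_def place_sum P_def by (intro upow_eq_sum CYB_summand l)
  then have "upow_eq 3 (- Alt_d B (rho_Z B Z) N l + CYB B (rho_Z B Z) N l)
      (place B [1, 2, 3] (\<lambda>as. - ?D as + ?C as))"
    unfolding place_add place_minus Alt_d_rho_Z[OF l] by (intro upow_eq_add upow_eq_refl)
  also have "place B [1, 2, 3] (\<lambda>as. - ?D as + ?C as) = place B [1, 2, 3] (\<lambda>as. if N = 0 then Z as else 0)"
  proof (rule place_cong)
    fix K :: "nat \<Rightarrow> 'g"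
    define \<alpha> \<beta> \<gamma> where abc: "\<alpha> = coord B (K 1)" "\<beta> = coord B (K 2)" "\<gamma> = coord B (K 3)"
    have d: "\<alpha> \<in> dual" "\<beta> \<in> dual" "\<gamma> \<in> dual" by (simp_all add: abc)
    define g where "g i j k = cubic (P i \<alpha>) (P j \<beta>) (P k \<gamma>)" for i j k
    have Pd: "snd (P n \<delta>) \<in> dual" if "\<delta> \<in> dual" for n \<delta>
      using that l by (simp add: P_def double_ad_pow_dual)
    have P0: "P 0 \<delta> = (0, \<delta>)" for \<delta> by (simp add: P_def)
    have PS: "P (Suc n) \<delta> = double_ad l (P n \<delta>)" for n \<delta> by (simp add: P_def)
    have rec: "g (Suc i) j k + g i (Suc j) k + g i j (Suc k) = 0" for i j k
      unfolding g_def PS by (intro cubic_invariant l Pd d)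
    have D1: "dir_deriv (rho_Z B Z (Suc N)) \<alpha> l [\<beta>, \<gamma>] = coth_coeff (Suc N) * (\<Sum>i\<le>N. (- 1) ^ i * g 0 (N - i) i)"
      unfolding dir_deriv_rho_Z_cubic[OF l d(1,2,3)] g_def P_def by simp
    have D2: "dir_deriv (rho_Z B Z (Suc N)) \<beta> l [\<alpha>, \<gamma>] = - coth_coeff (Suc N) * (\<Sum>i\<le>N. (- 1) ^ i * g (N - i) 0 i)"
    proof -
      have "cubic (0, \<beta>) (P j \<alpha>) (P i \<gamma>) = - g j 0 i" for i j
        unfolding g_def P0 by (rule cubic_swap) (simp_all add: Pd d)
      then show ?thesis
        unfolding dir_deriv_rho_Z_cubic[OF l d(2,1,3)] P_def[symmetric] by (simp add: sum_negf)
    qed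
    have D3: "dir_deriv (rho_Z B Z (Suc N)) \<gamma> l [\<alpha>, \<beta>] = coth_coeff (Suc N) * (\<Sum>i\<le>N. (- 1) ^ i * g (N - i) i 0)"
    proof -
      have "cubic (0, \<gamma>) (P j \<alpha>) (P i \<beta>) = g j i 0" for i j
        unfolding g_def P0 by (rule cubic_cyclic[symmetric])
      then show ?thesis
        unfolding dir_deriv_rho_Z_cubic[OF l d(3,1,2)] P_def[symmetric] by simp
    qed
    have C: "?C [\<alpha>, \<beta>, \<gamma>] = (\<Sum>i\<le>N. coth_coeff i * coth_coeff (N - i) * (g i (N - i) 0 + g 0 i (N - i) + g i 0 (N - i)))"
    proof -
      have "?C [\<alpha>, \<beta>, \<gamma>] = (\<Sum>i\<le>N. coth_coeff i * coth_coeff (N - i) * (\<alpha> (lie (fst (P i \<beta>)) (fst (P (N - i) \<gamma>)))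
          - \<beta> (lie (fst (P i \<alpha>)) (fst (P (N - i) \<gamma>))) + \<gamma> (lie (fst (P i \<alpha>)) (fst (P (N - i) \<beta>)))))"
        by (simp add: numeral_2_eq_2)
      also have "\<dots> = (\<Sum>i\<le>N. coth_coeff i * coth_coeff (N - i) * (g i (N - i) 0 + g 0 i (N - i) + g i 0 (N - i)))"
        unfolding g_def P_def by (intro sum.cong refl cubic_sum_odd l d)
      finally show ?thesis .
    qed
    have "- ?D [\<alpha>, \<beta>, \<gamma>] + ?C [\<alpha>, \<beta>, \<gamma>] = (if N = 0 then - g 0 0 0 else 0)"
      using trilinear_coth_identity[of g N, OF rec] unfolding C
      by (simp add: D1 D2 D3 algebra_simps sum.distrib numeral_2_eq_2)
    also have "g 0 0 0 = - Z [\<alpha>, \<beta>, \<gamma>]"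
      using d by (simp add: g_def P0 cubic_def dual_zero)
    finally show "- ?D (map (\<lambda>i. coord B (K i)) [1, 2, 3]) + ?C (map (\<lambda>i. coord B (K i)) [1, 2, 3])
      = (if N = 0 then Z (map (\<lambda>i. coord B (K i)) [1, 2, 3]) else 0)"
      unfolding list.map abc by (simp only: minus_minus)
  qed simp
  also have "\<dots> = (if N = 0 then place B [1, 2, 3] Z else 0)"
    by (simp add: place_zero)
  finally show "upow_eq 3 (- Alt_d B (rho_Z B Z) N l + CYB B (rho_Z B Z) N l)
     (if N = 0 then place B [1, 2, 3] Z else 0)" .
qed

end

section \<open>Comparison with $\rho_{\mathrm{AM}}$\<close>

locale lie_casimir = lie_3form B Z for B :: "'g::complex_lie_algebra set" and Z +
  fixes t :: "'g tensor"
  assumes t_sym: "t \<in> sym_tensors 2" and t_inv: "invariant_tensor 2 t"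
    and Z_t: "upow_eq 3 (place B [1, 2, 3] Z)
              (scalar (1 / 4) * comm (place B [1, 2] t) (place B [2, 3] t))"
begin

lemma t_tensor: "t \<in> tensors 2"
  using t_sym by (simp add: sym_tensors_def)

lemma t_swap: "t [\<beta>, \<alpha>] = t [\<alpha>, \<beta>]"
proof -
  have "Transposition.transpose 0 1 permutes {..<2::nat}" by (rule permutes_swap_id) auto
  moreover have "permute_list (Transposition.transpose 0 1) [\<alpha>, \<beta>] = [\<beta>, \<alpha>]"
    by (simp add: permute_list_def upt_rec transpose_def)
  ultimately show ?thesis
    using t_sym by (auto simp: sym_tensors_def dest!: spec[of _ "Transposition.transpose 0 (1::nat)"] dest: spec[of _ "[\<alpha>, \<beta>]"])
qed

abbreviation tsharp :: "('g \<Rightarrow> complex) \<Rightarrow> 'g" where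
  "tsharp \<alpha> \<equiv> t_check B t \<alpha>"

lemma dual_tsharp: "\<alpha> \<in> dual \<Longrightarrow> \<beta> \<in> dual \<Longrightarrow> \<beta> (tsharp \<alpha>) = t [\<alpha>, \<beta>]"
  using dual_raise[of t "[\<alpha>]" \<beta>] t_tensor by (simp add: numeral_2_eq_2 raise_def t_check_def)

lemma tsharp_symmetric: "\<alpha> \<in> dual \<Longrightarrow> \<beta> \<in> dual \<Longrightarrow> \<beta> (tsharp \<alpha>) = \<alpha> (tsharp \<beta>)"
  by (simp add: dual_tsharp t_swap)

lemma tsharp_lie:
  assumes a: "\<alpha> \<in> dual"
  shows "tsharp (\<lambda>v. \<alpha> (lie x v)) = - lie x (tsharp \<alpha>)"
proof (rule eq_if_dual_eq)
  fix \<gamma> :: "'g \<Rightarrow> complex" assume c: "\<gamma> \<in> dual"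
  have "t [\<lambda>v. \<alpha> (lie x v), \<gamma>] + t [\<alpha>, \<lambda>v. \<gamma> (lie x v)] = 0"
    using t_inv[unfolded invariant_tensor_def, rule_format, of "[\<alpha>, \<gamma>]" x] a c
    by (simp add: tensor_act_def numeral_2_eq_2 lessThan_Suc ac_simps)
  then show "\<gamma> (tsharp (\<lambda>v. \<alpha> (lie x v))) = \<gamma> (- lie x (tsharp \<alpha>))"
    using dual_tsharp[OF dual_lie[OF a] c] dual_tsharp[OF a dual_lie[OF c]]
    by (simp add: dual_minus[OF c] eq_neg_iff_add_eq_0)
qed

lemma tsharp_add: "\<alpha> \<in> dual \<Longrightarrow> \<beta> \<in> dual \<Longrightarrow> tsharp (\<lambda>v. \<alpha> v + \<beta> v) = tsharp \<alpha> + tsharp \<beta>"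
  by (rule eq_if_dual_eq) (simp add: dual_plus tsharp_symmetric dual_add_closed)

lemma tsharp_scale: "\<alpha> \<in> dual \<Longrightarrow> tsharp (\<lambda>v. c * \<alpha> v) = c *\<^sub>C tsharp \<alpha>"
  by (rule eq_if_dual_eq) (simp add: dual_scaleC tsharp_symmetric dual_scale_closed)

definition t_commutator :: "'g tensor" where
  "t_commutator = (\<lambda>as. if length as = 3 \<and> set as \<subseteq> dual
     then (as ! 1) (lie (tsharp (as ! 0)) (tsharp (as ! 2))) else 0)"

lemma t_commutator_eq: "\<alpha> \<in> dual \<Longrightarrow> \<beta> \<in> dual \<Longrightarrow> \<gamma> \<in> dual \<Longrightarrow>
    t_commutator [\<alpha>, \<beta>, \<gamma>] = \<beta> (lie (tsharp \<alpha>) (tsharp \<gamma>))"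
  by (simp add: t_commutator_def numeral_2_eq_2)

lemma t_commutator_tensor: "t_commutator \<in> tensors 3"
proof (rule tensorsI)
  fix as :: "('g \<Rightarrow> complex) list" assume "\<not> (length as = 3 \<and> set as \<subseteq> dual)"
  then show "t_commutator as = 0" by (auto simp: t_commutator_def)
next
  fix as :: "('g \<Rightarrow> complex) list" and i :: nat and \<phi> \<psi> :: "'g \<Rightarrow> complex"
  assume as: "length as = 3" "set as \<subseteq> dual" and i: "i < 3" and d: "\<phi> \<in> dual" "\<psi> \<in> dual"
  then obtain \<alpha> \<beta> \<gamma> where "as = [\<alpha>, \<beta>, \<gamma>]" "\<alpha> \<in> dual" "\<beta> \<in> dual" "\<gamma> \<in> dual"
    by (auto simp: length_Suc_conv numeral_3_eq_3)
  moreover have "i = 0 \<or> i = 1 \<or> i = 2" using i by auto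
  ultimately show "t_commutator (as[i := \<lambda>v. \<phi> v + \<psi> v]) = t_commutator (as[i := \<phi>]) + t_commutator (as[i := \<psi>])"
    using d by (auto simp: numeral_2_eq_2 t_commutator_eq dual_add_closed tsharp_add lie_add_left lie_add_right dual_plus)
next
  fix as :: "('g \<Rightarrow> complex) list" and i :: nat and \<phi> :: "'g \<Rightarrow> complex" and c
  assume as: "length as = 3" "set as \<subseteq> dual" and i: "i < 3" and d: "\<phi> \<in> dual"
  then obtain \<alpha> \<beta> \<gamma> where "as = [\<alpha>, \<beta>, \<gamma>]" "\<alpha> \<in> dual" "\<beta> \<in> dual" "\<gamma> \<in> dual"
    by (auto simp: length_Suc_conv numeral_3_eq_3)
  moreover have "i = 0 \<or> i = 1 \<or> i = 2" using i by auto
  ultimately show "t_commutator (as[i := \<lambda>v. c * \<phi> v]) = c * t_commutator (as[i := \<phi>])"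
    using d by (auto simp: numeral_2_eq_2 t_commutator_eq dual_scale_closed tsharp_scale
        lie_scaleC_left lie_scaleC_right dual_scaleC)
qed

text \<open>
  The hypothesis compares representatives in \<open>U(\<gg>)\<^sup>\<otimes>\<^sup>3\<close>; injectivity turns it into an equality of tensors.
\<close>

lemma Z_eq_t_commutator: "Z = (\<lambda>as. (1 / 4) * t_commutator as)"
proof (rule tensor_unique[OF Z_tensor tensors_scaled[OF t_commutator_tensor]])
  have "upow_eq 3 (comm (place B [1, 2] t) (place B [2, 3] t)) (place B [1, 2, 3] t_commutator)"
  proof (rule comm_place[where j = 2])
    fix K :: "nat \<Rightarrow> 'g"
    have X: "t [coord B b, coord B x] = coord B x (tsharp (coord B b))"
      and Y: "t [coord B x, coord B b] = coord B x (tsharp (coord B b))" for b x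
      using dual_tsharp[of "coord B b" "coord B x"] t_swap[of "coord B x" "coord B b"] by simp_all
    show "t_commutator (map (\<lambda>i. coord B (K i)) [1, 2, 3]) =
       (\<Sum>x\<in>B. \<Sum>y\<in>B. coord B (K 2) (lie x y) * t (map (\<lambda>i. coord B ((K(2 := x)) i)) [1, 2])
           * t (map (\<lambda>i. coord B ((K(2 := y)) i)) [2, 3]))"
      using lie_contraction[of "coord B (K 2)" "tsharp (coord B (K 1))" "tsharp (coord B (K 3))"]
      by (simp add: t_commutator_eq X[of "K (Suc 0)"] Y[of _ "K 3"])
  qed auto
  then have "upow_eq 3 (place B [1, 2, 3] Z) (place B [1, 2, 3] (\<lambda>as. (1 / 4) * t_commutator as))"
    unfolding place_scale by (rule upow_eq_trans[OF Z_t upow_eq_scalar])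
  moreover have "[1..<3 + 1] = [1, 2, 3::nat]" by (simp add: upt_conv_Cons)
  ultimately show "upow_eq 3 (place B [1..<3 + 1] Z) (place B [1..<3 + 1] (\<lambda>as. (1 / 4) * t_commutator as))"
    by (simp only:)
qed

text \<open>
  Symmetry and invariance of \<open>t\<close> turn the contraction of \<open>Z\<close> into a bracket of images under \<open>t\<close>.
\<close>

lemma zsharp_t:
  assumes a: "\<alpha> \<in> dual" and l: "l \<in> dual"
  shows "zsharp \<alpha> l = (1 / 4) *\<^sub>C lie (tsharp l) (tsharp \<alpha>)"
proof (rule eq_if_dual_eq)
  fix \<gamma> :: "'g \<Rightarrow> complex" assume c: "\<gamma> \<in> dual"
  have "\<gamma> (zsharp \<alpha> l) = 1 / 4 * l (lie (tsharp \<alpha>) (tsharp \<gamma>))"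
    unfolding dual_zsharp[OF a l c] by (subst Z_eq_t_commutator) (simp add: t_commutator_eq a l c)
  also have "l (lie (tsharp \<alpha>) (tsharp \<gamma>)) = \<gamma> (tsharp (\<lambda>v. l (lie (tsharp \<alpha>) v)))"
    using tsharp_symmetric[OF dual_lie[OF l] c] by simp
  also have "\<dots> = \<gamma> (lie (tsharp l) (tsharp \<alpha>))"
    by (simp add: tsharp_lie[OF l] lie_swap[of "tsharp \<alpha>" "tsharp l"])
  finally show "\<gamma> (zsharp \<alpha> l) = \<gamma> ((1 / 4) *\<^sub>C lie (tsharp l) (tsharp \<alpha>))"
    by (simp add: dual_scaleC[OF c])
qed

text \<open>
  The map \<open>t : \<gg>\<^sup>* \<rightarrow> \<gg>\<close> intertwines \<open>A\<^sub>l\<^sup>2\<close> with \<open>\<onequarter> (ad t\<^sup>\<or>(l))\<^sup>2\<close>.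
\<close>

lemma double_ad_pow_even_t:
  assumes a: "\<alpha> \<in> dual" and l: "l \<in> dual"
  shows "\<exists>\<alpha>'\<in>dual. double_ad_pow l (2 * n) (0, \<alpha>) = (0, \<alpha>')
    \<and> tsharp \<alpha>' = (1 / 4) ^ n *\<^sub>C (lie (tsharp l) ^^ (2 * n)) (tsharp \<alpha>)"
proof (induction n)
  case 0
  then show ?case using a by (simp add: scaleC_one)
next
  case (Suc n)
  then obtain \<alpha>' where d: "\<alpha>' \<in> dual" and p: "double_ad_pow l (2 * n) (0, \<alpha>) = (0, \<alpha>')"
    and th: "tsharp \<alpha>' = (1 / 4) ^ n *\<^sub>C (lie (tsharp l) ^^ (2 * n)) (tsharp \<alpha>)" by auto
  let ?\<alpha> = "\<lambda>v. l (lie (zsharp \<alpha>' l) v)"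
  have "double_ad_pow l (2 * Suc n) (0, \<alpha>) = double_ad l (double_ad l (double_ad_pow l (2 * n) (0, \<alpha>)))" by simp
  also have "\<dots> = (0, ?\<alpha>)"
    using l by (simp add: p double_ad_def zsharp_zero0 dual_zero)
  finally have "double_ad_pow l (2 * Suc n) (0, \<alpha>) = (0, ?\<alpha>)" .
  moreover have "tsharp ?\<alpha> = lie (tsharp l) (zsharp \<alpha>' l)"
    unfolding tsharp_lie[OF l] lie_swap[of "tsharp l"] ..
  then have "tsharp ?\<alpha> = (1 / 4) ^ Suc n *\<^sub>C (lie (tsharp l) ^^ (2 * Suc n)) (tsharp \<alpha>)"
    unfolding zsharp_t[OF d l] th by (simp add: lie_scaleC_right scaleC_scaleC)
  ultimately show ?case using dual_lie[OF l] by blast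
qed

lemma double_ad_pow_odd_t:
  assumes a: "\<alpha> \<in> dual" and l: "l \<in> dual"
  shows "fst (double_ad_pow l (2 * n + 1) (0, \<alpha>)) = (1 / 4) ^ Suc n *\<^sub>C (lie (tsharp l) ^^ (2 * n + 1)) (tsharp \<alpha>)"
proof -
  obtain \<alpha>' where d: "\<alpha>' \<in> dual" and p: "double_ad_pow l (2 * n) (0, \<alpha>) = (0, \<alpha>')"
    and th: "tsharp \<alpha>' = (1 / 4) ^ n *\<^sub>C (lie (tsharp l) ^^ (2 * n)) (tsharp \<alpha>)"
    using double_ad_pow_even_t[OF assms] by blast
  have "fst (double_ad_pow l (2 * n + 1) (0, \<alpha>)) = zsharp \<alpha>' l" by (simp add: p double_ad_def)
  then show ?thesis unfolding zsharp_t[OF d l] th by (simp add: lie_scaleC_right scaleC_scaleC)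
qed

lemma id_tensor_ad_funpow:
  "(id_tensor_ad y ^^ k) t [\<alpha>, \<beta>] = t [\<alpha>, \<lambda>v. \<beta> ((lie y ^^ k) v)]"
  by (induction k arbitrary: \<beta>) (simp_all add: id_tensor_ad_def)

lemma rho_Z_eq_rho_AM:
  assumes l: "l \<in> dual" and a: "\<alpha> \<in> dual" and b: "\<beta> \<in> dual"
  shows "rho_Z B Z k l [\<alpha>, \<beta>] = rho_AM B t k l [\<alpha>, \<beta>]"
proof (cases "even k")
  case True
  then show ?thesis by (simp add: rho_Z_even rho_AM_def phi_nth coth_coeff_even)
next
  case False
  then obtain n where k: "k = 2 * n + 1" by (rule oddE)
  have "(\<lambda>v. \<beta> ((lie y ^^ j) v)) \<in> dual" for y and j :: nat
    using b by (rule dual_lie_funpow)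
  then have "rho_AM B t k l [\<alpha>, \<beta>] = (1 / 2) ^ Suc k * coth_coeff k * \<beta> ((lie (tsharp l) ^^ k) (tsharp \<alpha>))"
    using dual_tsharp[OF a] by (simp add: rho_AM_def phi_nth id_tensor_ad_funpow)
  moreover have "(1 / 2) ^ Suc k = (1 / 4 :: complex) ^ Suc n"
  proof -
    have "(1 / 2) ^ Suc k = ((1 / 2 :: complex) ^ 2) ^ Suc n"
      unfolding power_mult[symmetric] by (simp add: k)
    then show ?thesis by (simp add: power2_eq_square)
  qed
  ultimately show ?thesis
    unfolding rho_Z_values(1)[OF l a b] k double_ad_pow_odd_t[OF a l] by (simp add: dual_scaleC[OF b])
qed

end

theorem proposition3p2:
  fixes B :: "'g::complex_lie_algebra set" and Z :: "'g tensor"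
  assumes "finite_dimensional_vector_space (scaleC :: complex \<Rightarrow> 'g \<Rightarrow> 'g) B"
    and "Z \<in> wedge 3" and "invariant_tensor 3 Z"
  shows "(rho_Z B Z \<in> formal_maps \<and> invariant_formal_map (rho_Z B Z) \<and>
          satisfies_mCDYBE B Z (rho_Z B Z)) \<and>
         (\<forall>t. t \<in> sym_tensors 2 \<and> invariant_tensor 2 t \<and>
            upow_eq 3 (place B [1, 2, 3] Z)
              (scalar (1 / 4) * comm (place B [1, 2] t) (place B [2, 3] t)) \<longrightarrow>
            (\<forall>k. \<forall>l\<in>dual. \<forall>\<alpha>\<in>dual. \<forall>\<beta>\<in>dual.
               rho_Z B Z k l [\<alpha>, \<beta>] = rho_AM B t k l [\<alpha>, \<beta>]))"
proof -
  interpret lie_3form B Z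
    by (intro lie_3form.intro lie_basis.intro lie_3form_axioms.intro assms)
  have "rho_Z B Z k l [\<alpha>, \<beta>] = rho_AM B t k l [\<alpha>, \<beta>]"
    if "t \<in> sym_tensors 2" "invariant_tensor 2 t"
      "upow_eq 3 (place B [1, 2, 3] Z) (scalar (1 / 4) * comm (place B [1, 2] t) (place B [2, 3] t))"
      "l \<in> dual" "\<alpha> \<in> dual" "\<beta> \<in> dual" for t k l \<alpha> \<beta>
  proof -
    interpret lie_casimir B Z t
      by (intro lie_casimir.intro lie_casimir_axioms.intro lie_3form_axioms that(1-3))
    show ?thesis by (rule rho_Z_eq_rho_AM) (fact that)+
  qed
  then show ?thesis
    using rho_Z_formal_map rho_Z_invariant rho_Z_mCDYBE by blast
qed

end
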